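(* Let $\rho_1,\rho_2\colon\mathrm{Isom}(\mathbf H^1_{\mathbb C})_o\to\mathrm{Isom}(\mathbf H^\infty_{\mathbb C})_o$ be irreducible representations with $\ell(\rho_1)=\ell(\rho_2)=t$. Suppose they have the same distinguished boundary points: there are $\eta_1,\eta_2\in\partial\mathbf H^\infty_{\mathbb C}$ such that for $i=1,2$, $\eta_1$ is fixed by $\rho_i(g(\lambda,b))$ for all $\lambda>0,b\in\mathbb R$ and $\eta_2$ is fixed by $\rho_i(g(\lambda,0))$ for all $\lambda>0$. Fix isotropic representatives with $B(\eta_1,\eta_2)=1$ and let $K_i(1)$ be the quantity $K(1)$ of $\rho_i$ computed with these representatives. Then there exists an irreducible representation $\rho\colon\mathrm{Isom}(\mathbf H^1_{\mathbb C})_o\to\mathrm{Isom}(\mathbf H^\infty_{\mathbb C})_o$ with $\ell(\rho)=t$ and $\mathrm{Arg}(\rho)=\arg\big(K_1(1)+K_2(1)\big)$.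
   Context: Complex hyperbolic spaces: $\mathcal H$ a separable complex Hilbert space with a strongly non-degenerate Hermitian form $B$ (linear in the first variable) of signature $(1,n)$; $\mathbf H^n_{\mathbb C}=\{[v]:B(v,v)>0\}$ with $\cosh d([v],[w])=|B(v,w)|/\sqrt{B(v,v)B(w,w)}$, boundary = isotropic lines, $\mathrm{Isom}(\mathbf H^n_{\mathbb C})_o=PU(B)$; complex hyperbolic subspaces are projectivizations of closed complex subspaces of signature $(1,m')$. For $\mathbf H^1_{\mathbb C}$: $\mathbb C^2$ with $B(z,w)=z_1\bar w_1-z_2\bar w_2$, $\xi_1=(e_1+e_2)/\sqrt2,\ \xi_2=(e_1-e_2)/\sqrt2$; $g(\lambda,b)\in SU(1,1)$ ($\lambda>0,b\in\mathbb R$) has matrix $\begin{pmatrix}\lambda&ib\\0&\lambda^{-1}\end{pmatrix}$ in the basis $(\xi_1,\xi_2)$; the same symbol denotes the induced isometry. Representations are orbitally continuous homomorphisms; non-elementary = no fixed point in $\mathbf H^\infty_{\mathbb C}\cup\partial\mathbf H^\infty_{\mathbb C}$ and no invariant pair of boundary points; irreducible = non-elementary with no proper invariant complex hyperbolic subspace. For non-elementary $\rho$, the point $\eta_1$ fixed by all $\rho(g(\lambda,b))$ is unique, and $\eta_2$ is the other endpoint of the common axis of the hyperbolic isometries $\rho(g(\lambda,0))$, $\lambda\neq 1$. With isotropic representatives $B(\eta_1,\eta_2)=1$ and $E=\eta_1^\perp\cap\eta_2^\perp$: for $b\in\mathbb R$ let $T_b\in U(B)$ be the lift of $\rho(g(1,b))$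 with $T_b\eta_1=\eta_1$; then $T_b\eta_2=K(b)\eta_1+\eta_2+c(b)$ with $K(b)\in\mathbb C$, $c(b)\in E$. $\ell(\rho)$ is the $t>0$ with $\inf_xd(\rho(g(\lambda,0))x,x)=t|\ln\lambda|$ for all $\lambda>0$; $\mathrm{Arg}(\rho)$ is the argument of $K(1)$ (independent of choices). *)

theory Defs
  imports "HOL-Analysis.Analysis"
begin

type_synonym vect = "nat \<Rightarrow> complex"

definition L2 :: "vect set" where
  "L2 = {z. summable (\<lambda>k. (cmod (z k))\<^sup>2)}"

definition l2norm :: "vect \<Rightarrow> real" where
  "l2norm z = sqrt (\<Sum>k. (cmod (z k))\<^sup>2)"

definition Bf :: "vect \<Rightarrow> vect \<Rightarrow> complex" where
  "Bf z w = z 0 * cnj (w 0) - (\<Sum>k. z (Suc k) * cnj (w (Suc k)))"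

definition sc :: "complex \<Rightarrow> vect \<Rightarrow> vect" where
  "sc c v = (\<lambda>k. c * v k)"

definition vadd :: "vect \<Rightarrow> vect \<Rightarrow> vect" where
  "vadd v w = (\<lambda>k. v k + w k)"

definition line :: "vect \<Rightarrow> vect set" where
  "line v = {sc c v | c. c \<noteq> 0}"

definition Lines :: "vect set set" where
  "Lines = {line v | v. v \<in> L2 \<and> v \<noteq> (\<lambda>k. 0)}"

definition HPts :: "vect set set" where
  "HPts = {line v | v. v \<in> L2 \<and> Re (Bf v v) > 0}"

definition BdPts :: "vect set set" where
  "BdPts = {line v | v. v \<in> L2 \<and> v \<noteq> (\<lambda>k. 0) \<and> Bf v v = 0}"

definition hdist :: "vect set \<Rightarrow> vect set \<Rightarrow> real" where
  "hdist L M = (let v = (SOME v. v \<in> L); w = (SOME w. w \<in> M) in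
      arcosh (cmod (Bf v w) / sqrt (Re (Bf v v) * Re (Bf w w))))"

definition unitaryB :: "(vect \<Rightarrow> vect) \<Rightarrow> bool" where
  "unitaryB T \<longleftrightarrow> bij_betw T L2 L2
     \<and> (\<forall>x\<in>L2. \<forall>y\<in>L2. \<forall>a b. T (vadd (sc a x) (sc b y)) = vadd (sc a (T x)) (sc b (T y)))
     \<and> (\<forall>x\<in>L2. \<forall>y\<in>L2. Bf (T x) (T y) = Bf x y)
     \<and> (\<exists>C. \<forall>x\<in>L2. l2norm (T x) \<le> C * l2norm x)"

definition lifts :: "(vect \<Rightarrow> vect) \<Rightarrow> (vect set \<Rightarrow> vect set) \<Rightarrow> bool" where
  "lifts T f \<longleftrightarrow> (\<forall>v\<in>L2. v \<noteq> (\<lambda>k. 0) \<longrightarrow> f (line v) = line (T v))"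

definition Jm :: "complex^2^2" where
  "Jm = (\<chi> i j. if i = j then (if i = 1 then 1 else -1) else 0)"

definition adjm :: "complex^2^2 \<Rightarrow> complex^2^2" where
  "adjm g = (\<chi> i j. cnj (g $ j $ i))"

definition SU11 :: "(complex^2^2) set" where
  "SU11 = {g. det g = 1 \<and> adjm g ** Jm ** g = Jm}"

text \<open>Change of basis matrix with columns xi1 = (e1+e2)/sqrt 2, xi2 = (e1-e2)/sqrt 2;
  it is its own inverse.\<close>
definition Pm :: "complex^2^2" where
  "Pm = (\<chi> i j. (if i = 2 \<and> j = 2 then -1 else 1) / complex_of_real (sqrt 2))"

definition gmat :: "real \<Rightarrow> real \<Rightarrow> complex^2^2" where
  "gmat l b = Pm ** (\<chi> i j. if i = 1 \<and> j = 1 then complex_of_real l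
                          else if i = 1 \<and> j = 2 then \<i> * complex_of_real b
                          else if i = 2 \<and> j = 2 then complex_of_real (1 / l) else 0) ** Pm"

text \<open>A representation of Isom(H^1_C)_o = PU(1,1) = SU(1,1)/{+-I} into
  Isom(H^infty_C)_o = PU(B), given as a map on SU(1,1) that is trivial on -I.
  Each rho g acts on lines and is induced by an element of U(B); rho is a
  homomorphism and orbitally continuous.\<close>
definition is_rep :: "(complex^2^2 \<Rightarrow> vect set \<Rightarrow> vect set) \<Rightarrow> bool" where
  "is_rep \<rho> \<longleftrightarrow>
     (\<forall>g\<in>SU11. \<exists>T. unitaryB T \<and> lifts T (\<rho> g))
   \<and> (\<forall>g\<in>SU11. \<forall>h\<in>SU11. \<forall>L\<in>Lines. \<rho> (g ** h) L = \<rho> g (\<rho> h L))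
   \<and> (\<forall>L\<in>Lines. \<rho> (- mat 1) L = L)
   \<and> (\<forall>x\<in>HPts. \<forall>g\<in>SU11. \<forall>\<epsilon>>0. \<exists>\<delta>>0. \<forall>h\<in>SU11.
         norm (h - g) < \<delta> \<longrightarrow> hdist (\<rho> h x) (\<rho> g x) < \<epsilon>)"

definition non_elementary :: "(complex^2^2 \<Rightarrow> vect set \<Rightarrow> vect set) \<Rightarrow> bool" where
  "non_elementary \<rho> \<longleftrightarrow>
     \<not> (\<exists>x \<in> HPts \<union> BdPts. \<forall>g\<in>SU11. \<rho> g x = x)
   \<and> \<not> (\<exists>x\<in>BdPts. \<exists>y\<in>BdPts. x \<noteq> y \<and> (\<forall>g\<in>SU11. \<rho> g ` {x, y} = {x, y}))"

text \<open>Closed complex subspaces of signature (1,m'): a unit positive vector v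
  whose B-orthogonal complement in W is negative definite.\<close>
definition hyp_subspace :: "vect set \<Rightarrow> bool" where
  "hyp_subspace W \<longleftrightarrow> W \<subseteq> L2 \<and> (\<lambda>k. 0) \<in> W
     \<and> (\<forall>x\<in>W. \<forall>y\<in>W. vadd x y \<in> W) \<and> (\<forall>c. \<forall>x\<in>W. sc c x \<in> W)
     \<and> (\<forall>f z. (\<forall>n. f n \<in> W) \<longrightarrow> z \<in> L2 \<longrightarrow>
            (\<lambda>n. l2norm (\<lambda>k. f n k - z k)) \<longlonglongrightarrow> 0 \<longrightarrow> z \<in> W)
     \<and> (\<exists>v\<in>W. Bf v v = 1 \<and> (\<forall>w\<in>W. Bf w v = 0 \<and> w \<noteq> (\<lambda>k. 0) \<longrightarrow> Re (Bf w w) < 0))"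

definition projW :: "vect set \<Rightarrow> vect set set" where
  "projW W = {line v | v. v \<in> W \<and> Re (Bf v v) > 0}"

definition irreducible_rep :: "(complex^2^2 \<Rightarrow> vect set \<Rightarrow> vect set) \<Rightarrow> bool" where
  "irreducible_rep \<rho> \<longleftrightarrow> is_rep \<rho> \<and> non_elementary \<rho>
     \<and> \<not> (\<exists>W. hyp_subspace W \<and> projW W \<noteq> HPts
              \<and> (\<forall>g\<in>SU11. \<forall>x\<in>projW W. \<rho> g x \<in> projW W))"

definition transl_length :: "(vect set \<Rightarrow> vect set) \<Rightarrow> real" where
  "transl_length f = Inf {hdist (f x) x | x. x \<in> HPts}"

definition has_ell :: "(complex^2^2 \<Rightarrow> vect set \<Rightarrow> vect set) \<Rightarrow> real \<Rightarrow> bool" where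
  "has_ell \<rho> t \<longleftrightarrow> t > 0 \<and> (\<forall>l>0. transl_length (\<rho> (gmat l 0)) = t * \<bar>ln l\<bar>)"

definition dist_reps :: "(complex^2^2 \<Rightarrow> vect set \<Rightarrow> vect set) \<Rightarrow> vect \<Rightarrow> vect \<Rightarrow> bool" where
  "dist_reps \<rho> e1 e2 \<longleftrightarrow> e1 \<in> L2 \<and> e2 \<in> L2 \<and> Bf e1 e1 = 0 \<and> Bf e2 e2 = 0 \<and> Bf e1 e2 = 1
     \<and> (\<forall>l>0. \<forall>b. \<rho> (gmat l b) (line e1) = line e1)
     \<and> (\<forall>l>0. \<rho> (gmat l 0) (line e2) = line e2)"

definition Espace :: "vect \<Rightarrow> vect \<Rightarrow> vect set" where
  "Espace e1 e2 = {c \<in> L2. Bf c e1 = 0 \<and> Bf c e2 = 0}"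

definition K1_of :: "(complex^2^2 \<Rightarrow> vect set \<Rightarrow> vect set) \<Rightarrow> vect \<Rightarrow> vect \<Rightarrow> complex \<Rightarrow> bool" where
  "K1_of \<rho> e1 e2 K \<longleftrightarrow> (\<exists>T. unitaryB T \<and> lifts T (\<rho> (gmat 1 1)) \<and> T e1 = e1
     \<and> (\<exists>c\<in>Espace e1 e2. T e2 = vadd (vadd (sc K e1) e2) c))"

text \<open>Arg(rho) = theta: K(1) can be formed, and its argument is theta for every
  admissible choice (the paper shows independence of choices).\<close>
definition Arg_rep :: "(complex^2^2 \<Rightarrow> vect set \<Rightarrow> vect set) \<Rightarrow> real \<Rightarrow> bool" where
  "Arg_rep \<rho> \<theta> \<longleftrightarrow> (\<exists>e1 e2 K. dist_reps \<rho> e1 e2 \<and> K1_of \<rho> e1 e2 K)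
     \<and> (\<forall>e1 e2 K. dist_reps \<rho> e1 e2 \<and> K1_of \<rho> e1 e2 K \<longrightarrow> Arg K = \<theta>)"

end

(* Let e1, e2 be the common boundary vectors and B(e1,e2) = 1. For a representation rho with these
   data let y(b) be the vector of the line rho(g(1,b)) e2 with B(y(b),e1) = 1. Then
   B(y(a),y(b)) = K(a-b), and conjugation by g(l,0) gives K(b) = |b|^t K(1) for b > 0, while
   K(-b) is the conjugate of K(b). The E-components of the y(b) show that
   K(a) + cnj K(b) - K(a-b) is positive definite; testing it against b = n |-> zeta^n (n >= 0), with
   zeta tending to 1 along rays, gives Re (K(1) e^{i s (t-1)}) >= 0 for |s| <= pi/2. Together with
   0 < t < 2 and Re K(1) > 0, which follow from irreducibility, these conditions are linear in K(1),
   hence pass to K1(1) + K2(1).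

   Conversely every t and K(1) satisfying them is realised. With p + q = t and q - p = 2 arg K(1) / pi
   one has p, q in [0,1], and the kernel (1-u)^p (1-cnj u)^q on the circle has exactly one positive
   Fourier coefficient, the constant one, and infinitely many negative ones. So
   Phi(z)_n = sqrt |a_n| z^n defines a total family in H^infinity whose Gram matrix is this kernel at
   z cnj w. The kernel is SU(1,1)-invariant up to a multiplier, which yields the representation. *)

theory Submission
  imports Defs
begin

section \<open>The Hilbert space underlying the form\<close>

text \<open>The given representations are never glued together: positivity of the sum of their
  kernels concerns only the stabiliser of eta_1 and says nothing about the rest of the group. Hence
  the detour through a description of all pairs (t, K(1)) that occur. In the coordinates p, q the
  sector condition |arg K(1)| + |t-1| pi/2 <= pi/2 is the unit square, and 0 < t < 2 together with
  Re K(1) > 0 removes its four corners, where the circle kernel is a trigonometric polynomial and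
  the model would be finite-dimensional. The formula for q - p has its origin in the parabolic
  g(1,1), which moves -1 to -i on the circle: K(1) is a positive multiple of the quotient of the
  kernel values at i and -i, that is of (-i)^p i^q. The other obstacle is that B is indefinite, so
  preserving B does not bound the Hilbert norm. Every bound comes from following one positive vector
  v, since B(x,x) and B(x,v) together control the norm of x.\<close>

lemma mult_cnj_cmod: "z * cnj z = complex_of_real ((cmod z)\<^sup>2)"
  by (simp only: complex_norm_square)

lemma L2_scale: "z \<in> L2 \<Longrightarrow> (\<lambda>k. c * z k) \<in> L2"
  by (auto simp: L2_def norm_mult power_mult_distrib intro: summable_mult)

lemma norm_add_sq_le: "(norm (a + b :: 'a::real_normed_vector))\<^sup>2 \<le> 2 * (norm a)\<^sup>2 + 2 * (norm b)\<^sup>2"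
proof -
  have "(norm (a + b))\<^sup>2 \<le> (norm a + norm b)\<^sup>2"
    by (simp add: norm_triangle_ineq)
  also have "\<dots> \<le> 2 * (norm a)\<^sup>2 + 2 * (norm b)\<^sup>2"
    using sum_squares_bound[of "norm a" "norm b"] by (simp add: power2_sum)
  finally show ?thesis .
qed

lemma L2_add:
  assumes "z \<in> L2" "w \<in> L2" shows "(\<lambda>k. z k + w k) \<in> L2"
proof -
  have "summable (\<lambda>k. 2 * (cmod (z k))\<^sup>2 + 2 * (cmod (w k))\<^sup>2)"
    using assms by (intro summable_add summable_mult) (auto simp: L2_def)
  then show ?thesis
    unfolding L2_def by (simp add: summable_comparison_test' norm_add_sq_le)
qed

text \<open>With a type of its own the sequence space becomes an instance of the topological type
  classes, so that closures, limits and completeness are available; \<open>coord\<close> leads back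
  to the functions of the statement.\<close>

typedef l2 = L2 morphisms coord l2_of
  by (rule exI[of _ "\<lambda>k. 0"]) (simp add: L2_def)

setup_lifting type_definition_l2

lemma coord_L2 [simp]: "coord x \<in> L2"
  by (rule coord)

lemma summable_coord_sq [simp]: "summable (\<lambda>k. (cmod (coord x k))\<^sup>2)"
  using coord[of x] unfolding L2_def by (rule CollectD)

lemma l2_eqI: "(\<And>k. coord x k = coord y k) \<Longrightarrow> x = y"
  by (metis coord_inject ext)

lemma summable_coord_mult:
  "summable (\<lambda>k. cmod (coord x k * cnj (coord y k)))"
proof (rule summable_comparison_test')
  show "summable (\<lambda>k. (cmod (coord x k))\<^sup>2 + (cmod (coord y k))\<^sup>2)"
    by (intro summable_add) auto
  fix k
  show "norm (cmod (coord x k * cnj (coord y k))) \<le> (cmod (coord x k))\<^sup>2 + (cmod (coord y k))\<^sup>2"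
    using sum_squares_bound[of "cmod (coord x k)" "cmod (coord y k)"]
      mult_nonneg_nonneg[OF norm_ge_zero norm_ge_zero, of "coord x k" "coord y k"]
    unfolding norm_mult real_norm_def abs_mult complex_mod_cnj abs_norm_cancel by linarith
qed

lemma summable_coord_mult' [simp]: "summable (\<lambda>k. coord x k * cnj (coord y k))"
  using summable_coord_mult by (rule summable_norm_cancel)

definition cin :: "l2 \<Rightarrow> l2 \<Rightarrow> complex" where
  "cin x y = (\<Sum>k. coord x k * cnj (coord y k))"

instantiation l2 :: ab_group_add
begin
lift_definition zero_l2 :: l2 is "\<lambda>k. 0" by (simp add: L2_def)
lift_definition plus_l2 :: "l2 \<Rightarrow> l2 \<Rightarrow> l2" is "\<lambda>x y k. x k + y k" by (rule L2_add)
lift_definition uminus_l2 :: "l2 \<Rightarrow> l2" is "\<lambda>x k. - x k" by (simp add: L2_def)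
lift_definition minus_l2 :: "l2 \<Rightarrow> l2 \<Rightarrow> l2" is "\<lambda>x y k. x k - y k"
proof -
  fix f g :: vect assume "f \<in> L2" "g \<in> L2"
  then show "(\<lambda>k. f k - g k) \<in> L2" using L2_add[OF _ L2_scale[of g "-1"], of f] by simp
qed
instance by intro_classes (transfer; simp add: fun_eq_iff algebra_simps)+
end

lift_definition scaleC :: "complex \<Rightarrow> l2 \<Rightarrow> l2" (infixr "*\<^sub>C" 75) is "\<lambda>c x k. c * x k"
  by (rule L2_scale)

lemma coord_simps [simp]:
  "coord 0 k = 0" "coord (x + y) k = coord x k + coord y k"
  "coord (x - y) k = coord x k - coord y k" "coord (- x) k = - coord x k"
  "coord (c *\<^sub>C x) k = c * coord x k"
  by (transfer; simp)+

instantiation l2 :: real_inner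
begin
definition scaleR_l2 :: "real \<Rightarrow> l2 \<Rightarrow> l2" where "scaleR_l2 r x = complex_of_real r *\<^sub>C x"
definition inner_l2 :: "l2 \<Rightarrow> l2 \<Rightarrow> real" where "inner_l2 x y = Re (cin x y)"
definition norm_l2 :: "l2 \<Rightarrow> real" where "norm_l2 x = sqrt (inner x x)"
definition dist_l2 :: "l2 \<Rightarrow> l2 \<Rightarrow> real" where "dist_l2 x y = norm (x - y)"
definition sgn_l2 :: "l2 \<Rightarrow> l2" where "sgn_l2 x = complex_of_real (inverse (norm x)) *\<^sub>C x"
definition uniformity_l2 :: "(l2 \<times> l2) filter"
  where "uniformity_l2 = (INF e\<in>{0<..}. principal {(x, y). dist x y < e})"
definition open_l2 :: "l2 set \<Rightarrow> bool"
  where "open_l2 U \<longleftrightarrow> (\<forall>x\<in>U. eventually (\<lambda>(x', y). x' = x \<longrightarrow> y \<in> U) uniformity)"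

instance
proof
  fix x y z :: l2 and a b :: real
  show "dist x y = norm (x - y)" by (rule dist_l2_def)
  show "a *\<^sub>R (x + y) = a *\<^sub>R x + a *\<^sub>R y" "(a + b) *\<^sub>R x = a *\<^sub>R x + b *\<^sub>R x"
    "a *\<^sub>R b *\<^sub>R x = (a * b) *\<^sub>R x" "1 *\<^sub>R x = x"
    by (auto simp: scaleR_l2_def algebra_simps intro!: l2_eqI)
  show "sgn x = inverse (norm x) *\<^sub>R x" by (simp only: sgn_l2_def scaleR_l2_def)
  show "(uniformity :: (l2 \<times> l2) filter) = (INF e\<in>{0<..}. principal {(x, y). dist x y < e})"
    by (rule uniformity_l2_def)
  show "open U \<longleftrightarrow> (\<forall>x\<in>U. eventually (\<lambda>(x', y). x' = x \<longrightarrow> y \<in> U) uniformity)"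
    for U :: "l2 set" by (rule open_l2_def)
  have Re_cin: "Re (cin u v) = (\<Sum>k. Re (coord u k * cnj (coord v k)))" for u v
    unfolding cin_def using bounded_linear.suminf[OF bounded_linear_Re summable_coord_mult'] by simp
  have smR: "summable (\<lambda>k. Re (coord u k * cnj (coord v k)))" for u v
    using bounded_linear.summable[OF bounded_linear_Re summable_coord_mult'] .
  show "inner x y = inner y x"
    unfolding inner_l2_def Re_cin by (simp add: mult.commute)
  show "inner (x + y) z = inner x z + inner y z"
    unfolding inner_l2_def cin_def by (simp add: distrib_right suminf_add[symmetric])
  show "inner (a *\<^sub>R x) y = a * inner x y"
    unfolding inner_l2_def cin_def scaleR_l2_def by (simp add: suminf_mult mult.assoc)
  have xx: "inner x x = (\<Sum>k. (cmod (coord x k))\<^sup>2)"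
    unfolding inner_l2_def Re_cin by (simp add: complex_mult_cnj cmod_power2)
  show "0 \<le> inner x x" unfolding xx by (simp add: suminf_nonneg)
  show "inner x x = 0 \<longleftrightarrow> x = 0"
    unfolding xx by (subst suminf_eq_zero_iff) (auto intro: l2_eqI)
  show "norm x = sqrt (inner x x)" by (rule norm_l2_def)
qed
end

lemma scaleR_scaleC: "r *\<^sub>R x = complex_of_real r *\<^sub>C x"
  by (rule scaleR_l2_def)

lemma scaleC_simps [simp]: "1 *\<^sub>C x = x" "0 *\<^sub>C x = 0" "c *\<^sub>C 0 = 0" "c *\<^sub>C d *\<^sub>C x = (c * d) *\<^sub>C x"
  by (auto intro!: l2_eqI)

lemma scaleC_add: "c *\<^sub>C (x + y) = c *\<^sub>C x + c *\<^sub>C y" "(c + d) *\<^sub>C x = c *\<^sub>C x + d *\<^sub>C x"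
  "c *\<^sub>C (x - y) = c *\<^sub>C x - c *\<^sub>C y" "(c - d) *\<^sub>C x = c *\<^sub>C x - d *\<^sub>C x"
  "(- c) *\<^sub>C x = - (c *\<^sub>C x)" "c *\<^sub>C (- x) = - (c *\<^sub>C x)"
  by (auto intro!: l2_eqI simp: algebra_simps)

lemma scaleC_eq_0_iff [simp]: "c *\<^sub>C x = 0 \<longleftrightarrow> c = 0 \<or> x = 0"
proof
  assume h: "c *\<^sub>C x = 0"
  show "c = 0 \<or> x = 0"
  proof (cases "c = 0")
    case False
    have "x = inverse c *\<^sub>C (c *\<^sub>C x)" using False by simp
    then show ?thesis unfolding h by simp
  qed simp
qed auto

lemma cin_add: "cin (x + y) z = cin x z + cin y z" "cin x (y + z) = cin x y + cin x z"
  and cin_diff: "cin (x - y) z = cin x z - cin y z" "cin x (y - z) = cin x y - cin x z"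
  and cin_scale: "cin (c *\<^sub>C x) y = c * cin x y" "cin x (c *\<^sub>C y) = cnj c * cin x y"
  and cin_uminus: "cin (- x) y = - cin x y" "cin x (- y) = - cin x y"
  unfolding cin_def
  by (simp_all add: ring_distribs mult.assoc mult.left_commute suminf_add suminf_diff suminf_mult suminf_minus
      flip: suminf_add suminf_diff suminf_mult suminf_minus)

lemma cin_cnj: "cnj (cin x y) = cin y x"
  unfolding cin_def using bounded_linear.suminf[OF bounded_linear_cnj summable_coord_mult'[of x y]]
  by (simp add: mult.commute)

lemma norm_l2_sq: "(norm x)\<^sup>2 = (\<Sum>k. (cmod (coord x k))\<^sup>2)"
proof -
  have "(norm x)\<^sup>2 = Re (cin x x)"
    by (simp add: power2_norm_eq_inner inner_l2_def)
  also have "\<dots> = (\<Sum>k. Re (coord x k * cnj (coord x k)))"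
    unfolding cin_def using bounded_linear.suminf[OF bounded_linear_Re summable_coord_mult'] by simp
  finally show ?thesis by (simp add: complex_mult_cnj cmod_power2)
qed

lemma norm_l2norm: "norm x = l2norm (coord x)"
  by (metis l2norm_def norm_ge_zero norm_l2_sq real_sqrt_abs abs_of_nonneg)

lemma cin_self: "cin x x = complex_of_real ((norm x)\<^sup>2)"
proof -
  have "cnj (cin x x) = cin x x" by (rule cin_cnj)
  then have "Im (cin x x) = 0" by (metis complex_cnj_cancel_iff complex.sel(2) cnj.simps(2) equal_neg_zero)
  moreover have "Re (cin x x) = (norm x)\<^sup>2" by (simp add: power2_norm_eq_inner inner_l2_def)
  ultimately show ?thesis by (simp add: complex_eq_iff)
qed

lemma norm_scaleC [simp]: "norm (c *\<^sub>C x) = cmod c * norm x"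
proof -
  have "(norm (c *\<^sub>C x))\<^sup>2 = (cmod c * norm x)\<^sup>2"
    unfolding norm_l2_sq by (simp add: norm_mult power_mult_distrib norm_l2_sq suminf_mult)
  then show ?thesis by (simp add: power2_eq_iff_nonneg)
qed

text \<open>Multiplying \<open>x\<close> by the phase that makes \<open>cin x y\<close> nonnegative
  reduces this to the real Cauchy-Schwarz inequality.\<close>

lemma norm_cin_le: "cmod (cin x y) \<le> norm x * norm y"
proof (cases "cin x y = 0")
  case False
  define c where "c = cnj (cin x y) / cmod (cin x y)"
  have c1: "cmod c = 1" using False by (simp add: c_def norm_divide)
  have "c * cin x y = complex_of_real (cmod (cin x y))"
    using False by (simp add: c_def complex_norm_square[symmetric] power2_eq_square mult.commute)
  then have "cmod (cin x y) = inner (c *\<^sub>C x) y"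
    by (simp add: inner_l2_def cin_scale)
  also have "\<dots> \<le> norm (c *\<^sub>C x) * norm y" by (rule norm_cauchy_schwarz)
  finally show ?thesis by (simp add: c1)
qed simp

lemma cmod_coord_le: "cmod (coord x k) \<le> norm x"
proof -
  have "(cmod (coord x k))\<^sup>2 \<le> (\<Sum>k. (cmod (coord x k))\<^sup>2)"
    using sum_le_suminf[of "\<lambda>k. (cmod (coord x k))\<^sup>2" "{k}"] by simp
  then show ?thesis unfolding norm_l2_sq[symmetric] by (simp add: power2_le_iff_abs_le)
qed

text \<open>Coordinates converge, and the Cauchy bound on each finite partial sum survives the
  coordinatewise limit. Being uniform in the length of the sum, it gives both square summability of
  the limit and convergence in norm.\<close>

instance l2 :: complete_space
proof
  fix X :: "nat \<Rightarrow> l2" assume "Cauchy X"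
  have C: "\<exists>M. \<forall>m\<ge>M. \<forall>n\<ge>M. norm (X m - X n) < e" if "e > 0" for e
    using CauchyD[OF \<open>Cauchy X\<close> that] .
  have "Cauchy (\<lambda>n. coord (X n) k)" for k
  proof (rule CauchyI)
    fix e :: real assume "e > 0"
    then obtain M where M: "\<forall>m\<ge>M. \<forall>n\<ge>M. norm (X m - X n) < e" using C by blast
    have "norm (coord (X m) k - coord (X n) k) < e" if "m \<ge> M" "n \<ge> M" for m n
      using cmod_coord_le[of "X m - X n" k] M that by fastforce
    then show "\<exists>M. \<forall>m\<ge>M. \<forall>n\<ge>M. norm (coord (X m) k - coord (X n) k) < e" by blast
  qed
  then have "\<exists>l. (\<lambda>n. coord (X n) k) \<longlonglongrightarrow> l" for k
    by (simp add: Cauchy_convergent_iff convergent_def)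
  then obtain z where z: "\<And>k. (\<lambda>n. coord (X n) k) \<longlonglongrightarrow> z k" by metis
  have part: "(\<Sum>k<K. (cmod (coord (X m) k - z k))\<^sup>2) \<le> e\<^sup>2"
    if M: "\<forall>m\<ge>M. \<forall>n\<ge>M. norm (X m - X n) < e" and "m \<ge> M" "e > 0" for M m e K
  proof (rule tendsto_upperbound)
    show "(\<lambda>n. \<Sum>k<K. (cmod (coord (X m) k - coord (X n) k))\<^sup>2) \<longlonglongrightarrow> (\<Sum>k<K. (cmod (coord (X m) k - z k))\<^sup>2)"
      by (intro tendsto_intros z)
    have "(\<Sum>k<K. (cmod (coord (X m) k - coord (X n) k))\<^sup>2) \<le> e\<^sup>2" if "n \<ge> M" for n
    proof -
      have "(\<Sum>k<K. (cmod (coord (X m) k - coord (X n) k))\<^sup>2) \<le> (norm (X m - X n))\<^sup>2"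
        unfolding norm_l2_sq using sum_le_suminf[OF summable_coord_sq[of "X m - X n"], of "{..<K}"] by simp
      also have "\<dots> \<le> e\<^sup>2" using M \<open>m \<ge> M\<close> \<open>n \<ge> M\<close> by (intro power_mono) (auto simp: less_imp_le)
      finally show ?thesis .
    qed
    then show "\<forall>\<^sub>F n in sequentially. (\<Sum>k<K. (cmod (coord (X m) k - coord (X n) k))\<^sup>2) \<le> e\<^sup>2"
      using eventually_sequentially by blast
  qed auto
  have summ: "summable (\<lambda>k. (cmod (coord (X m) k - z k))\<^sup>2)"
    and le: "(\<Sum>k. (cmod (coord (X m) k - z k))\<^sup>2) \<le> e\<^sup>2"
    if M: "\<forall>m\<ge>M. \<forall>n\<ge>M. norm (X m - X n) < e" and "m \<ge> M" "e > 0" for M m e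
  proof -
    show s: "summable (\<lambda>k. (cmod (coord (X m) k - z k))\<^sup>2)"
      by (rule summableI_nonneg_bounded[where x = "e\<^sup>2"]) (use part[OF that] in auto)
    show "(\<Sum>k. (cmod (coord (X m) k - z k))\<^sup>2) \<le> e\<^sup>2"
      using suminf_le_const[OF s] part[OF that] by blast
  qed
  obtain M where M: "\<forall>m\<ge>M. \<forall>n\<ge>M. norm (X m - X n) < 1" using C[of 1] by auto
  have "(\<lambda>k. coord (X M) k - z k) \<in> L2" using summ[OF M] by (simp add: L2_def)
  then have "(\<lambda>k. coord (X M) k + (-1) * (coord (X M) k - z k)) \<in> L2" by (intro L2_add L2_scale coord_L2)
  then have zL: "z \<in> L2" by simp
  have "X \<longlonglongrightarrow> l2_of z"
  proof (rule LIMSEQ_I)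
    fix r :: real assume "r > 0"
    then obtain M where M: "\<forall>m\<ge>M. \<forall>n\<ge>M. norm (X m - X n) < r/2" using C[of "r/2"] by auto
    have "norm (X n - l2_of z) < r" if "n \<ge> M" for n
    proof -
      have "(norm (X n - l2_of z))\<^sup>2 \<le> (r/2)\<^sup>2"
        unfolding norm_l2_sq using le[OF M that] \<open>r > 0\<close> zL by (simp add: l2_of_inverse)
      then show ?thesis using \<open>r > 0\<close> by (simp add: power2_le_iff_abs_le)
    qed
    then show "\<exists>no. \<forall>n\<ge>no. norm (X n - l2_of z) < r" by blast
  qed
  then show "convergent X" by (auto simp: convergent_def)
qed

definition ek :: "nat \<Rightarrow> l2" where "ek k = l2_of (\<lambda>j. if j = k then 1 else 0)"

lemma coord_ek [simp]: "coord (ek k) j = (if j = k then 1 else 0)"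
proof -
  have "(\<lambda>j. if j = k then 1 else 0 :: complex) \<in> L2"
    unfolding L2_def by (auto intro!: summable_finite[of "{k}"] split: if_splits)
  then show ?thesis by (simp add: ek_def l2_of_inverse)
qed

definition csubspace :: "l2 set \<Rightarrow> bool" where
  "csubspace S \<longleftrightarrow> 0 \<in> S \<and> (\<forall>x\<in>S. \<forall>y\<in>S. x + y \<in> S) \<and> (\<forall>c. \<forall>x\<in>S. c *\<^sub>C x \<in> S)"

lemma csubspaceD:
  assumes "csubspace S"
  shows "0 \<in> S" "x \<in> S \<Longrightarrow> y \<in> S \<Longrightarrow> x + y \<in> S" "x \<in> S \<Longrightarrow> c *\<^sub>C x \<in> S"
    "x \<in> S \<Longrightarrow> y \<in> S \<Longrightarrow> x - y \<in> S"
proof -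
  show "0 \<in> S" "x \<in> S \<Longrightarrow> y \<in> S \<Longrightarrow> x + y \<in> S" "x \<in> S \<Longrightarrow> c *\<^sub>C x \<in> S"
    using assms by (auto simp: csubspace_def)
  show "x - y \<in> S" if "x \<in> S" "y \<in> S"
  proof -
    have "(-1) *\<^sub>C y \<in> S" "\<And>z. z \<in> S \<Longrightarrow> x + z \<in> S" using assms that by (auto simp: csubspace_def)
    then have "x + (-1) *\<^sub>C y \<in> S" by blast
    then show ?thesis by (simp add: scaleC_add)
  qed
qed

lemma csubspace_sum: "csubspace S \<Longrightarrow> (\<And>i. i \<in> A \<Longrightarrow> f i \<in> S) \<Longrightarrow> sum f A \<in> S"
  by (induction A rule: infinite_finite_induct) (auto intro: csubspaceD)

lemma coord_sum: "coord (sum f A) k = (\<Sum>i\<in>A. coord (f i) k)"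
  by (induction A rule: infinite_finite_induct) auto

lemma closed_csubspace_UNIV:
  assumes S: "csubspace S" "closed S" and ek: "\<And>k. ek k \<in> S"
  shows "S = UNIV"
proof -
  have "x \<in> S" for x
  proof (rule closed_sequentially[OF S(2)])
    let ?X = "\<lambda>n. \<Sum>k<n. coord x k *\<^sub>C ek k"
    show "?X n \<in> S" for n by (intro csubspace_sum S csubspaceD ek)
    have c: "coord (?X n) j = (if j < n then coord x j else 0)" for n j
      by (simp add: coord_sum if_distrib[of "(*) _"] cong: if_cong) 
    have "(norm (x - ?X n))\<^sup>2 = (\<Sum>k. (cmod (coord x (k + n)))\<^sup>2)" for n
    proof -
      have "(norm (x - ?X n))\<^sup>2 = (\<Sum>k. (cmod (coord x k - (if k < n then coord x k else 0)))\<^sup>2)"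
        by (simp only: norm_l2_sq coord_simps c)
      also have "\<dots> = (\<Sum>k. (cmod (coord x (k + n) - (if k + n < n then coord x (k + n) else 0)))\<^sup>2)"
        using suminf_split_initial_segment[OF summable_coord_sq[of "x - ?X n"], of n]
        by (simp only: coord_simps c) simp
      finally show ?thesis by simp
    qed
    moreover have "(\<lambda>n. \<Sum>k. (cmod (coord x (k + n)))\<^sup>2) \<longlonglongrightarrow> 0"
      by (rule suminf_exist_split2) simp
    ultimately have "(\<lambda>n. (norm (x - ?X n))\<^sup>2) \<longlonglongrightarrow> 0" by simp
    then have "(\<lambda>n. sqrt ((norm (x - ?X n))\<^sup>2)) \<longlonglongrightarrow> sqrt 0" by (rule tendsto_real_sqrt)
    then have "(\<lambda>n. norm (?X n - x)) \<longlonglongrightarrow> 0" by (simp add: norm_minus_commute)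
    then show "?X \<longlonglongrightarrow> x" using LIM_zero_cancel tendsto_norm_zero_iff by blast
  qed
  then show ?thesis by auto
qed

lemma bounded_linear_scaleC: "bounded_linear (\<lambda>x. c *\<^sub>C x)"
  by (rule bounded_linear_intro[where K = "cmod c"]) (auto simp: scaleC_add scaleR_scaleC mult.commute)

lemma bounded_bilinear_scaleC: "bounded_bilinear scaleC"
  by (rule bounded_bilinear.intro)
     (auto simp: scaleC_add scaleR_scaleC scaleR_conv_of_real mult_ac intro!: exI[of _ 1])

lemmas tendsto_scaleC [tendsto_intros] = bounded_bilinear.tendsto[OF bounded_bilinear_scaleC]

lemma bounded_bilinear_cin: "bounded_bilinear cin"
  by (rule bounded_bilinear.intro)
     (auto simp: cin_add cin_scale scaleR_scaleC scaleR_conv_of_real intro!: exI[of _ 1] norm_cin_le)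

lemmas tendsto_cin [tendsto_intros] = bounded_bilinear.tendsto[OF bounded_bilinear_cin]

section \<open>The indefinite form and its norm estimates\<close>

definition BB :: "l2 \<Rightarrow> l2 \<Rightarrow> complex" where
  "BB x y = 2 * coord x 0 * cnj (coord y 0) - cin x y"

text \<open>Coordinate 0 is the only one counted with a plus sign, so adding it twice to
  \<open>- cin\<close> restores \<open>Bf\<close>. Expressed through \<open>cin\<close>, the form
  inherits continuity and norm bounds.\<close>

lemma BB_Bf: "BB x y = Bf (coord x) (coord y)"
  unfolding BB_def Bf_def cin_def
  using suminf_split_head[OF summable_coord_mult'[of x y]] by simp

lemma BB_add: "BB (x + y) z = BB x z + BB y z" "BB x (y + z) = BB x y + BB x z"
  and BB_diff: "BB (x - y) z = BB x z - BB y z" "BB x (y - z) = BB x y - BB x z"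
  and BB_scale: "BB (c *\<^sub>C x) y = c * BB x y" "BB x (c *\<^sub>C y) = cnj c * BB x y"
  and BB_uminus: "BB (- x) y = - BB x y" "BB x (- y) = - BB x y"
  by (simp_all add: BB_def cin_add cin_diff cin_scale cin_uminus algebra_simps)

lemma BB_0: "BB 0 x = 0" "BB x 0 = 0"
  using BB_scale(1)[of 0 0 x] BB_scale(2)[of x 0 0] by simp_all

lemmas BB_lin = BB_add BB_diff BB_scale BB_uminus BB_0

lemma BB_cnj: "cnj (BB x y) = BB y x"
  by (simp add: BB_def cin_cnj)

lemma BB_self: "BB x x = complex_of_real (2 * (cmod (coord x 0))\<^sup>2 - (norm x)\<^sup>2)"
  by (simp add: BB_def cin_self mult.assoc mult_cnj_cmod)

lemma BB_self_real: "BB x x = complex_of_real (Re (BB x x))"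
  by (simp add: BB_self)

lemma tendsto_coord [tendsto_intros]:
  assumes "(f \<longlongrightarrow> x) F" shows "((\<lambda>n. coord (f n) k) \<longlongrightarrow> coord x k) F"
proof -
  have "bounded_linear (\<lambda>x. coord x k)"
    by (rule bounded_linear_intro[where K = 1]) (auto simp: scaleR_scaleC scaleR_conv_of_real cmod_coord_le)
  then show ?thesis using assms by (rule bounded_linear.tendsto)
qed

lemma tendsto_BB [tendsto_intros]:
  assumes "(f \<longlongrightarrow> x) F" "(g \<longlongrightarrow> y) F" shows "((\<lambda>n. BB (f n) (g n)) \<longlongrightarrow> BB x y) F"
  unfolding BB_def using assms by (auto intro!: tendsto_intros)

text \<open>With coordinate 0 split off, orthogonality and Cauchy-Schwarz for the remaining
  coordinates give s a <= r b. The claim is equivalent to this, because (a + b)(r - s) - (s + r)(a -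
  b) = 2 (r b - s a).\<close>

lemma neg_complement:
  assumes v: "Re (BB v v) > 0" and x: "BB x v = 0"
  shows "(norm x)\<^sup>2 \<le> (norm v)\<^sup>2 / Re (BB v v) * (- Re (BB x x))"
proof -
  define a where "a = (cmod (coord v 0))\<^sup>2"
  define b where "b = (norm v)\<^sup>2 - a"
  define s where "s = (cmod (coord x 0))\<^sup>2"
  define r where "r = (norm x)\<^sup>2 - s"
  let ?v = "v - coord v 0 *\<^sub>C ek 0" let ?x = "x - coord x 0 *\<^sub>C ek 0"
  have nz: "(norm (w - coord w 0 *\<^sub>C ek 0))\<^sup>2 = (norm w)\<^sup>2 - (cmod (coord w 0))\<^sup>2"
    and cz: "cin (u - coord u 0 *\<^sub>C ek 0) (w - coord w 0 *\<^sub>C ek 0) = cin u w - coord u 0 * cnj (coord w 0)" for u w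
  proof -
    have "cin (ek 0) w = cnj (coord w 0)" for w
      unfolding cin_def by (subst suminf_finite[of "{0}"]) auto
    moreover have "cin w (ek 0) = coord w 0" for w
      unfolding cin_def by (subst suminf_finite[of "{0}"]) auto
    ultimately show *: "cin (u - coord u 0 *\<^sub>C ek 0) (w - coord w 0 *\<^sub>C ek 0) = cin u w - coord u 0 * cnj (coord w 0)" for u w
      by (simp add: cin_diff cin_scale)
    have "complex_of_real ((norm (w - coord w 0 *\<^sub>C ek 0))\<^sup>2) = complex_of_real ((norm w)\<^sup>2 - (cmod (coord w 0))\<^sup>2)"
      unfolding cin_self[symmetric] * by (simp add: cin_self mult_cnj_cmod)
    then show "(norm (w - coord w 0 *\<^sub>C ek 0))\<^sup>2 = (norm w)\<^sup>2 - (cmod (coord w 0))\<^sup>2"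
      using of_real_eq_iff by blast
  qed
  have b0: "b \<ge> 0" "r \<ge> 0" using nz[of v] nz[of x] zero_le_power2
    unfolding b_def a_def r_def s_def by (metis)+
  have ab: "Re (BB v v) = a - b" by (simp add: BB_self a_def b_def)
  have sr: "Re (BB x x) = s - r" by (simp add: BB_self s_def r_def)
  have "coord x 0 * cnj (coord v 0) = cin ?x ?v"
    using x unfolding cz BB_def by (simp add: algebra_simps)
  then have "cmod (coord x 0) * cmod (coord v 0) = cmod (cin ?x ?v)"
    by (metis norm_mult complex_mod_cnj)
  then have "(cmod (coord x 0) * cmod (coord v 0))\<^sup>2 \<le> (norm ?x * norm ?v)\<^sup>2"
    using norm_cin_le[of ?x ?v] by (intro power_mono) simp_all
  then have le: "s * a \<le> r * b"
    by (simp add: power_mult_distrib nz s_def a_def r_def b_def)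
  have d: "a - b > 0" using v ab by simp
  have nv: "(norm v)\<^sup>2 = a + b" and nx: "(norm x)\<^sup>2 = s + r" by (simp_all add: b_def r_def)
  have "(s + r) * (a - b) \<le> (a + b) * (r - s)" using le by (simp add: algebra_simps)
  then show ?thesis using d unfolding ab sr nv nx
    by (simp add: pos_le_divide_eq)
qed

lemma BB_neg:
  assumes "Re (BB v v) > 0" "BB x v = 0"
  shows "Re (BB x x) \<le> 0" "Re (BB x x) = 0 \<Longrightarrow> x = 0"
proof -
  have n: "(norm x)\<^sup>2 \<le> (norm v)\<^sup>2 / Re (BB v v) * (- Re (BB x x))" using neg_complement[OF assms] .
  have vv: "(norm v)\<^sup>2 / Re (BB v v) > 0"
  proof -
    have "v \<noteq> 0" using assms(1) by (auto simp: BB_0)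
    then show ?thesis using assms(1) by simp
  qed
  show "Re (BB x x) \<le> 0"
  proof (rule ccontr)
    assume "\<not> Re (BB x x) \<le> 0"
    then have "(norm v)\<^sup>2 / Re (BB v v) * (- Re (BB x x)) < 0" using vv by (intro mult_pos_neg) auto
    then show False using n zero_le_power2[of "norm x"] by linarith
  qed
  show "x = 0" if "Re (BB x x) = 0"
    using n that by simp
qed

text \<open>Orthogonal projection along \<open>v\<close>. The sign of \<open>BB v v\<close> is left
  open because both kinds occur: \<open>reverse_CS\<close> projects along a positive vector,
  \<open>complement_CS\<close> along a negative one.\<close>

lemma BB_split:
  fixes x v :: l2
  assumes v: "Re (BB v v) \<noteq> 0"
  defines "s \<equiv> BB x v / BB v v"
  shows "BB (x - s *\<^sub>C v) v = 0" "cmod s = cmod (BB x v) / \<bar>Re (BB v v)\<bar>"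
    "Re (BB x x) = Re (BB (x - s *\<^sub>C v) (x - s *\<^sub>C v)) + (cmod (BB x v))\<^sup>2 / Re (BB v v)"
proof -
  define r where "r = Re (BB v v)"
  have vr: "BB v v = complex_of_real r" unfolding r_def by (rule BB_self_real)
  have r: "r \<noteq> 0" using v by (simp add: r_def)
  define y where "y = x - s *\<^sub>C v"
  have x: "x = y + s *\<^sub>C v" by (simp add: y_def)
  show yv: "BB (x - s *\<^sub>C v) v = 0" using r by (simp add: BB_lin s_def vr)
  then have yv': "BB y v = 0" "BB v y = 0" using BB_cnj[of y v] by (simp_all add: y_def)
  show sm: "cmod s = cmod (BB x v) / \<bar>Re (BB v v)\<bar>"
    unfolding s_def vr using r by (simp add: norm_divide)
  have "BB x x = BB y y + s * cnj s * BB v v"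
    unfolding x by (simp add: BB_lin yv')
  also have "\<dots> = BB y y + complex_of_real ((cmod s)\<^sup>2 * r)"
    by (simp add: vr mult_cnj_cmod)
  finally show "Re (BB x x) = Re (BB (x - s *\<^sub>C v) (x - s *\<^sub>C v)) + (cmod (BB x v))\<^sup>2 / Re (BB v v)"
    using r by (simp add: y_def sm vr power_divide power2_eq_square)
qed

text \<open>The right-hand side involves only the form value of \<open>x\<close> and its pairing
  with one positive vector. Form-preserving maps respect both, so this is the substitute for
  invariance of the norm.\<close>

lemma norm_le_form:
  assumes v: "Re (BB v v) > 0"
  shows "(norm x)\<^sup>2 \<le> 2 * (cmod (BB x v) / Re (BB v v))\<^sup>2 * (norm v)\<^sup>2
    + 2 * ((norm v)\<^sup>2 / Re (BB v v)) * ((cmod (BB x v))\<^sup>2 / Re (BB v v) - Re (BB x x))"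
proof -
  define s where "s = BB x v / BB v v"
  have v': "Re (BB v v) \<noteq> 0" using v by simp
  note sp = BB_split[OF v', of x, folded s_def]
  let ?y = "x - s *\<^sub>C v"
  have "(norm x)\<^sup>2 = (norm (s *\<^sub>C v + ?y))\<^sup>2" by simp
  also have "\<dots> \<le> 2 * (norm (s *\<^sub>C v))\<^sup>2 + 2 * (norm ?y)\<^sup>2" by (rule norm_add_sq_le)
  also have "\<dots> \<le> 2 * (norm (s *\<^sub>C v))\<^sup>2 + 2 * ((norm v)\<^sup>2 / Re (BB v v) * (- Re (BB ?y ?y)))"
    using neg_complement[OF v sp(1)] by simp
  also have "- Re (BB ?y ?y) = (cmod (BB x v))\<^sup>2 / Re (BB v v) - Re (BB x x)" using sp(3) by simp
  finally show ?thesis by (simp add: power_mult_distrib power_divide sp(2) mult.assoc)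
qed

lemma reverse_CS:
  assumes "Re (BB v v) > 0"
  shows "Re (BB v v) * Re (BB x x) \<le> (cmod (BB x v))\<^sup>2"
proof -
  have v': "Re (BB v v) \<noteq> 0" using assms by simp
  have "Re (BB x x) \<le> (cmod (BB x v))\<^sup>2 / Re (BB v v)"
    using BB_split(3)[OF v', of x] BB_neg(1)[OF assms BB_split(1)[OF v', of x]] by simp
  then show ?thesis using assms by (simp add: pos_le_divide_eq mult.commute)
qed

text \<open>The form is negative definite on the complement of \<open>v\<close>, so the ordinary
  Cauchy-Schwarz argument applies there: remove from \<open>x\<close> its projection along
  \<open>y\<close>; if \<open>BB y y\<close> vanishes, so does \<open>y\<close>.\<close>

lemma complement_CS:
  assumes v: "Re (BB v v) > 0" and x: "BB x v = 0" and y: "BB y v = 0"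
  shows "(cmod (BB x y))\<^sup>2 \<le> Re (BB x x) * Re (BB y y)"
proof (cases "Re (BB y y) = 0")
  case True
  then have "y = 0" using BB_neg(2)[OF v y] by simp
  then show ?thesis by (simp add: BB_0)
next
  case False
  then have neg: "Re (BB y y) < 0" using BB_neg(1)[OF v y] by simp
  have "BB (x - (BB x y / BB y y) *\<^sub>C y) v = 0" by (simp add: BB_lin x y)
  then have "Re (BB x x) \<le> (cmod (BB x y))\<^sup>2 / Re (BB y y)"
    using BB_split(3)[OF False, of x] BB_neg(1)[OF v] by simp
  then show ?thesis using neg by (simp add: neg_le_divide_eq mult.commute)
qed

section \<open>Lines, isometries and the group SU(1,1)\<close>

definition lin :: "l2 \<Rightarrow> vect set" where "lin x = line (coord x)"

lemma sc_coord: "sc c (coord x) = coord (c *\<^sub>C x)"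
  by (auto simp: sc_def)

lemma vadd_coord: "vadd (coord x) (coord y) = coord (x + y)"
  by (auto simp: vadd_def)

lemma coord_eq_0_iff: "coord x = (\<lambda>k. 0) \<longleftrightarrow> x = 0"
  by (auto intro!: l2_eqI)

lemma L2_coord: "v \<in> L2 \<Longrightarrow> \<exists>x. v = coord x"
  by (metis l2_of_inverse)

lemma lin_alt: "lin x = {coord (c *\<^sub>C x) | c. c \<noteq> 0}"
  by (auto simp: lin_def line_def sc_coord)

lemma lin_eq_iff: "lin x = lin y \<longleftrightarrow> (\<exists>c. c \<noteq> 0 \<and> x = c *\<^sub>C y)"
proof
  assume h: "lin x = lin y"
  have "coord (1 *\<^sub>C x) \<in> lin x" unfolding lin_alt by (rule CollectI) (intro exI[of _ 1], simp)
  then have "coord (1 *\<^sub>C x) \<in> lin y" unfolding h .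
  then have "\<exists>c. coord (1 *\<^sub>C x) = coord (c *\<^sub>C y) \<and> c \<noteq> 0" unfolding lin_alt by (rule CollectD)
  then show "\<exists>c. c \<noteq> 0 \<and> x = c *\<^sub>C y" unfolding coord_inject scaleC_simps by (simp only: conj_commute)
next
  assume "\<exists>c. c \<noteq> 0 \<and> x = c *\<^sub>C y"
  then obtain c where c: "c \<noteq> 0" "x = c *\<^sub>C y" by blast
  show "lin x = lin y"
  proof (intro set_eqI iffI)
    fix v assume "v \<in> lin x"
    then obtain d where "d \<noteq> 0" "v = coord ((d * c) *\<^sub>C y)" unfolding lin_alt c by auto
    then show "v \<in> lin y" using c unfolding lin_alt by (auto intro!: exI[of _ "d * c"])
  next
    fix v assume "v \<in> lin y"
    then obtain d where "d \<noteq> 0" "v = coord (d *\<^sub>C y)" unfolding lin_alt by auto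
    then show "v \<in> lin x" using c unfolding lin_alt by (auto intro!: exI[of _ "d / c"])
  qed
qed

lemma lin_scale: "c \<noteq> 0 \<Longrightarrow> lin (c *\<^sub>C x) = lin x"
  unfolding lin_eq_iff by blast

lemma Lines_alt: "Lines = {lin x | x. x \<noteq> 0}"
  unfolding Lines_def lin_def by (metis (lifting) L2_coord coord_L2 coord_eq_0_iff)

lemma HPts_alt: "HPts = {lin x | x. Re (BB x x) > 0}"
  unfolding HPts_def lin_def BB_Bf by (metis (lifting) L2_coord coord_L2)

lemma BdPts_alt: "BdPts = {lin x | x. x \<noteq> 0 \<and> BB x x = 0}"
  unfolding BdPts_def lin_def BB_Bf by (metis (lifting) L2_coord coord_L2 coord_eq_0_iff)

section \<open>Bounded form-preserving operators and the line maps they induce\<close>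

definition unitary :: "(l2 \<Rightarrow> l2) \<Rightarrow> bool" where
  "unitary T \<longleftrightarrow> bij T \<and> (\<forall>x y. T (x + y) = T x + T y) \<and> (\<forall>c x. T (c *\<^sub>C x) = c *\<^sub>C T x)
    \<and> (\<forall>x y. BB (T x) (T y) = BB x y) \<and> (\<exists>C. \<forall>x. norm (T x) \<le> C * norm x)"

lemma unitaryD:
  assumes "unitary T"
  shows "bij T" "T (x + y) = T x + T y" "T (c *\<^sub>C x) = c *\<^sub>C T x" "BB (T x) (T y) = BB x y"
    "T (x - y) = T x - T y" "T 0 = 0" "T x = 0 \<longleftrightarrow> x = 0" "\<exists>C. \<forall>x. norm (T x) \<le> C * norm x"
    "bounded_linear T"
proof -
  show b: "bij T" and a: "T (x + y) = T x + T y" and s: "T (c *\<^sub>C x) = c *\<^sub>C T x" for x y c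
    using assms by (auto simp: unitary_def)
  show "BB (T x) (T y) = BB x y" "\<exists>C. \<forall>x. norm (T x) \<le> C * norm x" using assms by (auto simp: unitary_def)
  show "T (x - y) = T x - T y" using a[of "x - y" y] by (simp add: algebra_simps)
  show z: "T 0 = 0" using s[of 0 0] by simp
  show "T x = 0 \<longleftrightarrow> x = 0" using b z by (metis bij_pointE)
  obtain C where "\<And>x. norm (T x) \<le> C * norm x" using assms by (auto simp: unitary_def)
  then show "bounded_linear T"
    by (intro bounded_linear_intro[where K = C]) (auto simp: a s scaleR_scaleC mult.commute)
qed

definition lifted :: "(l2 \<Rightarrow> l2) \<Rightarrow> (vect set \<Rightarrow> vect set) \<Rightarrow> bool" where
  "lifted T f \<longleftrightarrow> (\<forall>x. x \<noteq> 0 \<longrightarrow> f (lin x) = lin (T x))"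

lemma liftedD: "lifted T f \<Longrightarrow> x \<noteq> 0 \<Longrightarrow> f (lin x) = lin (T x)"
  by (simp add: lifted_def)

lemma unitaryB_imp_unitary:
  assumes T: "unitaryB T"
  defines "U \<equiv> \<lambda>x. l2_of (T (coord x))"
  shows "unitary U" "coord (U x) = T (coord x)" "lifts T f \<Longrightarrow> lifted U f"
proof -
  have bij: "bij_betw T L2 L2"
    and lin: "\<forall>x\<in>L2. \<forall>y\<in>L2. \<forall>a b. T (vadd (sc a x) (sc b y)) = vadd (sc a (T x)) (sc b (T y))"
    and pres: "\<forall>x\<in>L2. \<forall>y\<in>L2. Bf (T x) (T y) = Bf x y"
    and bd: "\<exists>C. \<forall>x\<in>L2. l2norm (T x) \<le> C * l2norm x"
    using T by (auto simp: unitaryB_def)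
  show c: "coord (U x) = T (coord x)" for x
    unfolding U_def using bij_betwE[OF bij] by (simp add: l2_of_inverse)
  have cl: "U (a *\<^sub>C x + b *\<^sub>C y) = a *\<^sub>C U x + b *\<^sub>C U y" for a b x y
  proof -
    have "coord (U (a *\<^sub>C x + b *\<^sub>C y)) = coord (a *\<^sub>C U x + b *\<^sub>C U y)"
      unfolding c vadd_coord[symmetric] sc_coord[symmetric] using lin[rule_format, of "coord x" "coord y" a b] by (simp add: vadd_coord sc_coord)
    then show ?thesis using coord_inject by blast
  qed
  have "bij U"
  proof (rule bijI)
    show "inj U"
    proof (rule injI)
      fix x y assume "U x = U y"
      then have "T (coord x) = T (coord y)" by (metis c)
      then have "coord x = coord y" using bij by (auto simp: bij_betw_def inj_on_def)
      then show "x = y" using coord_inject by blast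
    qed
    show "surj U"
    proof -
      have "\<exists>x. y = U x" for y
      proof -
        have "coord y \<in> T ` L2" using bij coord_L2 by (simp add: bij_betw_def)
        then obtain v where "v \<in> L2" "coord y = T v" by blast
        then show ?thesis by (metis L2_coord c coord_inject)
      qed
      then show ?thesis by (simp add: surj_def)
    qed
  qed
  moreover have "BB (U x) (U y) = BB x y" for x y
    unfolding BB_Bf c using pres by simp
  moreover have "\<exists>C. \<forall>x. norm (U x) \<le> C * norm x"
  proof -
    obtain C where "\<forall>x\<in>L2. l2norm (T x) \<le> C * l2norm x" using bd by blast
    then have "\<forall>x. norm (U x) \<le> C * norm x" unfolding norm_l2norm c by simp
    then show ?thesis by blast
  qed
  ultimately show "unitary U"
    unfolding unitary_def using cl[of 1 _ 1] cl[of _ _ 0] by simp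
  show "lifted U f" if "lifts T f"
    using that unfolding lifts_def lifted_def lin_def c by (simp add: coord_eq_0_iff)
qed

lemma unitary_imp_unitaryB:
  assumes T: "unitary T"
  defines "U \<equiv> \<lambda>v. coord (T (l2_of v))"
  shows "unitaryB U" "U (coord x) = coord (T x)" "lifted T f \<Longrightarrow> lifts U f"
proof -
  note D = unitaryD[OF T]
  show c: "U (coord x) = coord (T x)" for x by (simp add: U_def coord_inverse)
  have "bij_betw U L2 L2"
  proof (rule bij_betw_imageI)
    show "inj_on U L2"
    proof (rule inj_onI)
      fix v w assume "v \<in> L2" "w \<in> L2" "U v = U w"
      then obtain x y where "v = coord x" "w = coord y" "T x = T y" by (metis L2_coord c coord_inject)
      then show "v = w" using D(1) by (metis bij_pointE)
    qed
    show "U ` L2 = L2"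
    proof (intro set_eqI iffI)
      fix v assume "v \<in> L2"
      then obtain y where y: "v = coord y" using L2_coord by blast
      obtain x where "y = T x" using D(1) by (metis bij_pointE)
      then show "v \<in> U ` L2" using c y coord_L2 by (metis image_eqI)
    qed (auto simp: U_def)
  qed
  moreover have "U (vadd (sc a v) (sc b w)) = vadd (sc a (U v)) (sc b (U w))" if "v \<in> L2" "w \<in> L2" for a b v w
    using L2_coord[OF that(1)] L2_coord[OF that(2)] by (auto simp: sc_coord vadd_coord c D)
  moreover have "Bf (U v) (U w) = Bf v w" if "v \<in> L2" "w \<in> L2" for v w
    using L2_coord[OF that(1)] L2_coord[OF that(2)] by (auto simp: c BB_Bf[symmetric] D)
  moreover have "\<exists>C. \<forall>v\<in>L2. l2norm (U v) \<le> C * l2norm v"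
  proof -
    obtain C where C: "\<And>x. norm (T x) \<le> C * norm x" using D(8) by blast
    have "l2norm (U v) \<le> C * l2norm v" if "v \<in> L2" for v
      using L2_coord[OF that] C by (auto simp: c norm_l2norm)
    then show ?thesis by blast
  qed
  ultimately show "unitaryB U" unfolding unitaryB_def by blast
  show "lifts U f" if "lifted T f"
    using that unfolding lifts_def lifted_def lin_def
    by (metis L2_coord c coord_eq_0_iff)
qed

text \<open>The representatives chosen in \<open>hdist\<close> are unknown nonzero multiples of
  \<open>x\<close> and \<open>y\<close>; both scalars cancel in the quotient.\<close>

lemma hdist_lin:
  assumes "Re (BB x x) > 0" "Re (BB y y) > 0"
  shows "hdist (lin x) (lin y) = arcosh (cmod (BB x y) / sqrt (Re (BB x x) * Re (BB y y)))"
proof -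
  have ex: "\<exists>c. c \<noteq> 0 \<and> (SOME v. v \<in> lin x) = coord (c *\<^sub>C x)" for x
  proof -
    have "coord (1 *\<^sub>C x) \<in> lin x" unfolding lin_alt by (rule CollectI) (intro exI[of _ 1], simp)
    then have "(SOME v. v \<in> lin x) \<in> lin x" by (rule someI[where P = "\<lambda>v. v \<in> lin x"])
    then obtain c where "(SOME v. v \<in> lin x) = coord (c *\<^sub>C x)" "c \<noteq> 0"
      by (subst (asm) (3) lin_alt) blast
    then show ?thesis by blast
  qed
  obtain c d where c: "c \<noteq> 0" "(SOME v. v \<in> lin x) = coord (c *\<^sub>C x)"
    and d: "d \<noteq> 0" "(SOME v. v \<in> lin y) = coord (d *\<^sub>C y)"
    using ex by metis
  have sq: "Re (BB (c *\<^sub>C x) (c *\<^sub>C x)) = (cmod c)\<^sup>2 * Re (BB x x)" for c x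
  proof -
    have "BB (c *\<^sub>C x) (c *\<^sub>C x) = complex_of_real ((cmod c)\<^sup>2) * BB x x"
      by (simp only: BB_scale mult_cnj_cmod[symmetric] mult_ac)
    then show ?thesis by (simp del: of_real_power)
  qed
  have "sqrt ((cmod c)\<^sup>2 * Re (BB x x) * ((cmod d)\<^sup>2 * Re (BB y y)))
      = cmod c * cmod d * sqrt (Re (BB x x) * Re (BB y y))"
    by (simp add: real_sqrt_mult)
  moreover have "cmod (BB (c *\<^sub>C x) (d *\<^sub>C y)) = cmod c * cmod d * cmod (BB x y)"
    by (simp add: BB_scale norm_mult)
  ultimately show ?thesis
    unfolding hdist_def Let_def c(2) d(2) BB_Bf[symmetric] sq using c(1) d(1) by simp
qed

section \<open>Hyperbolic pairs and isometries preserving an axis\<close>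

lemma hyperbolic_pair_decomp:
  assumes e: "BB e1 e1 = 0" "BB e2 e2 = 0" "BB e1 e2 = 1"
  defines "c \<equiv> \<lambda>x. x - BB x e2 *\<^sub>C e1 - BB x e1 *\<^sub>C e2"
  shows "BB (c x) e1 = 0" "BB (c x) e2 = 0" "x = BB x e2 *\<^sub>C e1 + BB x e1 *\<^sub>C e2 + c x"
    "BB x y = BB x e2 * cnj (BB y e1) + BB x e1 * cnj (BB y e2) + BB (c x) (c y)"
proof -
  have e': "BB e2 e1 = 1" using BB_cnj[of e1 e2] e by simp
  show c1: "BB (c x) e1 = 0" and c2: "BB (c x) e2 = 0" for x
    by (simp_all add: c_def BB_lin e e')
  show x: "x = BB x e2 *\<^sub>C e1 + BB x e1 *\<^sub>C e2 + c x" for x by (simp add: c_def)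
  have c3: "BB e1 (c x) = 0" "BB e2 (c x) = 0" for x
    using BB_cnj[of "c x"] c1 c2 by (metis complex_cnj_zero)+
  have "BB x y = BB (BB x e2 *\<^sub>C e1 + BB x e1 *\<^sub>C e2 + c x) (BB y e2 *\<^sub>C e1 + BB y e1 *\<^sub>C e2 + c y)"
    using x by metis
  also have "\<dots> = BB x e2 * cnj (BB y e1) + BB x e1 * cnj (BB y e2) + BB (c x) (c y)"
    by (simp add: BB_add BB_scale e e' c1 c2 c3)
  finally show "BB x y = \<dots>" .
qed

text \<open>\<open>e1 + e2\<close> has form value 2, so a vector orthogonal to \<open>e1\<close> and
  \<open>e2\<close> lies in the complement of a positive vector.\<close>

lemma hyperbolic_pair_neg:
  assumes e: "BB e1 e1 = 0" "BB e2 e2 = 0" "BB e1 e2 = 1" and y: "BB y e1 = 0" "BB y e2 = 0"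
  shows "Re (BB y y) \<le> 0" "Re (BB y y) = 0 \<Longrightarrow> y = 0"
    "BB z e1 = 0 \<Longrightarrow> BB z e2 = 0 \<Longrightarrow> (cmod (BB y z))\<^sup>2 \<le> Re (BB y y) * Re (BB z z)"
proof -
  have e': "BB e2 e1 = 1" using BB_cnj[of e1 e2] e by simp
  have v: "Re (BB (e1 + e2) (e1 + e2)) > 0" by (simp add: BB_lin e e')
  have v0: "BB w (e1 + e2) = 0" if "BB w e1 = 0" "BB w e2 = 0" for w using that by (simp add: BB_lin)
  show "Re (BB y y) \<le> 0" using BB_neg(1)[OF v v0[OF y]] .
  show "y = 0" if "Re (BB y y) = 0" using BB_neg(2)[OF v v0[OF y] that] .
  show "(cmod (BB y z))\<^sup>2 \<le> Re (BB y y) * Re (BB z z)" if "BB z e1 = 0" "BB z e2 = 0"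
    using complement_CS[OF v v0[OF y] v0[OF that]] .
qed

context
  fixes M :: "l2 \<Rightarrow> l2" and e1 e2 :: l2 and \<mu> \<nu> :: complex
  assumes M: "unitary M" and Me: "M e1 = \<mu> *\<^sub>C e1" "M e2 = \<nu> *\<^sub>C e2"
    and e: "BB e1 e1 = 0" "BB e2 e2 = 0" "BB e1 e2 = 1"
begin

lemma axis_multipliers: "\<mu> * cnj \<nu> = 1" "\<mu> \<noteq> 0" "\<nu> = \<mu> / complex_of_real ((cmod \<mu>)\<^sup>2)"
proof -
  have "BB (M e1) (M e2) = BB e1 e2" by (rule unitaryD[OF M])
  then show h: "\<mu> * cnj \<nu> = 1" by (simp add: Me BB_scale e mult.commute)
  then show n: "\<mu> \<noteq> 0" by auto
  have "cnj (\<mu> * cnj \<nu>) = 1" unfolding h by simp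
  then have h': "cnj \<mu> * \<nu> = 1" by simp
  have "\<nu> * complex_of_real ((cmod \<mu>)\<^sup>2) = \<mu>"
    unfolding mult_cnj_cmod[symmetric] using h' by (metis mult.assoc mult.commute mult_1_right)
  then show "\<nu> = \<mu> / complex_of_real ((cmod \<mu>)\<^sup>2)"
    using n by (simp add: field_simps)
qed

text \<open>Up to a common phase the hyperbolic plane contributes m z + cnj z / m, whose real part
  is 2 cosh (ln m) Re z. The component orthogonal to the plane costs at most \<gamma>, and \<gamma>
  <= cosh (ln m) \<gamma>.\<close>

lemma axis_displacement:
  assumes "Re (BB v v) > 0"
  shows "cosh (ln (cmod \<mu>)) * Re (BB v v) \<le> cmod (BB (M v) v)"
proof -
  define m where "m = cmod \<mu>"
  have m: "m > 0" using axis_multipliers by (simp add: m_def)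
  define c where "c = v - BB v e2 *\<^sub>C e1 - BB v e1 *\<^sub>C e2"
  note D = hyperbolic_pair_decomp[OF e, of v, folded c_def]
  define z where "z = BB v e2 * cnj (BB v e1)"
  have v: "v = BB v e2 *\<^sub>C e1 + BB v e1 *\<^sub>C e2 + c" by (rule D(3))
  have Mv: "M v = (BB v e2 * \<mu>) *\<^sub>C e1 + (BB v e1 * \<nu>) *\<^sub>C e2 + M c"
    by (subst v) (simp add: unitaryD[OF M] Me)
  have e': "BB e2 e1 = 1" using BB_cnj[of e1 e2] e by simp
  have "BB (M c) (M e1) = 0" "BB (M c) (M e2) = 0" by (simp_all add: unitaryD[OF M] D)
  then have Mc: "BB (M c) e1 = 0" "BB (M c) e2 = 0"
    using axis_multipliers unfolding Me BB_scale by auto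
  define \<gamma> where "\<gamma> = - Re (BB c c)"
  have \<gamma>: "\<gamma> \<ge> 0" using hyperbolic_pair_neg(1)[OF e D(1,2)] by (simp add: \<gamma>_def)
  have vv: "Re (BB v v) = 2 * Re z - \<gamma>"
    using D(4)[of v] unfolding z_def \<gamma>_def c_def[symmetric]
    by (simp add: mult.commute)
  have "cmod (BB (M c) c) ^ 2 \<le> Re (BB (M c) (M c)) * Re (BB c c)"
    by (rule hyperbolic_pair_neg(3)[OF e Mc D(1,2)])
  also have "\<dots> = \<gamma>\<^sup>2" by (simp add: unitaryD[OF M] \<gamma>_def power2_eq_square)
  finally have cc: "cmod (BB (M c) c) \<le> \<gamma>" using \<gamma> by (rule power2_le_imp_le)
  have "BB (M v) v = BB (M v) e2 * cnj (BB v e1) + BB (M v) e1 * cnj (BB v e2) +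
      BB (M v - BB (M v) e2 *\<^sub>C e1 - BB (M v) e1 *\<^sub>C e2) c"
    unfolding c_def using hyperbolic_pair_decomp(4)[OF e, of "M v" v] .
  moreover have a: "BB (M v) e2 = BB v e2 * \<mu>" and b: "BB (M v) e1 = BB v e1 * \<nu>"
    by (simp_all add: Mv BB_lin e e' Mc)
  moreover have "M v - (BB v e2 * \<mu>) *\<^sub>C e1 - (BB v e1 * \<nu>) *\<^sub>C e2 = M c" by (simp add: Mv)
  ultimately have BM: "BB (M v) v = \<mu> * z + \<nu> * cnj z + BB (M c) c"
    by (simp add: z_def mult_ac)
  have "\<mu> * z + \<nu> * cnj z = (\<mu> / of_real m) * (of_real m * z + cnj z / of_real m)"
    unfolding axis_multipliers(3) using m by (simp add: m_def power2_eq_square field_simps)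
  then have "cmod (\<mu> * z + \<nu> * cnj z) = cmod (of_real m * z + cnj z / of_real m)"
    using m by (simp add: norm_mult norm_divide m_def)
  also have "\<dots> \<ge> Re (of_real m * z + cnj z / of_real m)" by (rule complex_Re_le_cmod)
  also have "Re (of_real m * z + cnj z / of_real m) = cosh (ln m) * (2 * Re z)"
    using m by (simp add: cosh_ln_real field_simps)
  finally have "cosh (ln m) * (2 * Re z) \<le> cmod (\<mu> * z + \<nu> * cnj z)" .
  moreover have "cmod (\<mu> * z + \<nu> * cnj z) \<le> cmod (BB (M v) v) + \<gamma>"
    using norm_triangle_ineq4[of "BB (M v) v" "BB (M c) c"] cc unfolding BM by simp
  moreover have "\<gamma> \<le> cosh (ln m) * \<gamma>" using \<gamma> cosh_real_ge_1[of "ln m"] by (simp add: mult_le_cancel_right1)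
  ultimately have "cosh (ln m) * (2 * Re z - \<gamma>) \<le> cmod (BB (M v) v)" by (simp add: algebra_simps)
  then show ?thesis by (simp add: vv m_def)
qed

text \<open>The bound of \<open>axis_displacement\<close> is attained on the axis, at the point of
  \<open>e1 + e2\<close>, so the infimum is a minimum.\<close>

lemma transl_length_axis:
  assumes f: "lifted M f"
  shows "transl_length f = \<bar>ln (cmod \<mu>)\<bar>"
proof -
  define m where "m = cmod \<mu>"
  have m: "m > 0" using axis_multipliers by (simp add: m_def)
  have h: "hdist (f (lin x)) (lin x) = arcosh (cmod (BB (M x) x) / Re (BB x x))"
    if "Re (BB x x) > 0" for x
  proof -
    have "x \<noteq> 0" using that by (auto simp: BB_0)
    then have "f (lin x) = lin (M x)" using f by (simp add: liftedD)
    moreover have "Re (BB (M x) (M x)) > 0" by (simp add: unitaryD[OF M] that)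
    ultimately show ?thesis using that by (simp add: hdist_lin unitaryD[OF M] real_sqrt_mult_self)
  qed
  have e': "BB e2 e1 = 1" using BB_cnj[of e1 e2] e by simp
  show ?thesis unfolding transl_length_def m_def[symmetric]
  proof (rule cInf_eq_minimum)
    let ?v = "e1 + e2"
    have vv: "Re (BB ?v ?v) = 2" by (simp add: BB_lin e e')
    have "BB (M ?v) ?v = \<mu> + \<nu>" by (simp add: unitaryD[OF M] Me BB_lin e e')
    also have "\<dots> = (\<mu> / of_real m) * (of_real m + 1 / of_real m)"
      unfolding axis_multipliers(3) using m by (simp add: m_def power2_eq_square field_simps)
    finally have "cmod (BB (M ?v) ?v) = cmod (of_real (m + 1 / m))"
      using m by (simp add: norm_mult norm_divide m_def)
    also have "\<dots> = m + 1 / m" unfolding norm_of_real using m by simp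
    finally have "hdist (f (lin ?v)) (lin ?v) = arcosh (cosh (ln m))"
      using h[of ?v] vv m by (simp add: cosh_ln_real inverse_eq_divide)
    then have "hdist (f (lin ?v)) (lin ?v) = \<bar>ln m\<bar>"
      using arcosh_cosh_real[of "\<bar>ln m\<bar>"] by simp
    moreover have "lin ?v \<in> HPts" unfolding HPts_alt using vv by force
    ultimately show "\<bar>ln m\<bar> \<in> {hdist (f x) x |x. x \<in> HPts}" by (metis (mono_tags, lifting) mem_Collect_eq)
  next
    fix d assume "d \<in> {hdist (f x) x |x. x \<in> HPts}"
    then obtain x where x: "Re (BB x x) > 0" "d = hdist (f (lin x)) (lin x)" unfolding HPts_alt by auto
    have "cosh \<bar>ln m\<bar> \<le> cmod (BB (M x) x) / Re (BB x x)"
      using axis_displacement[OF x(1)] x(1) by (simp add: m_def pos_le_divide_eq)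
    then have "arcosh (cosh \<bar>ln m\<bar>) \<le> d"
      unfolding x(2) h[OF x(1)] using cosh_real_ge_1[of "\<bar>ln m\<bar>"] arcosh_real_strict_mono
      by (metis order_le_less)
    then show "\<bar>ln m\<bar> \<le> d" by (simp only: arcosh_cosh_real abs_ge_zero)
  qed
qed

text \<open>Comparing eigenvalues, an eigenvector pairing nontrivially with both \<open>e1\<close>
  and \<open>e2\<close> would force \<mu> = \<nu> and hence |\<mu>| = 1. So one pairing is zero, the
  hyperbolic part of \<open>x\<close> is isotropic, and \<open>Re (BB x x)\<close> nonnegative
  leaves no room for an orthogonal component.\<close>

lemma axis_fixed_lines:
  assumes m: "cmod \<mu> \<noteq> 1" and x: "x \<noteq> 0" "Re (BB x x) \<ge> 0" "M x = \<kappa> *\<^sub>C x"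
  shows "lin x = lin e1 \<or> lin x = lin e2"
proof -
  define c where "c = x - BB x e2 *\<^sub>C e1 - BB x e1 *\<^sub>C e2"
  note D = hyperbolic_pair_decomp[OF e, of x, folded c_def]
  have "BB (M x) (M e1) = BB x e1" "BB (M x) (M e2) = BB x e2" by (simp_all add: unitaryD[OF M])
  then have a: "\<kappa> * cnj \<mu> = 1 \<or> BB x e1 = 0" and b: "\<kappa> * cnj \<nu> = 1 \<or> BB x e2 = 0"
    unfolding x Me BB_scale by (auto simp: mult.commute)
  have "BB x e1 = 0 \<or> BB x e2 = 0"
  proof (rule ccontr)
    assume "\<not> ?thesis"
    then have "\<kappa> * cnj \<mu> = \<kappa> * cnj \<nu>" "\<kappa> \<noteq> 0" using a b by auto
    then have "\<mu> = \<nu>" by simp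
    then have "complex_of_real ((cmod \<mu>)\<^sup>2) = 1" using axis_multipliers(1) by (simp add: mult_cnj_cmod)
    then have "(cmod \<mu>)\<^sup>2 = 1" using of_real_eq_1_iff by blast
    then show False using m norm_ge_zero[of \<mu>] by (auto simp: power2_eq_1_iff)
  qed
  then have "Re (BB x x) = Re (BB c c)"
    using D(4)[of x] unfolding c_def[symmetric] by auto
  then have "c = 0" using hyperbolic_pair_neg(1,2)[OF e D(1,2)] x(2) by linarith
  then have "x = BB x e2 *\<^sub>C e1 + BB x e1 *\<^sub>C e2" using D(3) by simp
  then show ?thesis using \<open>BB x e1 = 0 \<or> BB x e2 = 0\<close> x(1) unfolding lin_eq_iff
    by (metis add.right_neutral add_0 scaleC_simps(2))
qed

end

section \<open>The group SU(1,1) and its action on the circle\<close>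

definition su :: "complex \<Rightarrow> complex \<Rightarrow> complex^2^2" where
  "su a b = (\<chi> i j. if i = 1 then (if j = 1 then a else b) else (if j = 1 then cnj b else cnj a))"

lemma su_nth [simp]: "su a b $ 1 $ 1 = a" "su a b $ 1 $ 2 = b" "su a b $ 2 $ 1 = cnj b" "su a b $ 2 $ 2 = cnj a"
  by (simp_all add: su_def)

lemma matrix2_eqI:
  "(A :: complex^2^2) $ 1 $ 1 = B $ 1 $ 1 \<Longrightarrow> A $ 1 $ 2 = B $ 1 $ 2 \<Longrightarrow> A $ 2 $ 1 = B $ 2 $ 1 \<Longrightarrow> A $ 2 $ 2 = B $ 2 $ 2 \<Longrightarrow> A = B"
  by (simp add: vec_eq_iff forall_2)

lemma mult_nth2: "((A :: complex^2^2) ** B) $ i $ j = A $ i $ 1 * B $ 1 $ j + A $ i $ 2 * B $ 2 $ j"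
  by (simp add: matrix_matrix_mult_def sum_2)

lemma su_mult: "su a b ** su c d = su (a * c + b * cnj d) (a * d + b * cnj c)"
  by (rule matrix2_eqI) (simp_all add: mult_nth2)

lemma su_one: "su 1 0 = mat 1" and su_neg: "- su a b = su (- a) (- b)"
  by (rule matrix2_eqI; simp add: mat_def)+

lemma SU11_iff: "g \<in> SU11 \<longleftrightarrow> (\<exists>a b. (cmod a)\<^sup>2 - (cmod b)\<^sup>2 = 1 \<and> g = su a b)"
proof
  assume g: "g \<in> SU11"
  define a b c d where "a = g $ 1 $ 1" and "b = g $ 1 $ 2" and "c = g $ 2 $ 1" and "d = g $ 2 $ 2"
  note abcd = a_def b_def c_def d_def
  have det: "a * d - b * c = 1" using g by (simp add: SU11_def det_2 abcd)
  have J: "adjm g ** Jm ** g = Jm" using g by (simp add: SU11_def)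
  have nth: "(adjm g ** Jm ** g) $ i $ j = cnj (g $ 1 $ i) * g $ 1 $ j - cnj (g $ 2 $ i) * g $ 2 $ j" for i j
    by (simp add: mult_nth2 adjm_def Jm_def)
  have 1: "cnj a * a - cnj c * c = 1" and 2: "cnj a * b - cnj c * d = 0" and 3: "cnj b * b - cnj d * d = - 1"
    using J nth[of 1 1] nth[of 1 2] nth[of 2 2] by (simp_all add: abcd Jm_def)
  have d: "d = cnj a"
  proof -
    have "d * (cnj a * a - cnj c * c) = cnj a * (a * d - b * c) + c * (cnj a * b - cnj c * d)"
      by (simp add: algebra_simps)
    then show ?thesis unfolding 1 2 det by simp
  qed
  have c: "c = cnj b"
  proof -
    have "cnj a * b = cnj c * cnj a" using 2 d by simp
    moreover have "a \<noteq> 0"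
    proof
      assume "a = 0"
      then have "Re (- (cnj c * c)) = 1" using 1 by simp
      then have "Re c * Re c + Im c * Im c = - 1" by simp
      then show False using sum_squares_ge_zero[of "Re c" "Im c"] by linarith
    qed
    ultimately have "b = cnj c" by (simp add: mult.commute)
    then show ?thesis by simp
  qed
  have "complex_of_real ((cmod a)\<^sup>2 - (cmod b)\<^sup>2) = 1"
    using 1 unfolding c by (simp add: mult.commute flip: mult_cnj_cmod del: of_real_power)
  then have "(cmod a)\<^sup>2 - (cmod b)\<^sup>2 = 1" using of_real_eq_1_iff by blast
  moreover have "g = su a b" by (rule matrix2_eqI) (simp_all add: abcd[symmetric] c d)
  ultimately show "\<exists>a b. (cmod a)\<^sup>2 - (cmod b)\<^sup>2 = 1 \<and> g = su a b" by blast
next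
  assume "\<exists>a b. (cmod a)\<^sup>2 - (cmod b)\<^sup>2 = 1 \<and> g = su a b"
  then obtain a b where h: "(cmod a)\<^sup>2 - (cmod b)\<^sup>2 = 1" and g: "g = su a b" by blast
  have h': "a * cnj a - b * cnj b = 1"
    unfolding mult_cnj_cmod of_real_diff[symmetric] h by simp
  have "adjm g ** Jm ** g = Jm"
    by (rule matrix2_eqI; use h' in \<open>simp add: mult_nth2 adjm_def Jm_def g algebra_simps\<close>)
  moreover have "det g = 1" using h' by (simp add: det_2 g)
  ultimately show "g \<in> SU11" by (simp add: SU11_def)
qed

lemma su_in: "(cmod a)\<^sup>2 - (cmod b)\<^sup>2 = 1 \<Longrightarrow> su a b \<in> SU11"
  by (auto simp: SU11_iff)

lemma SU11E:
  assumes "g \<in> SU11"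
  obtains a b where "g = su a b" "a * cnj a - b * cnj b = 1" "(cmod a)\<^sup>2 - (cmod b)\<^sup>2 = 1" "cmod b < cmod a"
proof -
  obtain a b where h: "(cmod a)\<^sup>2 - (cmod b)\<^sup>2 = 1" and g: "g = su a b" using assms by (auto simp: SU11_iff)
  have "a * cnj a - b * cnj b = 1"
    unfolding mult_cnj_cmod of_real_diff[symmetric] h by simp
  moreover have "cmod b < cmod a" by (rule power2_less_imp_less) (use h in auto)
  ultimately show thesis using that g h by blast
qed

lemma SU11_mult: "g \<in> SU11 \<Longrightarrow> h \<in> SU11 \<Longrightarrow> g ** h \<in> SU11"
proof (elim SU11E)
  fix a b c d assume g: "g = su a b" "a * cnj a - b * cnj b = 1" and h: "h = su c d" "c * cnj c - d * cnj d = 1"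
  have "(a * c + b * cnj d) * cnj (a * c + b * cnj d) - (a * d + b * cnj c) * cnj (a * d + b * cnj c)
     = (a * cnj a - b * cnj b) * (c * cnj c - d * cnj d)"
    by (simp add: algebra_simps)
  also have "\<dots> = 1" using g h by simp
  finally have "complex_of_real ((cmod (a * c + b * cnj d))\<^sup>2 - (cmod (a * d + b * cnj c))\<^sup>2) = 1"
    by (simp only: mult_cnj_cmod of_real_diff)
  then show "g ** h \<in> SU11" unfolding g h su_mult using of_real_eq_1_iff by (intro su_in) blast
qed

lemma SU11_one: "mat 1 \<in> SU11" "- mat 1 \<in> SU11"
  unfolding su_one[symmetric] su_neg by (rule su_in; simp)+

lemma SU11_inverse:
  assumes "g \<in> SU11" obtains h where "h \<in> SU11" "g ** h = mat 1" "h ** g = mat 1"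
proof -
  obtain a b where g: "g = su a b" "a * cnj a - b * cnj b = 1" "(cmod a)\<^sup>2 - (cmod b)\<^sup>2 = 1"
    using SU11E[OF assms] by metis
  show thesis
  proof
    show "su (cnj a) (- b) \<in> SU11" by (rule su_in) (use g in simp)
    show "g ** su (cnj a) (- b) = mat 1" "su (cnj a) (- b) ** g = mat 1"
      using g(2) unfolding g(1) su_mult su_one[symmetric] by (simp_all add: algebra_simps)
  qed
qed

lemma gmat_su: "gmat l b = su ((l + 1 / l + \<i> * b) / 2) ((l - 1 / l - \<i> * b) / 2)"
proof -
  have s: "complex_of_real (sqrt 2) * complex_of_real (sqrt 2) = 2"
    by (simp flip: of_real_mult)
  have s': "x / complex_of_real (sqrt 2) / complex_of_real (sqrt 2) = x / 2" for x
    using s by (metis divide_divide_eq_left)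
  show ?thesis
    unfolding gmat_def
    by (rule matrix2_eqI) (simp_all add: mult_nth2 Pm_def add_divide_distrib[symmetric] diff_divide_distrib[symmetric] s' s algebra_simps)
qed

lemma gmat_SU11: "l > 0 \<Longrightarrow> gmat l b \<in> SU11"
  unfolding gmat_su by (rule su_in, unfold cmod_power2) (simp add: power2_eq_square field_simps)

lemma gmat_one: "gmat 1 0 = mat 1"
  by (simp add: gmat_su su_one)

lemma gmat_mult:
  assumes "l > 0" "m > 0" shows "gmat l b ** gmat m c = gmat (l * m) (l * c + b / m)"
  unfolding gmat_su su_mult using assms
  by (intro arg_cong2[of _ _ _ _ su]) (simp_all add: complex_eq_iff field_simps)

text \<open>The boundary of the complex hyperbolic line as the unit circle: z stands for the
  isotropic line of (z, 1). Then xi1 corresponds to 1 and xi2 to -1, the points fixed by the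
  elements \<open>gmat l 0\<close>.\<close>

definition mob :: "complex^2^2 \<Rightarrow> complex \<Rightarrow> complex" where
  "mob g z = (g $ 1 $ 1 * z + g $ 1 $ 2) / (g $ 2 $ 1 * z + g $ 2 $ 2)"

lemma mob_su: "mob (su a b) z = (a * z + b) / (cnj b * z + cnj a)"
  by (simp add: mob_def)

lemma su_denom_nz:
  assumes "cmod b < cmod a" "cmod z = 1" shows "cnj b * z + cnj a \<noteq> 0"
proof
  assume "cnj b * z + cnj a = 0"
  then have "cnj a = - (cnj b * z)" by (simp add: eq_neg_iff_add_eq_0 add.commute)
  then have "cmod (cnj a) = cmod (cnj b * z)" by (metis norm_minus_cancel)
  then show False using assms by (simp add: norm_mult)
qed

lemma norm_mob: assumes "g \<in> SU11" "cmod z = 1" shows "cmod (mob g z) = 1"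
proof -
  obtain a b where g: "g = su a b" "cmod b < cmod a" using SU11E[OF assms(1)] by metis
  have zz: "z * cnj z = 1" using assms(2) by (simp add: mult_cnj_cmod)
  have "a * z + b = z * cnj (cnj b * z + cnj a)"
    using zz by (simp add: distrib_left mult.left_commute[of z b])
  then have "cmod (a * z + b) = cmod (cnj b * z + cnj a)"
    by (simp only: norm_mult complex_mod_cnj assms(2))
  then show ?thesis using su_denom_nz[OF g(2) assms(2)] by (simp add: g mob_su norm_divide)
qed

lemma mob_mult: assumes "g \<in> SU11" "h \<in> SU11" "cmod z = 1" shows "mob (g ** h) z = mob g (mob h z)"
proof -
  obtain a b where g: "g = su a b" "cmod b < cmod a" using SU11E[OF assms(1)] by metis
  obtain c d where h: "h = su c d" "cmod d < cmod c" using SU11E[OF assms(2)] by metis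
  have D: "cnj d * z + cnj c \<noteq> 0" using su_denom_nz[OF h(2) assms(3)] .
  have "cnj b * mob h z + cnj a \<noteq> 0" using su_denom_nz[OF g(2) norm_mob[OF assms(2,3)]] .
  then show ?thesis using D unfolding g h su_mult mob_su
    by (simp add: divide_simps) (simp add: algebra_simps)
qed

lemma mob_one: "mob (mat 1) z = z" "mob (- mat 1) z = z"
  by (simp_all add: mob_def mat_def)

lemma mob_inj:
  assumes "g \<in> SU11" "cmod z = 1" "cmod w = 1" "mob g z = mob g w" shows "z = w"
proof -
  obtain h where h: "h \<in> SU11" "h ** g = mat 1" using SU11_inverse[OF assms(1)] by metis
  have "mob h (mob g z) = z" "mob h (mob g w) = w"
    using mob_mult[OF h(1) assms(1)] assms(2,3) by (simp_all add: h mob_one)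
  then show ?thesis using assms(4) by metis
qed

lemma mob_surj:
  assumes "g \<in> SU11" "cmod z = 1" obtains w where "cmod w = 1" "mob g w = z"
proof -
  obtain h where h: "h \<in> SU11" "g ** h = mat 1" using SU11_inverse[OF assms(1)] by metis
  show thesis
    using that[of "mob h z"] norm_mob[OF h(1) assms(2)] mob_mult[OF assms(1) h(1) assms(2)] by (simp add: h mob_one)
qed

lemma mob_gmat_one: "l > 0 \<Longrightarrow> mob (gmat l b) 1 = 1"
  and mob_gmat_minus_one: "l > 0 \<Longrightarrow> mob (gmat l 0) (- 1) = - 1"
  by (simp_all add: gmat_su mob_su field_simps complex_eq_iff)

lemma mob_parabolic: "mob (gmat 1 b) (- 1) = - (1 + \<i> * b) / (1 - \<i> * b)"
  unfolding gmat_su mob_su by (simp add: field_simps)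

text \<open>If 1 is fixed, xi1 is an eigenvector and its eigenvalue r = a + b is real. A negative r
  is absorbed in the sign of g, which is invisible in PU(1,1).\<close>

lemma stabiliser_one:
  assumes g: "g \<in> SU11" "mob g 1 = 1"
  obtains l b where "l > 0" "g = gmat l b \<or> g = - gmat l b"
proof -
  obtain a b where ab: "g = su a b" "(cmod a)\<^sup>2 - (cmod b)\<^sup>2 = 1" "cmod b < cmod a"
    using SU11E[OF g(1)] by metis
  have "cnj b + cnj a \<noteq> 0" using su_denom_nz[OF ab(3), of 1] by simp
  then have "a + b = cnj b + cnj a" using g(2) by (simp add: ab mob_su)
  then have im: "Im b = - Im a" by (simp add: complex_eq_iff)
  define r where "r = Re a + Re b"
  have "(Re a)\<^sup>2 - (Re b)\<^sup>2 = 1" using ab(2) im by (simp add: cmod_power2)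
  then have r1: "r * (Re a - Re b) = 1" by (simp add: r_def algebra_simps power2_eq_square)
  then have r0: "r \<noteq> 0" by auto
  have d: "Re a - Re b = 1 / r" using r1 r0 by (simp add: field_simps)
  have "Re a = (r + 1 / r) / 2" "Re b = (r - 1 / r) / 2" using d by (simp_all add: r_def)
  then have gg: "g = su ((r + 1 / r + \<i> * (2 * Im a)) / 2) ((r - 1 / r - \<i> * (2 * Im a)) / 2)"
    unfolding ab(1) by (intro arg_cong2[of _ _ _ _ su]) (simp_all add: complex_eq_iff im)
  show thesis
  proof (cases "r > 0")
    case True
    then show thesis using that[of r "2 * Im a"] gg by (simp add: gmat_su)
  next
    case False
    have "g = - gmat (- r) (- 2 * Im a)"
      unfolding gg gmat_su su_neg by (intro arg_cong2[of _ _ _ _ su]) (simp_all add: field_simps)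
    then show thesis using that[of "- r" "- 2 * Im a"] False r0 by simp
  qed
qed

lemma parabolic_transitive:
  assumes "cmod u = 1" "u \<noteq> 1" obtains b where "mob (gmat 1 b) (- 1) = u"
proof -
  have uu: "(Re u)\<^sup>2 + (Im u)\<^sup>2 = 1" using assms(1) by (metis cmod_power2 one_power2)
  have "Re u \<noteq> 1"
  proof
    assume "Re u = 1"
    then have "Im u = 0" using uu by simp
    then show False using \<open>Re u = 1\<close> assms(2) by (simp add: complex_eq_iff)
  qed
  \<comment> \<open>The solution of -(1 + i b) = u (1 - i b), an inverse Cayley transform; it is
    real because |u| = 1.\<close>
  define b where "b = Im u / (Re u - 1)"
  have eq: "- (1 + \<i> * b) = u * (1 - \<i> * b)"
  proof -
    have "- 1 = Re u + Im u * b" using \<open>Re u \<noteq> 1\<close> uu by (simp add: b_def field_simps power2_eq_square)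
    moreover have "- b = Im u - Re u * b" using \<open>Re u \<noteq> 1\<close> by (simp add: b_def field_simps)
    moreover have "Re (u * (1 - \<i> * b)) = Re u + Im u * b" "Im (u * (1 - \<i> * b)) = Im u - Re u * b"
      "Re (- (1 + \<i> * b)) = - 1" "Im (- (1 + \<i> * b)) = - b" by simp_all
    ultimately show ?thesis by (intro complex_eqI) (simp_all only:)
  qed
  have "1 - \<i> * complex_of_real b \<noteq> 0" by (simp add: complex_eq_iff)
  then have "mob (gmat 1 b) (- 1) = u" unfolding mob_parabolic eq by simp
  then show thesis using that by blast
qed

section \<open>Positive definite homogeneous kernels\<close>

text \<open>Geometric weights decouple the double sum: two of its terms are products of power
  series, and the part in n - m, cut at the diagonal, is a Cauchy product with the geometric series
  of |\<zeta>|^2. The two halves share the diagonal, which is harmless because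
  \<open>K 0 = 0\<close>.\<close>

lemma kernel_sum_limit:
  fixes K :: "int \<Rightarrow> complex" and \<zeta> :: complex
  assumes z: "cmod \<zeta> < 1" and sym: "\<And>n. K (- n) = cnj (K n)" and K0: "K 0 = 0"
    and sm: "summable (\<lambda>n. norm (K (int n) * \<zeta> ^ n))"
    and pos: "\<And>N. Re (\<Sum>n<N. \<Sum>m<N. \<zeta> ^ n * cnj \<zeta> ^ m * (K (int n) + cnj (K (int m)) - K (int n - int m))) \<ge> 0"
  defines "F \<equiv> \<Sum>n. K (int n) * \<zeta> ^ n"
  shows "Re (F / (1 - cnj \<zeta>)) \<ge> Re F / (1 - (cmod \<zeta>)\<^sup>2)"
proof -
  define A where "A N = (\<Sum>n<N. K (int n) * \<zeta> ^ n)" for N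
  define G where "G N = (\<Sum>n<N. cnj \<zeta> ^ n)" for N
  define q where "q = complex_of_real ((cmod \<zeta>)\<^sup>2)"
  define D where "D N = (\<Sum>n<N. \<Sum>m\<le>n. q ^ m * (K (int (n - m)) * \<zeta> ^ (n - m)))" for N
  have zz: "\<zeta> * cnj \<zeta> = q" unfolding q_def by (rule mult_cnj_cmod)
  have nq: "cmod q < 1"
    unfolding q_def using z by (simp add: norm_power power_less_one_iff)
  have A: "A \<longlonglongrightarrow> F"
    unfolding A_def F_def by (rule summable_LIMSEQ) (rule summable_norm_cancel[OF sm])
  have G: "G \<longlonglongrightarrow> 1 / (1 - cnj \<zeta>)"
    unfolding G_def using geometric_sums[of "cnj \<zeta>"] z by (simp add: sums_def)
  have D: "D \<longlonglongrightarrow> 1 / (1 - q) * F"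
  proof -
    have "(\<lambda>n. \<Sum>m\<le>n. q ^ m * (K (int (n - m)) * \<zeta> ^ (n - m))) sums ((\<Sum>n. q ^ n) * F)"
      unfolding F_def
      by (rule Cauchy_product_sums) (use sm nq in \<open>auto simp: norm_power intro!: summable_geometric\<close>)
    moreover have "(\<Sum>n. q ^ n) = 1 / (1 - q)" using suminf_geometric[OF nq] .
    ultimately show ?thesis unfolding D_def sums_def by simp
  qed
  have trm: "\<zeta> ^ n * cnj \<zeta> ^ m * K (int n - int m) = q ^ m * (K (int (n - m)) * \<zeta> ^ (n - m))"
    if "m \<le> n" for m n
  proof -
    have "\<zeta> ^ n = \<zeta> ^ m * \<zeta> ^ (n - m)" using that by (simp flip: power_add)
    then show ?thesis using that unfolding zz[symmetric] power_mult_distrib by (simp add: of_nat_diff)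
  qed
  have third: "(\<Sum>n<N. \<Sum>m<N. \<zeta> ^ n * cnj \<zeta> ^ m * K (int n - int m)) = D N + cnj (D N)" for N
  proof -
    let ?t = "\<lambda>n m. \<zeta> ^ n * cnj \<zeta> ^ m * K (int n - int m)"
    have D': "D N = (\<Sum>n<N. \<Sum>m\<le>n. ?t n m)" for N unfolding D_def by (intro sum.cong) (auto simp: trm)
    have tc: "cnj (?t n m) = ?t m n" for n m
      using sym[of "int n - int m"] by (simp add: mult.commute mult.left_commute)
    show ?thesis
    proof (induction N)
      case 0
      then show ?case by (simp add: D_def)
    next
      case (Suc N)
      have "D (Suc N) = D N + (\<Sum>m<Suc N. ?t N m)" unfolding D' lessThan_Suc_atMost[of N, symmetric] sum.lessThan_Suc ..
      then have D1: "D (Suc N) = D N + (\<Sum>m<N. ?t N m)" using K0 by simp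
      have "(\<Sum>n<Suc N. \<Sum>m<Suc N. ?t n m) = (\<Sum>n<N. \<Sum>m<N. ?t n m) + (\<Sum>n<N. ?t n N) + (\<Sum>m<N. ?t N m)"
        using K0 by (simp add: sum.distrib)
      also have "(\<Sum>n<N. ?t n N) = cnj (\<Sum>m<N. ?t N m)" unfolding cnj_sum tc ..
      finally show ?case unfolding Suc.IH D1 complex_cnj_add by simp
    qed
  qed
  have first: "(\<Sum>n<N. \<Sum>m<N. \<zeta> ^ n * cnj \<zeta> ^ m * (K (int n) + cnj (K (int m)) - K (int n - int m)))
      = A N * G N + cnj (A N * G N) - (D N + cnj (D N))" for N
  proof -
    have "A N * G N = (\<Sum>n<N. \<Sum>m<N. \<zeta> ^ n * cnj \<zeta> ^ m * K (int n))"
      unfolding A_def G_def sum_product by (simp add: mult_ac)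
    moreover have "cnj (A N * G N) = (\<Sum>n<N. \<Sum>m<N. \<zeta> ^ n * cnj \<zeta> ^ m * cnj (K (int m)))"
      unfolding A_def G_def sum_product cnj_sum complex_cnj_mult by (subst sum.swap) (simp add: mult_ac)
    ultimately show ?thesis
      unfolding third[symmetric] by (simp add: distrib_left right_diff_distrib sum.distrib sum_subtractf)
  qed
  have "(\<lambda>N. Re (A N * G N + cnj (A N * G N) - (D N + cnj (D N))))
      \<longlonglongrightarrow> Re (F * (1 / (1 - cnj \<zeta>)) + cnj (F * (1 / (1 - cnj \<zeta>))) - (1 / (1 - q) * F + cnj (1 / (1 - q) * F)))"
    by (intro tendsto_intros A G D)
  then have "0 \<le> Re (F * (1 / (1 - cnj \<zeta>)) + cnj (F * (1 / (1 - cnj \<zeta>))) - (1 / (1 - q) * F + cnj (1 / (1 - q) * F)))"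
    by (rule tendsto_lowerbound) (use pos in \<open>auto simp: first\<close>)
  moreover have "Re (1 / (1 - q) * F) = Re F / (1 - (cmod \<zeta>)\<^sup>2)"
  proof -
    have "1 / (1 - q) * F = F / complex_of_real (1 - (cmod \<zeta>)\<^sup>2)" by (simp add: q_def)
    then show ?thesis by (simp only: Re_divide_of_real)
  qed
  ultimately show ?thesis by (simp only: plus_complex.simps minus_complex.simps cnj.simps times_divide_eq_right mult_1_right)
qed

section \<open>Abelian asymptotics of the power series of \<open>n powr t\<close>\<close>

lemma powr_binomial_asymp:
  assumes "t > 0"
  shows "(\<lambda>n. real n powr t / ((t + real n) gchoose n)) \<longlonglongrightarrow> Gamma (t + 1)"
proof -
  have "(\<lambda>n. ((t + of_nat n) gchoose n) * exp (- t * of_real (ln (real n)))) \<longlonglongrightarrow> rGamma (t + 1)"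
    using Gamma_gbinomial[of t] by simp
  then have "(\<lambda>n. inverse (((t + real n) gchoose n) * exp (- t * ln (real n)))) \<longlonglongrightarrow> inverse (rGamma (t + 1))"
    using assms by (intro tendsto_inverse) (auto simp: rGamma_inverse_Gamma Gamma_real_pos less_imp_neq[symmetric] add_pos_pos)
  moreover have "inverse (rGamma (t + 1)) = Gamma (t + 1)" by (simp add: Gamma_def)
  moreover have "\<forall>\<^sub>F n in sequentially. inverse (((t + real n) gchoose n) * exp (- t * ln (real n)))
      = real n powr t / ((t + real n) gchoose n)"
    using eventually_gt_at_top[of 0]
    by eventually_elim (simp add: powr_def exp_minus field_simps)
  ultimately show ?thesis by (simp add: tendsto_cong)
qed

lemma gbinomial_shift_pos: "t > 0 \<Longrightarrow> ((t + real n) gchoose n) > 0"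
  by (auto simp: gbinomial_prod_rev intro!: divide_pos_pos prod_pos)

lemma binomial_series_neg:
  fixes \<zeta> :: complex
  assumes "cmod \<zeta> < 1"
  shows "(\<lambda>n. complex_of_real ((t + real n) gchoose n) * \<zeta> ^ n) sums (1 - \<zeta>) powr (- complex_of_real t - 1)"
proof -
  have "(\<lambda>n. ((- complex_of_real t - 1) gchoose n) * (- \<zeta>) ^ n) sums (1 + - \<zeta>) powr (- complex_of_real t - 1)"
    using assms by (intro gen_binomial_complex) simp
  moreover have "((- complex_of_real t - 1) gchoose n) * (- \<zeta>) ^ n = complex_of_real ((t + real n) gchoose n) * \<zeta> ^ n" for n
  proof -
    have "complex_of_real ((t + real n) gchoose n) = (of_real t + of_nat n) gchoose n"
      by (simp add: gbinomial_prod_rev)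
    also have "\<dots> = (- 1) ^ n * ((- of_real t - 1) gchoose n)"
      using gbinomial_minus'[of "complex_of_real t" n] by simp
    finally show ?thesis by (simp add: power_minus[of \<zeta>])
  qed
  ultimately show ?thesis by simp
qed

lemma binomial_series_neg_real:
  assumes "0 \<le> x" "x < (1::real)"
  shows "(\<lambda>n. ((t + real n) gchoose n) * x ^ n) sums (1 - x) powr (- t - 1)"
proof -
  have "(\<lambda>n. complex_of_real ((t + real n) gchoose n) * complex_of_real x ^ n) sums (1 - complex_of_real x) powr (- complex_of_real t - 1)"
    using assms by (intro binomial_series_neg) simp
  moreover have "(1 - complex_of_real x) powr (- complex_of_real t - 1) = complex_of_real ((1 - x) powr (- t - 1))"
    using assms powr_of_real[of "1 - x" "- t - 1"] by simp
  ultimately have "(\<lambda>n. complex_of_real (((t + real n) gchoose n) * x ^ n)) sums complex_of_real ((1 - x) powr (- t - 1))"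
    by simp
  then show ?thesis by (simp only: sums_of_real_iff)
qed

text \<open>An Abelian theorem: inside a Stolz angle the series of \<open>n powr t\<close> behaves like that of its
  binomial approximation, whose sum is known in closed form.\<close>

lemma polylog_Stolz_limit:
  fixes w :: complex and h :: "nat \<Rightarrow> real"
  assumes t: "t > 0" and w: "cmod w = 1" "Re w > 0"
    and h: "\<And>n. h n > 0" "\<And>n. h n \<le> Re w" "h \<longlonglongrightarrow> 0"
  defines "\<zeta> \<equiv> \<lambda>k. 1 - of_real (h k) * w"
  shows "cmod (\<zeta> k) < 1" "1 - (cmod (\<zeta> k))\<^sup>2 = h k * (2 * Re w - h k)"
    "summable (\<lambda>n. norm (complex_of_real (real n powr t) * \<zeta> k ^ n))"
    "(\<lambda>k. complex_of_real (h k powr (t + 1)) * (\<Sum>n. complex_of_real (real n powr t) * \<zeta> k ^ n))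
       \<longlonglongrightarrow> complex_of_real (Gamma (t + 1)) * w powr (- complex_of_real t - 1)"
proof -
  define b where "b n = ((t + real n) gchoose n)" for n
  have bpos: "b n > 0" for n unfolding b_def using gbinomial_shift_pos[OF t] .
  have lim: "(\<lambda>n. real n powr t / b n) \<longlonglongrightarrow> Gamma (t + 1)" unfolding b_def by (rule powr_binomial_asymp[OF t])
  have ww: "(Re w)\<^sup>2 + (Im w)\<^sup>2 = 1" using w(1) by (metis cmod_power2 one_power2)
  show sq: "1 - (cmod (\<zeta> k))\<^sup>2 = h k * (2 * Re w - h k)" for k
  proof -
    have "(cmod (\<zeta> k))\<^sup>2 = (1 - h k * Re w)\<^sup>2 + (h k * Im w)\<^sup>2" by (simp add: \<zeta>_def cmod_power2)
    also have "\<dots> = 1 - 2 * h k * Re w + (h k)\<^sup>2 * ((Re w)\<^sup>2 + (Im w)\<^sup>2)"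
      by (simp add: power2_eq_square algebra_simps)
    finally show ?thesis unfolding ww by (simp add: power2_eq_square algebra_simps)
  qed
  have pos2: "2 * Re w - h k \<ge> Re w" for k using h(2)[of k] by simp
  show z1: "cmod (\<zeta> k) < 1" for k
  proof -
    have "0 < h k * (2 * Re w - h k)" using h(1)[of k] pos2[of k] w(2) by (intro mult_pos_pos) auto
    then have "(cmod (\<zeta> k))\<^sup>2 < 1\<^sup>2" using sq[of k] by simp
    then show ?thesis using power2_less_imp_less by fastforce
  qed
  \<comment> \<open>The Stolz condition: 1 - |\<zeta>| is bounded below by a fixed multiple of |1 -
    \<zeta>| = h. It lets an error series with absolute values be compared at the same rate
    h^(-t-1).\<close>
  have stolz: "h k * Re w / 2 \<le> 1 - cmod (\<zeta> k)" for k
  proof -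
    have "h k * Re w \<le> h k * (2 * Re w - h k)" using h(1)[of k] pos2 by (intro mult_left_mono) auto
    also have "\<dots> = (1 - cmod (\<zeta> k)) * (1 + cmod (\<zeta> k))" unfolding sq[symmetric] by (simp add: power2_eq_square algebra_simps)
    also have "\<dots> \<le> (1 - cmod (\<zeta> k)) * 2" using z1[of k] by (intro mult_left_mono) auto
    finally show ?thesis by simp
  qed
  have bz: "(\<lambda>n. complex_of_real (b n) * \<zeta> k ^ n) sums (1 - \<zeta> k) powr (- complex_of_real t - 1)" for k
    unfolding b_def using binomial_series_neg[OF z1] .
  have bn: "(\<lambda>n. b n * cmod (\<zeta> k) ^ n) sums (1 - cmod (\<zeta> k)) powr (- t - 1)" for k
    unfolding b_def using binomial_series_neg_real[OF norm_ge_zero z1] .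
  define d where "d n = real n powr t - Gamma (t + 1) * b n" for n
  obtain Cb where Cb: "\<And>n. real n powr t / b n \<le> Cb"
  proof -
    have "Bseq (\<lambda>n. real n powr t / b n)" using lim convergentI convergent_imp_Bseq by blast
    then obtain C where "\<And>n. norm (real n powr t / b n) \<le> C" by (auto simp: Bseq_def)
    then show thesis using that[of C] by (metis abs_le_D1 real_norm_def)
  qed
  have pb: "real n powr t \<le> Cb * b n" for n using Cb[of n] bpos[of n] by (simp add: pos_divide_le_eq)
  show sm: "summable (\<lambda>n. norm (complex_of_real (real n powr t) * \<zeta> k ^ n))" for k
  proof (rule summable_comparison_test')
    show "summable (\<lambda>n. Cb * (b n * cmod (\<zeta> k) ^ n))" using bn sums_summable by (intro summable_mult) blast
    show "norm (norm (complex_of_real (real n powr t) * \<zeta> k ^ n)) \<le> Cb * (b n * cmod (\<zeta> k) ^ n)" for n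
      using mult_right_mono[OF pb[of n], of "cmod (\<zeta> k) ^ n"] by (simp add: norm_mult norm_power mult.assoc)
  qed
  define P where "P k = (\<Sum>n. complex_of_real (real n powr t) * \<zeta> k ^ n)" for k
  define Q where "Q k = (1 - \<zeta> k) powr (- complex_of_real t - 1)" for k
  have PQ: "(\<lambda>n. complex_of_real (d n) * \<zeta> k ^ n) sums (P k - complex_of_real (Gamma (t + 1)) * Q k)" for k
  proof -
    have "(\<lambda>n. complex_of_real (real n powr t) * \<zeta> k ^ n - complex_of_real (Gamma (t + 1)) * (complex_of_real (b n) * \<zeta> k ^ n))
       sums (P k - complex_of_real (Gamma (t + 1)) * Q k)"
      unfolding P_def Q_def
      by (intro sums_diff sums_mult bz summable_sums summable_norm_cancel[OF sm])
    then show ?thesis by (simp add: d_def left_diff_distrib mult.assoc)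
  qed
  have hQ: "complex_of_real (h k powr (t + 1)) * Q k = w powr (- complex_of_real t - 1)" for k
  proof -
    have "Q k = of_real (h k) powr (- complex_of_real t - 1) * w powr (- complex_of_real t - 1)"
      unfolding Q_def \<zeta>_def using h(1)[of k] by (simp add: powr_times_real_left less_imp_le)
    moreover have "of_real (h k) powr (- complex_of_real t - 1) = complex_of_real (h k powr (- t - 1))"
      using powr_of_real[of "h k" "- t - 1"] h(1)[of k] by simp
    moreover have "h k powr (t + 1) * h k powr (- t - 1) = 1"
      using h(1)[of k] by (simp flip: powr_add)
    ultimately show ?thesis by (metis mult.assoc mult_1 of_real_1 of_real_mult)
  qed
  have dlim: "(\<lambda>n. d n / b n) \<longlonglongrightarrow> 0"
  proof -
    have "(\<lambda>n. real n powr t / b n - Gamma (t + 1)) \<longlonglongrightarrow> 0" using lim by (simp add: LIM_zero)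
    moreover have "real n powr t / b n - Gamma (t + 1) = d n / b n" for n
      using bpos[of n] by (simp add: d_def field_simps)
    ultimately show ?thesis by simp
  qed
  define E where "E k = complex_of_real (h k powr (t + 1)) * (P k - complex_of_real (Gamma (t + 1)) * Q k)" for k
  have "E \<longlonglongrightarrow> 0"
  proof (rule LIMSEQ_I)
    fix r :: real assume r: "r > 0"
    \<comment> \<open>After scaling by h^(t+1) the terms with n >= N contribute at most \<epsilon>
      c, the factor \<open>c\<close> coming from \<open>stolz\<close>; \<epsilon> is chosen to make
      this r / 2. The first N terms are bounded by the constant \<open>C\<close>, and h^(t+1)
      \<open>C\<close> tends to 0.\<close>
    define c where "c = (Re w / 2) powr (- t - 1)"
    have c: "c > 0" using w(2) by (simp add: c_def)
    define \<epsilon> where "\<epsilon> = r / (2 * c)"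
    have e: "\<epsilon> > 0" using r c by (simp add: \<epsilon>_def)
    obtain N where N: "\<And>n. n \<ge> N \<Longrightarrow> \<bar>d n / b n\<bar> < \<epsilon>"
      using LIMSEQ_D[OF dlim e] by auto
    define C where "C = (\<Sum>n<N. \<bar>d n\<bar>)"
    have bound: "cmod (P k - complex_of_real (Gamma (t + 1)) * Q k) \<le> C + \<epsilon> * (1 - cmod (\<zeta> k)) powr (- t - 1)" for k
    proof -
      let ?g = "\<lambda>n. (if n < N then \<bar>d n\<bar> else 0) + \<epsilon> * (b n * cmod (\<zeta> k) ^ n)"
      have g: "?g sums (C + \<epsilon> * (1 - cmod (\<zeta> k)) powr (- t - 1))"
        unfolding C_def using sums_If_finite_set[of "{..<N}" "\<lambda>n. \<bar>d n\<bar>"]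
        by (intro sums_add sums_mult bn) simp
      have le: "norm (complex_of_real (d n) * \<zeta> k ^ n) \<le> ?g n" for n
      proof (cases "n < N")
        case True
        have "\<bar>d n\<bar> * cmod (\<zeta> k) ^ n \<le> \<bar>d n\<bar> * 1" using z1[of k] by (intro mult_left_mono power_le_one) auto
        moreover have "0 \<le> \<epsilon> * (b n * cmod (\<zeta> k) ^ n)" using e bpos[of n] by simp
        ultimately show ?thesis using True by (simp add: norm_mult norm_power)
      next
        case False
        then have "\<bar>d n\<bar> / b n \<le> \<epsilon>" using N[of n] bpos[of n] by (simp add: abs_divide)
        then have "\<bar>d n\<bar> \<le> \<epsilon> * b n" using bpos[of n] by (simp add: pos_divide_le_eq)
        then have "\<bar>d n\<bar> * cmod (\<zeta> k) ^ n \<le> \<epsilon> * b n * cmod (\<zeta> k) ^ n" by (intro mult_right_mono) auto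
        then show ?thesis using False by (simp add: norm_mult norm_power mult.assoc)
      qed
      have "cmod (\<Sum>n. complex_of_real (d n) * \<zeta> k ^ n) \<le> suminf ?g"
        by (rule norm_suminf_le) (use g le in \<open>auto intro: sums_summable\<close>)
      then show ?thesis using sums_unique[OF g] sums_unique[OF PQ[of k]] by simp
    qed
    have Ebound: "cmod (E k) \<le> h k powr (t + 1) * C + r / 2" for k
    proof -
      have "(1 - cmod (\<zeta> k)) powr (- t - 1) \<le> (h k * (Re w / 2)) powr (- t - 1)"
        using stolz[of k] h(1)[of k] w(2) t by (intro powr_mono2') (auto simp: mult.commute)
      also have "\<dots> = h k powr (- t - 1) * c"
        unfolding c_def by (rule powr_mult)
      finally have "\<epsilon> * (1 - cmod (\<zeta> k)) powr (- t - 1) \<le> \<epsilon> * (h k powr (- t - 1) * c)"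
        using e by (intro mult_left_mono) auto
      then have "cmod (P k - complex_of_real (Gamma (t + 1)) * Q k) \<le> C + \<epsilon> * (h k powr (- t - 1) * c)"
        using bound[of k] by linarith
      then have "h k powr (t + 1) * cmod (P k - complex_of_real (Gamma (t + 1)) * Q k) \<le> h k powr (t + 1) * (C + \<epsilon> * (h k powr (- t - 1) * c))"
        by (intro mult_left_mono) auto
      also have "\<dots> = h k powr (t + 1) * C + (h k powr (t + 1) * h k powr (- t - 1)) * (\<epsilon> * c)"
        by (simp add: algebra_simps)
      also have "h k powr (t + 1) * h k powr (- t - 1) = 1"
        using h(1)[of k] by (simp flip: powr_add)
      also have "\<epsilon> * c = r / 2" using c by (simp add: \<epsilon>_def)
      finally show ?thesis by (simp add: E_def norm_mult)
    qed
    have "(\<lambda>k. h k powr (t + 1) * C) \<longlonglongrightarrow> 0 * C"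
    proof (intro tendsto_mult tendsto_const)
      have "(\<lambda>k. h k powr (t + 1)) \<longlonglongrightarrow> 0 powr (t + 1)"
        using h t by (intro tendsto_powr2 tendsto_const) (auto simp: less_imp_le)
      then show "(\<lambda>k. h k powr (t + 1)) \<longlonglongrightarrow> 0" by simp
    qed
    then obtain M where M: "\<And>k. k \<ge> M \<Longrightarrow> \<bar>h k powr (t + 1) * C\<bar> < r / 2"
      using LIMSEQ_D[of "\<lambda>k. h k powr (t + 1) * C" 0 "r / 2"] r by auto
    have "norm (E k - 0) < r" if "k \<ge> M" for k
      using M[OF that] Ebound[of k] by simp
    then show "\<exists>no. \<forall>n\<ge>no. norm (E n - 0) < r" by blast
  qed
  then have "(\<lambda>k. E k + complex_of_real (Gamma (t + 1)) * w powr (- complex_of_real t - 1))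
      \<longlonglongrightarrow> 0 + complex_of_real (Gamma (t + 1)) * w powr (- complex_of_real t - 1)"
    by (intro tendsto_intros)
  moreover have "E k + complex_of_real (Gamma (t + 1)) * w powr (- complex_of_real t - 1) = complex_of_real (h k powr (t + 1)) * P k" for k
    unfolding E_def hQ[of k, symmetric] by (simp add: algebra_simps)
  ultimately show "(\<lambda>k. complex_of_real (h k powr (t + 1)) * (\<Sum>n. complex_of_real (real n powr t) * \<zeta> k ^ n))
       \<longlonglongrightarrow> complex_of_real (Gamma (t + 1)) * w powr (- complex_of_real t - 1)"
    by (simp add: P_def)
qed

text \<open>All conditions are linear in \<open>K\<close>, so that admissible values can be added.\<close>

definition admissible :: "real \<Rightarrow> complex \<Rightarrow> bool" where
  "admissible t K \<longleftrightarrow> 0 < t \<and> t < 2 \<and> 0 < Re K \<and> 0 \<le> Re (K * cis ((t - 1) * pi / 2)) \<and> 0 \<le> Re (K * cis (- ((t - 1) * pi / 2)))"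

lemma admissible_add: "admissible t K \<Longrightarrow> admissible t L \<Longrightarrow> admissible t (K + L)"
  by (simp add: admissible_def distrib_right)

text \<open>Along \<zeta> = 1 - h w the series of \<open>K\<close>, scaled by h^(t+1), tends to
  \<kappa> R with R = Gamma(t+1) w^(-t-1), the Laplace transform of x^t at w. The kernel inequality
  becomes Re (\<kappa> R) <= 2 cos \<psi> Re (\<kappa> R w). As 2 cos \<psi> = w + cnj w and |w| =
  1, the difference of the two sides is Gamma(t+1) Re (\<kappa> w^(1-t)).\<close>

lemma positive_definite_imp_sector:
  fixes K :: "int \<Rightarrow> complex" and \<kappa> :: complex
  assumes t: "t > 0" and K: "\<And>n::nat. K (int n) = of_real (real n powr t) * \<kappa>"
    and sym: "\<And>n. K (- n) = cnj (K n)"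
    and pos: "\<And>N \<zeta>. Re (\<Sum>n<N. \<Sum>m<N. \<zeta> ^ n * cnj \<zeta> ^ m * (K (int n) + cnj (K (int m)) - K (int n - int m))) \<ge> 0"
    and psi: "\<bar>\<psi>\<bar> < pi / 2"
  shows "0 \<le> Re (\<kappa> * cis (- ((t - 1) * \<psi>)))"
proof -
  define w where "w = cis \<psi>"
  have cpos: "cos \<psi> > 0" using psi by (intro cos_gt_zero_pi) auto
  have w: "cmod w = 1" "Re w > 0" using cpos by (simp_all add: w_def)
  \<comment> \<open>The ray toward 1 starts at step length cos \<psi> = Re w, which keeps \<zeta>
    inside the disc, since 1 - |\<zeta>|^2 = h (2 Re w - h).\<close>
  define h where "h k = cos \<psi> / real (k + 1)" for k
  have h: "h k > 0" "h k \<le> Re w" "h \<longlonglongrightarrow> 0" for k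
  proof -
    show "h k > 0" "h k \<le> Re w" using cpos by (simp_all add: h_def w_def field_simps)
    have "(\<lambda>k. cos \<psi> * inverse (real (Suc k))) \<longlonglongrightarrow> cos \<psi> * 0" by (intro tendsto_mult tendsto_const LIMSEQ_inverse_real_of_nat)
    then show "h \<longlonglongrightarrow> 0" by (simp add: h_def[abs_def] divide_inverse)
  qed
  define \<zeta> where "\<zeta> k = 1 - of_real (h k) * w" for k
  note L = polylog_Stolz_limit[OF t w h, folded \<zeta>_def]
  define P where "P k = (\<Sum>n. complex_of_real (real n powr t) * \<zeta> k ^ n)" for k
  define R where "R = complex_of_real (Gamma (t + 1)) * w powr (- complex_of_real t - 1)"
  have F: "(\<Sum>n. K (int n) * \<zeta> k ^ n) = \<kappa> * P k" for k
    unfolding K P_def using suminf_mult[OF summable_norm_cancel[OF L(3)[of k]], of \<kappa>] by (simp add: mult_ac)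
  have ineq: "Re (\<kappa> * P k) / (1 - (cmod (\<zeta> k))\<^sup>2) \<le> Re (\<kappa> * P k / (1 - cnj (\<zeta> k)))" for k
    unfolding F[symmetric]
  proof (rule kernel_sum_limit[OF L(1) sym _ _ pos])
    show "K 0 = 0" using K[of 0] by simp
    show "summable (\<lambda>n. norm (K (int n) * \<zeta> k ^ n))"
      using summable_mult[OF L(3)[of k], of "cmod \<kappa>"] by (simp add: K norm_mult mult_ac)
  qed
  let ?q = "\<lambda>k. complex_of_real (h k powr (t + 1)) * P k"
  have lim: "?q \<longlonglongrightarrow> R" using L(4) unfolding P_def R_def .
  have ineq2: "Re (\<kappa> * ?q k) / (2 * cos \<psi> - h k) \<le> Re (\<kappa> * ?q k * w)" for k
  proof -
    have hk: "h k > 0" by (rule h)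
    have 1: "1 - (cmod (\<zeta> k))\<^sup>2 = h k * (2 * cos \<psi> - h k)" unfolding L(2) by (simp add: w_def)
    have ww: "w * cnj w = 1" using w(1) by (simp add: mult_cnj_cmod)
    have "1 - cnj (\<zeta> k) = of_real (h k) * cnj w" by (simp add: \<zeta>_def)
    then have 2: "x / (1 - cnj (\<zeta> k)) = x * w / of_real (h k)" for x
      using ww hk by (simp add: divide_simps)
    have "Re (\<kappa> * P k) / (h k * (2 * cos \<psi> - h k)) \<le> Re (\<kappa> * P k * w) / h k"
      using ineq[of k] unfolding 1 2 Re_divide_of_real .
    then have "h k powr (t + 1) * h k * (Re (\<kappa> * P k) / (h k * (2 * cos \<psi> - h k))) \<le> h k powr (t + 1) * h k * (Re (\<kappa> * P k * w) / h k)"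
      using hk by (intro mult_left_mono) auto
    then have "h k powr (t + 1) * Re (\<kappa> * P k) / (2 * cos \<psi> - h k) \<le> h k powr (t + 1) * Re (\<kappa> * P k * w)"
      using hk by simp
    moreover have "Re (\<kappa> * ?q k) = h k powr (t + 1) * Re (\<kappa> * P k)"
      and "Re (\<kappa> * ?q k * w) = h k powr (t + 1) * Re (\<kappa> * P k * w)"
      by (simp_all add: algebra_simps)
    ultimately show ?thesis by simp
  qed
  have l1: "(\<lambda>k. Re (\<kappa> * ?q k) / (2 * cos \<psi> - h k)) \<longlonglongrightarrow> Re (\<kappa> * R) / (2 * cos \<psi> - 0)"
    using cpos by (intro tendsto_intros lim h) simp
  have l2: "(\<lambda>k. Re (\<kappa> * ?q k * w)) \<longlonglongrightarrow> Re (\<kappa> * R * w)" by (intro tendsto_intros lim)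
  have "Re (\<kappa> * R) / (2 * cos \<psi> - 0) \<le> Re (\<kappa> * R * w)"
    by (rule tendsto_le[OF _ l2 l1]) (use ineq2 in auto)
  then have main: "Re (\<kappa> * R) \<le> 2 * cos \<psi> * Re (\<kappa> * R * w)" using cpos by (simp add: pos_divide_le_eq mult.commute)
  have wp: "w powr (- complex_of_real t - 1) = cis (- ((t + 1) * \<psi>))"
  proof -
    have "Ln w = \<i> * \<psi>" unfolding w_def cis_conv_exp using psi by (intro Ln_exp) auto
    moreover have "w \<noteq> 0" using w by auto
    moreover have "(- complex_of_real t - 1) * (\<i> * \<psi>) = \<i> * of_real (- ((t + 1) * \<psi>))" by (simp add: algebra_simps)
    ultimately show ?thesis by (simp only: powr_def cis_conv_exp if_False)
  qed
  define g where "g = Gamma (t + 1)"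
  have g: "g > 0" unfolding g_def using t by (intro Gamma_real_pos) auto
  have "complex_of_real (2 * cos \<psi>) = w + cnj w" by (simp add: w_def complex_eq_iff)
  then have id: "complex_of_real (2 * cos \<psi>) * (cis (- ((t + 1) * \<psi>)) * w) - cis (- ((t + 1) * \<psi>)) = cis (- ((t - 1) * \<psi>))"
    by (simp add: w_def cis_mult cis_cnj distrib_right algebra_simps)
  have re: "Re (complex_of_real r * x) = r * Re x" for r x by simp
  have "complex_of_real g * (\<kappa> * cis (- ((t - 1) * \<psi>))) = complex_of_real (2 * cos \<psi>) * (\<kappa> * R * w) - \<kappa> * R"
    unfolding id[symmetric] R_def wp g_def by (simp add: algebra_simps)
  then have "g * Re (\<kappa> * cis (- ((t - 1) * \<psi>))) = 2 * cos \<psi> * Re (\<kappa> * R * w) - Re (\<kappa> * R)"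
    using re by (metis minus_complex.simps(1))
  then have "0 \<le> g * Re (\<kappa> * cis (- ((t - 1) * \<psi>)))" using main by simp
  then show ?thesis using g by (simp add: zero_le_mult_iff)
qed

text \<open>The endpoints \<psi> = pi/2 and -pi/2 are not reached by rays inside the disc, since cos
  \<psi> = 0 there; continuity of the closed condition supplies them.\<close>

lemma sector_closure:
  assumes "\<And>\<psi>. \<bar>\<psi>\<bar> < pi / 2 \<Longrightarrow> 0 \<le> Re (\<kappa> * cis (- ((t - 1) * \<psi>)))"
  shows "0 \<le> Re (\<kappa> * cis ((t - 1) * pi / 2))" "0 \<le> Re (\<kappa> * cis (- ((t - 1) * pi / 2)))"
proof -
  have *: "0 \<le> Re (\<kappa> * cis (- ((t - 1) * (s * (pi / 2)))))" if s: "\<bar>s\<bar> = 1" for s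
  proof (rule tendsto_lowerbound)
    have "(\<lambda>k. s * (pi / 2) * (1 - inverse (real (Suc k)))) \<longlonglongrightarrow> s * (pi / 2) * (1 - 0)"
      by (intro tendsto_intros LIMSEQ_inverse_real_of_nat)
    then have l: "(\<lambda>k. s * (pi / 2) * (1 - inverse (real (Suc k)))) \<longlonglongrightarrow> s * (pi / 2)" by simp
    show "(\<lambda>k. Re (\<kappa> * cis (- ((t - 1) * (s * (pi / 2) * (1 - inverse (real (Suc k)))))))) \<longlonglongrightarrow> Re (\<kappa> * cis (- ((t - 1) * (s * (pi / 2)))))"
      unfolding cis_conv_exp by (intro tendsto_intros l)
    have "\<bar>s * (pi / 2) * (1 - inverse (real (Suc k)))\<bar> < pi / 2" for k
      using s by (simp add: abs_mult field_simps)
    then show "\<forall>\<^sub>F k in sequentially. 0 \<le> Re (\<kappa> * cis (- ((t - 1) * (s * (pi / 2) * (1 - inverse (real (Suc k)))))))"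
      using assms by (intro always_eventually allI) blast
  qed auto
  show "0 \<le> Re (\<kappa> * cis ((t - 1) * pi / 2))" "0 \<le> Re (\<kappa> * cis (- ((t - 1) * pi / 2)))"
    using *[of "-1"] *[of 1] by (simp_all del: times_complex.simps)
qed

section \<open>The kernel of an irreducible representation\<close>

lemma coord_nz_exists: "x \<noteq> 0 \<Longrightarrow> \<exists>k. coord x k \<noteq> 0"
  using l2_eqI[of x 0] by auto

lemma norm_BB_le: "cmod (BB x y) \<le> 3 * norm x * norm y"
proof -
  have "cmod (2 * coord x 0 * cnj (coord y 0)) \<le> 2 * norm x * norm y"
    unfolding norm_mult using mult_mono[OF cmod_coord_le[of x 0] cmod_coord_le[of y 0]] by simp
  then show ?thesis
    using norm_triangle_ineq4[of "2 * coord x 0 * cnj (coord y 0)" "cin x y"] norm_cin_le[of x y]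
    unfolding BB_def by linarith
qed

lemma unitary_comp: "unitary S \<Longrightarrow> unitary T \<Longrightarrow> unitary (S \<circ> T)"
proof -
  assume S: "unitary S" and T: "unitary T"
  obtain C D where C: "\<And>x. norm (S x) \<le> C * norm x" and D: "\<And>x. norm (T x) \<le> D * norm x"
    using unitaryD(8)[OF S] unitaryD(8)[OF T] by blast
  have "norm (S (T x)) \<le> (\<bar>C\<bar> * D) * norm x" for x
  proof -
    have "norm (S (T x)) \<le> C * norm (T x)" by (rule C)
    also have "\<dots> \<le> \<bar>C\<bar> * norm (T x)" by (intro mult_right_mono) auto
    also have "\<dots> \<le> \<bar>C\<bar> * (D * norm x)" by (intro mult_left_mono D) auto
    finally show ?thesis by (simp add: mult.assoc)
  qed
  then show ?thesis
    unfolding unitary_def using S T by (auto simp: unitaryD bij_comp o_def intro: bij_comp[unfolded o_def])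
qed

lemma unitary_scale:
  assumes T: "unitary T" and c: "cmod c = 1" shows "unitary (\<lambda>x. c *\<^sub>C T x)"
proof -
  have cc: "c * cnj c = 1" "cnj c * c = 1" using c mult_cnj_cmod[of c] by (simp_all add: mult.commute)
  have "bij (\<lambda>x. c *\<^sub>C x)" by (rule o_bij[where g = "\<lambda>x. cnj c *\<^sub>C x"]) (simp_all add: cc fun_eq_iff)
  then have "bij (\<lambda>x. c *\<^sub>C T x)" using bij_comp[OF unitaryD(1)[OF T]] by (simp add: o_def)
  moreover have "BB (c *\<^sub>C T x) (c *\<^sub>C T y) = BB x y" for x y
  proof -
    have "BB (c *\<^sub>C T x) (c *\<^sub>C T y) = (c * cnj c) * BB (T x) (T y)" by (simp only: BB_scale mult.assoc mult.left_commute)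
    then show ?thesis by (simp add: cc unitaryD(4)[OF T])
  qed
  moreover have "\<exists>C. \<forall>x. norm (c *\<^sub>C T x) \<le> C * norm x" using unitaryD(8)[OF T] by (simp add: c)
  ultimately show ?thesis
    unfolding unitary_def by (simp add: unitaryD(2,3)[OF T] scaleC_add mult.commute)
qed

text \<open>Only boundedness of the inverse needs an argument. \<open>norm_le_form\<close> with the
  positive vector \<open>ek 0\<close> bounds \<open>inv T x\<close> by its form value, which is that
  of \<open>x\<close>, and by its pairing with \<open>v\<close>, which is the pairing of
  \<open>x\<close> with \<open>T v\<close>.\<close>

lemma unitary_inv:
  assumes T: "unitary T" shows "unitary (inv T)" "T (inv T x) = x" "inv T (T x) = x"
proof -
  note D = unitaryD[OF T]
  show Ti: "T (inv T x) = x" and iT: "inv T (T x) = x" for x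
    using D(1) by (simp_all add: bij_is_surj surj_f_inv_f bij_is_inj)
  define v where "v = ek 0"
  have vv: "BB v v = 1"
  proof -
    have "cin v v = 1" unfolding cin_def v_def by (subst suminf_finite[of "{0}"]) auto
    then show ?thesis by (simp add: BB_def v_def)
  qed
  then have v: "Re (BB v v) > 0" by simp
  have B: "BB (inv T x) (inv T y) = BB x y" for x y using D(4)[of "inv T x" "inv T y"] by (simp add: Ti)
  have lin: "inv T (x + y) = inv T x + inv T y" "inv T (c *\<^sub>C x) = c *\<^sub>C inv T x" for x y c
    by (metis D(2) Ti iT) (metis D(3) Ti iT)
  define A where "A = 3 * norm (T v)"
  have bound: "norm (inv T x) \<le> sqrt (4 * (norm v)\<^sup>2 * A\<^sup>2 + 6 * (norm v)\<^sup>2) * norm x" for x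
  proof -
    have "BB (inv T x) v = BB x (T v)" using D(4)[of "inv T x" v] by (simp add: Ti)
    then have b: "cmod (BB (inv T x) v) \<le> A * norm x"
      unfolding A_def using norm_BB_le[of x "T v"] by (simp add: mult_ac)
    then have b2: "(cmod (BB (inv T x) v))\<^sup>2 \<le> A\<^sup>2 * (norm x)\<^sup>2"
      by (metis norm_ge_zero power_mono power_mult_distrib)
    have c: "- Re (BB (inv T x) (inv T x)) \<le> 3 * (norm x)\<^sup>2"
      unfolding B using norm_BB_le[of x x] complex_Re_le_cmod[of "- BB x x"] by (simp add: power2_eq_square mult.assoc)
    have "(norm (inv T x))\<^sup>2 \<le> 2 * (cmod (BB (inv T x) v))\<^sup>2 * (norm v)\<^sup>2 +
       2 * (norm v)\<^sup>2 * ((cmod (BB (inv T x) v))\<^sup>2 - Re (BB (inv T x) (inv T x)))"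
      using norm_le_form[OF v, of "inv T x"] by (simp add: vv)
    also have "\<dots> \<le> 2 * (A\<^sup>2 * (norm x)\<^sup>2) * (norm v)\<^sup>2 + 2 * (norm v)\<^sup>2 * (A\<^sup>2 * (norm x)\<^sup>2 + 3 * (norm x)\<^sup>2)"
      using b2 c by (intro add_mono mult_mono mult_left_mono mult_right_mono) auto
    also have "\<dots> = (4 * (norm v)\<^sup>2 * A\<^sup>2 + 6 * (norm v)\<^sup>2) * (norm x)\<^sup>2" by (simp add: algebra_simps)
    finally have "sqrt ((norm (inv T x))\<^sup>2) \<le> sqrt ((4 * (norm v)\<^sup>2 * A\<^sup>2 + 6 * (norm v)\<^sup>2) * (norm x)\<^sup>2)"
      by (rule real_sqrt_le_mono)
    then show ?thesis by (simp add: real_sqrt_mult)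
  qed
  show "unitary (inv T)" unfolding unitary_def using bij_imp_bij_inv[OF D(1)] lin B bound by blast
qed

text \<open>The support window makes the induction work: two solutions with disjoint supports
  combine to one that also kills the new vector, and disjointness prevents the combination from
  vanishing. The result shows that a space spanned by finitely many vectors is proper.\<close>

lemma orthogonal_vector_exists:
  assumes "finite A"
  shows "\<exists>u M. u \<noteq> 0 \<and> (\<forall>k. coord u k \<noteq> 0 \<longrightarrow> m \<le> k \<and> k < M) \<and> (\<forall>a\<in>A. BB u a = 0)"
  using assms
proof (induction A arbitrary: m rule: finite_induct)
  case empty
  have "ek m \<noteq> 0" by (metis coord_ek coord_simps(1) zero_neq_one)
  then show ?case by (intro exI[of _ "ek m"] exI[of _ "Suc m"]) auto
next
  case (insert a A)
  obtain u M where u: "u \<noteq> 0" "\<And>k. coord u k \<noteq> 0 \<Longrightarrow> m \<le> k \<and> k < M" "\<And>b. b \<in> A \<Longrightarrow> BB u b = 0"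
    using insert.IH[of m] by blast
  obtain v N where v: "v \<noteq> 0" "\<And>k. coord v k \<noteq> 0 \<Longrightarrow> M \<le> k \<and> k < N" "\<And>b. b \<in> A \<Longrightarrow> BB v b = 0"
    using insert.IH[of M] by blast
  show ?case
  proof (cases "BB u a = 0")
    case True
    then show ?thesis using u by (intro exI[of _ u] exI[of _ M]) auto
  next
    case False
    let ?c = "BB v a / BB u a" let ?w = "v - ?c *\<^sub>C u"
    obtain k where k: "coord v k \<noteq> 0" using coord_nz_exists[OF v(1)] by blast
    then have "coord u k = 0" using u(2)[of k] v(2)[of k] by linarith
    then have "?w \<noteq> 0" using k by (metis coord_simps(1,3,5) diff_0_right mult_zero_right)
    obtain k0 where k0: "coord u k0 \<noteq> 0" using coord_nz_exists[OF u(1)] by blast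
    then have mM: "m \<le> M" using u(2)[of k0] by simp
    have "M \<le> N" using v(2)[OF k] by simp
    have "m \<le> k \<and> k < N" if "coord ?w k \<noteq> 0" for k
    proof -
      have "coord v k \<noteq> 0 \<or> coord u k \<noteq> 0" using that by auto
      then show ?thesis using u(2)[of k] v(2)[of k] mM \<open>M \<le> N\<close> by linarith
    qed
    moreover have "BB ?w b = 0" if "b \<in> insert a A" for b
      using that u v False by (auto simp: BB_lin)
    ultimately show ?thesis using \<open>?w \<noteq> 0\<close> by blast
  qed
qed

locale rep =
  fixes \<rho> :: "complex^2^2 \<Rightarrow> vect set \<Rightarrow> vect set"
  assumes is_rep: "is_rep \<rho>"
begin

lemma lift: assumes "g \<in> SU11" obtains T where "unitary T" "lifted T (\<rho> g)"
proof -
  have "\<forall>g\<in>SU11. \<exists>T. unitaryB T \<and> lifts T (\<rho> g)"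
    by (rule conjunct1[OF is_rep[unfolded is_rep_def]])
  then obtain T where "unitaryB T" "lifts T (\<rho> g)" using assms by blast
  then show thesis using that unitaryB_imp_unitary by blast
qed

lemma lin_Lines: "x \<noteq> 0 \<Longrightarrow> lin x \<in> Lines"
  unfolding Lines_alt by blast

lemma mult: "g \<in> SU11 \<Longrightarrow> h \<in> SU11 \<Longrightarrow> x \<noteq> 0 \<Longrightarrow> \<rho> (g ** h) (lin x) = \<rho> g (\<rho> h (lin x))"
  using conjunct1[OF conjunct2[OF is_rep[unfolded is_rep_def]]] lin_Lines by blast

lemma neg_one: "x \<noteq> 0 \<Longrightarrow> \<rho> (- mat 1) (lin x) = lin x"
  using conjunct1[OF conjunct2[OF conjunct2[OF is_rep[unfolded is_rep_def]]]] lin_Lines by blast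

lemma neg: assumes "g \<in> SU11" "x \<noteq> 0" shows "\<rho> (- g) (lin x) = \<rho> g (lin x)"
proof -
  have "g ** (- mat 1) = - g" by (rule matrix2_eqI) (simp_all add: mult_nth2 mat_def)
  then show ?thesis using mult[OF assms(1) SU11_one(2) assms(2)] neg_one[OF assms(2)] by simp
qed

lemma one: assumes "x \<noteq> 0" shows "\<rho> (mat 1) (lin x) = lin x"
proof -
  have "- mat 1 ** - mat 1 = (mat 1 :: complex^2^2)" by (rule matrix2_eqI) (simp_all add: mult_nth2 mat_def)
  then show ?thesis using mult[OF SU11_one(2) SU11_one(2) assms] neg_one[OF assms] by simp
qed

end

section \<open>The horospherical kernel of a representation with given axis\<close>

locale axis_rep = rep +
  fixes t :: real and e1 e2 :: l2 and U1 :: "l2 \<Rightarrow> l2"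
  assumes irred: "irreducible_rep \<rho>" and ell: "has_ell \<rho> t"
    and e: "BB e1 e1 = 0" "BB e2 e2 = 0" "BB e1 e2 = 1"
    and fix1: "\<And>l b. l > 0 \<Longrightarrow> \<rho> (gmat l b) (lin e1) = lin e1"
    and fix2: "\<And>l. l > 0 \<Longrightarrow> \<rho> (gmat l 0) (lin e2) = lin e2"
    and U1: "unitary U1" "lifted U1 (\<rho> (gmat 1 1))" "U1 e1 = e1"
begin

lemma e21: "BB e2 e1 = 1" using BB_cnj[of e1 e2] e by simp
lemma e_nz: "e1 \<noteq> 0" "e2 \<noteq> 0" using e by (auto simp: BB_0)
lemma t_pos: "t > 0" using ell by (simp add: has_ell_def)

lemma axis_lift:
  assumes "l > 0"
  obtains M \<mu> \<nu> where "unitary M" "lifted M (\<rho> (gmat l 0))" "M e1 = \<mu> *\<^sub>C e1" "M e2 = \<nu> *\<^sub>C e2"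
    "\<mu> * cnj \<nu> = 1" "\<bar>ln (cmod \<mu>)\<bar> = t * \<bar>ln l\<bar>"
proof -
  obtain M where M: "unitary M" "lifted M (\<rho> (gmat l 0))" using lift[OF gmat_SU11[OF assms]] .
  have "lin (M e1) = lin e1" "lin (M e2) = lin e2"
    using liftedD[OF M(2)] e_nz fix1[OF assms] fix2[OF assms] by metis+
  then obtain \<mu> \<nu> where Me: "M e1 = \<mu> *\<^sub>C e1" "M e2 = \<nu> *\<^sub>C e2" unfolding lin_eq_iff by blast
  have "\<bar>ln (cmod \<mu>)\<bar> = transl_length (\<rho> (gmat l 0))"
    using transl_length_axis[OF M(1) Me e M(2)] by simp
  also have "\<dots> = t * \<bar>ln l\<bar>" using ell assms by (simp add: has_ell_def)
  finally show thesis using that M Me axis_multipliers(1)[OF M(1) Me e] by blast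
qed

text \<open>An arbitrary lift only maps \<open>e1\<close> to a multiple of itself. A lift fixing
  \<open>e1\<close> is given for b = 1; conjugation by the lift of g(sqrt b, 0) carries it to every
  b > 0, and inversion to b < 0.\<close>

lemma parabolic_lift: obtains U where "unitary U" "lifted U (\<rho> (gmat 1 b))" "U e1 = e1"
proof -
  have pos: "\<exists>U. unitary U \<and> lifted U (\<rho> (gmat 1 b)) \<and> U e1 = e1" if b: "b > 0" for b
  proof -
    define l where "l = sqrt b"
    have l: "l > 0" "l * l = b" using b by (simp_all add: l_def)
    obtain M \<mu> \<nu> where M: "unitary M" "lifted M (\<rho> (gmat l 0))" "M e1 = \<mu> *\<^sub>C e1" "\<mu> * cnj \<nu> = 1"
      using axis_lift[OF l(1)] by metis
    note I = unitary_inv[OF M(1)]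
    have mu: "\<mu> \<noteq> 0" using M(4) by auto
    have "inv M e1 = (1 / \<mu>) *\<^sub>C e1"
    proof -
      have "M ((1 / \<mu>) *\<^sub>C e1) = e1" using mu by (simp add: unitaryD[OF M(1)] M(3))
      then show ?thesis using I(3) by metis
    qed
    then have "(M \<circ> (U1 \<circ> inv M)) e1 = e1" using mu by (simp add: unitaryD[OF M(1)] unitaryD[OF U1(1)] U1(3) M(3))
    moreover have "unitary (M \<circ> (U1 \<circ> inv M))" using unitary_comp M(1) U1(1) I(1) by blast
    moreover have "\<rho> (gmat 1 b) (lin x) = lin (M (U1 (inv M x)))" if x: "x \<noteq> 0" for x
    proof -
      have nz: "inv M x \<noteq> 0" "U1 (inv M x) \<noteq> 0" using x unitaryD(7)[OF I(1)] unitaryD(7)[OF U1(1)] by simp_all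
      have "gmat 1 b ** gmat l 0 = gmat l 0 ** gmat 1 1"
        using l by (simp add: gmat_mult) (metis nonzero_mult_div_cancel_left less_irrefl)
      moreover have "lin x = \<rho> (gmat l 0) (lin (inv M x))" using liftedD[OF M(2) nz(1)] I(2) by simp
      ultimately have "\<rho> (gmat 1 b) (lin x) = \<rho> (gmat l 0) (\<rho> (gmat 1 1) (lin (inv M x)))"
        using mult gmat_SU11 l(1) nz(1) by (metis zero_less_one)
      also have "\<dots> = lin (M (U1 (inv M x)))" using liftedD[OF U1(2) nz(1)] liftedD[OF M(2) nz(2)] by simp
      finally show ?thesis .
    qed
    ultimately show ?thesis
      by (intro exI[of _ "M \<circ> (U1 \<circ> inv M)"]) (simp add: lifted_def)
  qed
  consider "b > 0" | "b = 0" | "b < 0" by linarith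
  then have "\<exists>U. unitary U \<and> lifted U (\<rho> (gmat 1 b)) \<and> U e1 = e1"
  proof cases
    case 2
    have "unitary (\<lambda>x. x)" unfolding unitary_def by (auto simp: bij_id[unfolded id_def] intro: exI[of _ 1])
    then show ?thesis using one by (intro exI[of _ "\<lambda>x. x"]) (auto simp: lifted_def gmat_one 2)
  next
    case 3
    obtain U where U: "unitary U" "lifted U (\<rho> (gmat 1 (- b)))" "U e1 = e1" using pos[of "- b"] 3 by auto
    note I = unitary_inv[OF U(1)]
    have "\<rho> (gmat 1 b) (lin x) = lin (inv U x)" if x: "x \<noteq> 0" for x
    proof -
      have nz: "inv U x \<noteq> 0" using x unitaryD(7)[OF I(1)] by simp
      have "lin x = \<rho> (gmat 1 (- b)) (lin (inv U x))" using liftedD[OF U(2) nz] I(2) by simp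
      then have "\<rho> (gmat 1 b) (lin x) = \<rho> (gmat 1 b ** gmat 1 (- b)) (lin (inv U x))"
        using mult gmat_SU11 nz by simp
      also have "gmat 1 b ** gmat 1 (- b) = mat 1" by (simp add: gmat_mult gmat_one)
      finally show ?thesis using one[OF nz] by simp
    qed
    moreover have "inv U e1 = e1" using U(3) I(3) by metis
    ultimately show ?thesis using I(1) unfolding lifted_def by blast
  qed (use pos in blast)
  then show thesis using that by blast
qed

text \<open>Pairing 1 with \<open>e1\<close> selects one vector of the line without reference to a
  lift; it is the image of \<open>e2\<close> under any lift of g(1,b) that fixes
  \<open>e1\<close>.\<close>

definition y :: "real \<Rightarrow> l2" where
  "y b = (SOME x. lin x = \<rho> (gmat 1 b) (lin e2) \<and> BB x e1 = 1)"

lemma y: "lin (y b) = \<rho> (gmat 1 b) (lin e2)" "BB (y b) e1 = 1" "y b \<noteq> 0"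
  and y_unique: "lin x = \<rho> (gmat 1 b) (lin e2) \<Longrightarrow> BB x e1 = 1 \<Longrightarrow> y b = x"
  and y_iso: "BB (y b) (y b) = 0"
proof -
  obtain U where U: "unitary U" "lifted U (\<rho> (gmat 1 b))" "U e1 = e1" by (rule parabolic_lift)
  have "BB (U e2) e1 = 1" using unitaryD(4)[OF U(1), of e2 e1] U(3) e21 by simp
  moreover have l: "lin (U e2) = \<rho> (gmat 1 b) (lin e2)" using liftedD[OF U(2) e_nz(2)] by simp
  ultimately have ex: "\<exists>x. lin x = \<rho> (gmat 1 b) (lin e2) \<and> BB x e1 = 1" by blast
  have Y: "lin (y b) = \<rho> (gmat 1 b) (lin e2) \<and> BB (y b) e1 = 1"
    unfolding y_def by (rule someI_ex[OF ex])
  then show y12: "lin (y b) = \<rho> (gmat 1 b) (lin e2)" "BB (y b) e1 = 1" by simp_all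
  then show "y b \<noteq> 0" by (auto simp: BB_0)
  show un: "y b = x" if "lin x = \<rho> (gmat 1 b) (lin e2)" "BB x e1 = 1" for x
  proof -
    have "lin (y b) = lin x" using that(1) y12(1) by simp
    then obtain c where c: "y b = c *\<^sub>C x" unfolding lin_eq_iff by blast
    then have "c = 1" using y12(2) that(2) by (simp add: BB_scale)
    then show ?thesis using c by simp
  qed
  have "y b = U e2" using un l \<open>BB (U e2) e1 = 1\<close> by blast
  then show "BB (y b) (y b) = 0" using unitaryD(4)[OF U(1), of e2 e2] e by simp
qed

lemma y0: "y 0 = e2"
  by (rule y_unique) (simp_all add: gmat_one one e_nz e21)

definition K :: "real \<Rightarrow> complex" where "K b = BB (y b) e2"

lemma y_parabolic: "unitary U \<Longrightarrow> lifted U (\<rho> (gmat 1 a)) \<Longrightarrow> U e1 = e1 \<Longrightarrow> U (y b) = y (a + b)"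
proof -
  assume U: "unitary U" "lifted U (\<rho> (gmat 1 a))" "U e1 = e1"
  have "lin (U (y b)) = \<rho> (gmat 1 a) (lin (y b))" using liftedD[OF U(2) y(3)] by simp
  also have "\<dots> = \<rho> (gmat 1 a ** gmat 1 b) (lin e2)" using mult gmat_SU11 e_nz by (simp add: y)
  also have "gmat 1 a ** gmat 1 b = gmat 1 (a + b)" by (simp add: gmat_mult add.commute)
  finally have l: "lin (U (y b)) = \<rho> (gmat 1 (a + b)) (lin e2)" .
  have "BB (U (y b)) e1 = 1" using unitaryD(4)[OF U(1), of "y b" e1] U(3) y(2) by simp
  then show "U (y b) = y (a + b)" using y_unique[OF l] by simp
qed

lemma BB_y: "BB (y a) (y b) = K (a - b)"
proof -
  obtain U where U: "unitary U" "lifted U (\<rho> (gmat 1 (- b)))" "U e1 = e1" by (rule parabolic_lift)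
  have "BB (y a) (y b) = BB (U (y a)) (U (y b))" by (simp add: unitaryD[OF U(1)])
  then show ?thesis by (simp add: y_parabolic[OF U] y0 K_def)
qed

lemma K_minus: "K (- b) = cnj (K b)" and K_zero: "K 0 = 0"
  using BB_y[of 0 b] BB_y[of b 0] BB_cnj[of "y b" "y 0"] BB_y[of 0 0] y_iso[of 0] by simp_all

text \<open>Conjugating by the lift of g(sqrt s, 0) multiplies the kernel by |\<mu>|^2. The
  translation length knows only the absolute value of ln |\<mu>|, so at this stage the exponent is
  determined up to sign.\<close>

lemma K_scale:
  assumes "s > 0"
  obtains r where "r = s powr t \<or> r = s powr (- t)" "\<And>b. K (s * b) = of_real r * K b"
proof -
  define l where "l = sqrt s"
  have l: "l > 0" "l * l = s" using assms by (simp_all add: l_def)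
  obtain M \<mu> \<nu> where M: "unitary M" "lifted M (\<rho> (gmat l 0))" "M e1 = \<mu> *\<^sub>C e1" "M e2 = \<nu> *\<^sub>C e2"
    and mn: "\<mu> * cnj \<nu> = 1" and len: "\<bar>ln (cmod \<mu>)\<bar> = t * \<bar>ln l\<bar>"
    by (rule axis_lift[OF l(1)])
  have nz: "\<mu> \<noteq> 0" "\<nu> \<noteq> 0" using mn by auto
  have My: "M (y b) = \<nu> *\<^sub>C y (s * b)" for b
  proof -
    have "cnj (\<mu> * cnj \<nu>) = 1" unfolding mn by simp
    then have nm: "\<nu> * cnj \<mu> = 1" by (simp add: mult.commute)
    have "BB (M (y b)) (M e1) = 1" by (simp add: unitaryD[OF M(1)] y)
    then have "cnj \<mu> * BB (M (y b)) e1 = 1" by (simp add: M(3) BB_scale)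
    then have b1: "BB ((1 / \<nu>) *\<^sub>C M (y b)) e1 = 1"
      using nm nz by (simp add: BB_scale) (metis mult.commute mult_left_cancel complex_cnj_zero_iff)
    have "lin ((1 / \<nu>) *\<^sub>C M (y b)) = lin (M (y b))" using nz by (simp add: lin_scale)
    also have "\<dots> = \<rho> (gmat l 0) (lin (y b))" using liftedD[OF M(2) y(3)] by simp
    also have "\<dots> = \<rho> (gmat l 0 ** gmat 1 b) (lin e2)" using mult gmat_SU11 e_nz l(1) by (simp add: y)
    also have "gmat l 0 ** gmat 1 b = gmat 1 (s * b) ** gmat l 0"
      using l(1) by (simp add: gmat_mult flip: l(2))
    also have "\<rho> \<dots> (lin e2) = \<rho> (gmat 1 (s * b)) (lin e2)"
      using mult gmat_SU11 e_nz l(1) fix2 by simp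
    finally have "y (s * b) = (1 / \<nu>) *\<^sub>C M (y b)" using y_unique b1 by blast
    then show ?thesis using nz by simp
  qed
  have K: "K (s * b) = of_real ((cmod \<mu>)\<^sup>2) * K b" for b
  proof -
    have "K b = BB (M (y b)) (M e2)" by (simp add: unitaryD[OF M(1)] K_def)
    also have "\<dots> = \<nu> * cnj \<nu> * K (s * b)" by (simp add: My M(4) BB_scale K_def)
    finally have "\<mu> * cnj \<mu> * K b = (\<mu> * cnj \<nu>) * cnj (\<mu> * cnj \<nu>) * K (s * b)" by (simp add: mult_ac)
    then show ?thesis unfolding mn mult_cnj_cmod by simp
  qed
  have ll: "ln l = ln s / 2" using l assms by (simp add: l_def ln_sqrt)
  have "ln (cmod \<mu>) = t * ln l \<or> ln (cmod \<mu>) = - t * ln l" using len t_pos by (auto simp: abs_if split: if_splits)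
  moreover have "(cmod \<mu>)\<^sup>2 = exp (2 * ln (cmod \<mu>))" using nz by (simp add: exp_double power2_eq_square)
  ultimately have "(cmod \<mu>)\<^sup>2 = s powr t \<or> (cmod \<mu>)\<^sup>2 = s powr (- t)"
    using assms unfolding powr_def ll by auto
  then show thesis using that K by blast
qed

definition c :: "real \<Rightarrow> l2" where "c b = y b - K b *\<^sub>C e1 - e2"

lemma c_orth: "BB (c b) e1 = 0" "BB (c b) e2 = 0"
  using hyperbolic_pair_decomp(1,2)[OF e, of "y b"] by (simp_all add: c_def K_def y)

lemma BB_c: "BB (c a) (c b) = - (K a + cnj (K b) - K (a - b))"
  using hyperbolic_pair_decomp(4)[OF e, of "y a" "y b"] by (simp add: c_def K_def y BB_y[unfolded K_def])

lemma Re_K_nonneg: "Re (K b) \<ge> 0" and c_zero: "Re (K b) = 0 \<Longrightarrow> c b = 0"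
  using hyperbolic_pair_neg(1,2)[OF e c_orth[of b]] by (simp_all add: BB_c K_zero)

text \<open>In the negative definite space orthogonal to \<open>e1\<close> and \<open>e2\<close>,
  the vector \<open>c b\<close> has squared length 2 Re K(b) and \<open>c a - c b\<close> has
  squared length 2 Re K(a - b). This is the triangle inequality.\<close>

lemma Re_K_subadditive: "sqrt (Re (K (a - b))) \<le> sqrt (Re (K a)) + sqrt (Re (K b))"
proof -
  have "cmod (BB (c a) (c b)) ^ 2 \<le> Re (BB (c a) (c a)) * Re (BB (c b) (c b))"
    by (rule hyperbolic_pair_neg(3)[OF e c_orth c_orth])
  also have "\<dots> = (2 * (sqrt (Re (K a)) * sqrt (Re (K b))))\<^sup>2"
    using Re_K_nonneg by (simp add: BB_c K_zero power_mult_distrib)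
  finally have "cmod (BB (c a) (c b)) \<le> 2 * (sqrt (Re (K a)) * sqrt (Re (K b)))"
    by (rule power2_le_imp_le) (simp add: Re_K_nonneg)
  then have "Re (BB (c a) (c b)) \<le> 2 * (sqrt (Re (K a)) * sqrt (Re (K b)))"
    using complex_Re_le_cmod order_trans by blast
  then have "Re (K (a - b)) \<le> (sqrt (Re (K a)) + sqrt (Re (K b)))\<^sup>2"
    using Re_K_nonneg by (simp add: BB_c power2_sum)
  then show ?thesis using Re_K_nonneg by (intro real_le_lsqrt) auto
qed

text \<open>The Bruhat decomposition. \<open>su \<i> 0\<close> acts on the circle as z |-> -z; if g
  moves 1, a parabolic takes -1 to its image, and what remains fixes 1 and hence the line of
  \<open>e1\<close>.\<close>

lemma orbit_dichotomy:
  assumes g: "g \<in> SU11"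
  shows "\<rho> g (lin e1) = lin e1 \<or> (\<exists>b. \<rho> g (lin e1) = \<rho> (gmat 1 b) (\<rho> (su \<i> 0) (lin e1)))"
proof -
  let ?w = "su \<i> 0"
  have w: "?w \<in> SU11" by (rule su_in) simp
  have mw: "mob ?w z = - z" for z by (simp add: mob_su)
  have u1: "cmod (mob g 1) = 1" using norm_mob[OF g] by simp
  have P: "\<rho> k (lin e1) = lin e1" if "k \<in> SU11" "mob k 1 = 1" for k
    using stabiliser_one[OF that] fix1 neg gmat_SU11 e_nz by metis
  show ?thesis
  proof (cases "mob g 1 = 1")
    case True
    then show ?thesis using P[OF g] by simp
  next
    case False
    obtain b where b: "mob (gmat 1 b) (- 1) = mob g 1" using parabolic_transitive[OF u1 False] .
    define h where "h = gmat 1 b ** ?w"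
    have h: "h \<in> SU11" unfolding h_def using SU11_mult gmat_SU11 w by simp
    have mh: "mob h 1 = mob g 1" unfolding h_def using mob_mult[OF gmat_SU11 w, of 1 1] mw b by simp
    obtain h' where h': "h' \<in> SU11" "h ** h' = mat 1" "h' ** h = mat 1" using SU11_inverse[OF h] .
    have "mob (h' ** g) 1 = mob h' (mob h 1)" using mob_mult[OF h'(1) g] mh by simp
    also have "\<dots> = mob (h' ** h) 1" using mob_mult[OF h'(1) h] by simp
    finally have "mob (h' ** g) 1 = 1" by (simp add: h' mob_one)
    then have "\<rho> (h' ** g) (lin e1) = lin e1" using P SU11_mult h'(1) g by blast
    then have "\<rho> (h ** (h' ** g)) (lin e1) = \<rho> h (lin e1)"
      using mult[OF h SU11_mult[OF h'(1) g] e_nz(1)] by simp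
    moreover have "h ** (h' ** g) = g" using h'(2) by (simp add: matrix_mul_assoc)
    moreover have "\<rho> h (lin e1) = \<rho> (gmat 1 b) (\<rho> ?w (lin e1))"
      unfolding h_def using mult[OF gmat_SU11 w e_nz(1)] by simp
    ultimately show ?thesis by auto
  qed
qed

text \<open>Conjugation by \<open>su \<i> 0\<close> inverts g(2,0), so the image of
  \<open>e1\<close> is an isotropic line fixed by a hyperbolic isometry, that is an endpoint of the
  axis. If it were \<open>e1\<close> again, \<open>orbit_dichotomy\<close> would make
  \<open>e1\<close> fixed by the whole group.\<close>

lemma Weyl_swap: "\<rho> (su \<i> 0) (lin e1) = lin e2"
proof -
  let ?w = "su \<i> 0"
  have w: "?w \<in> SU11" by (rule su_in) simp
  obtain S where S: "unitary S" "lifted S (\<rho> ?w)" using lift[OF w] .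
  define x where "x = S e1"
  have x: "x \<noteq> 0" "BB x x = 0" "\<rho> ?w (lin e1) = lin x"
    using unitaryD(4,7)[OF S(1)] e_nz e liftedD[OF S(2)] by (auto simp: x_def)
  obtain M \<mu> \<nu> where M: "unitary M" "lifted M (\<rho> (gmat 2 0))" "M e1 = \<mu> *\<^sub>C e1" "M e2 = \<nu> *\<^sub>C e2"
    "\<mu> * cnj \<nu> = 1" and len: "\<bar>ln (cmod \<mu>)\<bar> = t * \<bar>ln 2\<bar>"
    by (rule axis_lift[of 2]) simp
  have "cmod \<mu> \<noteq> 1" using len t_pos by auto
  moreover have "lin (M x) = lin x"
  proof -
    have "lin (M x) = \<rho> (gmat 2 0) (\<rho> ?w (lin e1))" using liftedD[OF M(2) x(1)] x(3) by simp
    also have "\<dots> = \<rho> (gmat 2 0 ** ?w) (lin e1)" using mult[OF gmat_SU11 w] e_nz by simp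
    also have "gmat 2 0 ** ?w = ?w ** gmat (1/2) 0"
      unfolding gmat_su su_mult by (intro arg_cong2[of _ _ _ _ su]) simp_all
    also have "\<rho> \<dots> (lin e1) = \<rho> ?w (lin e1)" using mult[OF w gmat_SU11] e_nz fix1 by simp
    finally show ?thesis using x(3) by simp
  qed
  moreover obtain k where "M x = k *\<^sub>C x" using calculation(2) unfolding lin_eq_iff by blast
  ultimately have "lin x = lin e1 \<or> lin x = lin e2"
    using axis_fixed_lines[OF M(1,3,4) e, of x k] x by simp
  moreover have "lin x \<noteq> lin e1"
  proof
    assume "lin x = lin e1"
    then have "\<rho> g (lin e1) = lin e1" if "g \<in> SU11" for g
      using orbit_dichotomy[OF that] x(3) fix1[of 1] by auto
    moreover have "lin e1 \<in> BdPts" unfolding BdPts_alt using e_nz e by blast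
    moreover have "\<not> (\<exists>x\<in>HPts \<union> BdPts. \<forall>g\<in>SU11. \<rho> g x = x)"
      using irred by (simp only: irreducible_rep_def non_elementary_def) simp
    ultimately show False by blast
  qed
  ultimately show ?thesis using x(3) by simp
qed

lemma orbit_of_e1:
  "g \<in> SU11 \<Longrightarrow> \<rho> g (lin e1) = lin e1 \<or> (\<exists>b. \<rho> g (lin e1) = lin (y b))"
  using orbit_dichotomy[of g] by (simp add: Weyl_swap y(1))

text \<open>The lines \<open>lin e1\<close> and \<open>lin (y b)\<close> form one orbit, so their span is invariant and, by
  irreducibility, cannot be of dimension at most three.\<close>

lemma c_not_proportional: "\<exists>b. \<forall>z. c b \<noteq> z *\<^sub>C c 1"
proof (rule ccontr)
  assume "\<not> ?thesis"
  then have prp: "\<And>b. \<exists>z. c b = z *\<^sub>C c 1" by blast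
  let ?w = "su \<i> 0"
  have w: "?w \<in> SU11" by (rule su_in) simp
  define W where "W = {a *\<^sub>C e1 + b *\<^sub>C e2 + z *\<^sub>C c 1 | a b z. True}"
  have WI: "a *\<^sub>C e1 + b *\<^sub>C e2 + z *\<^sub>C c 1 \<in> W" for a b z unfolding W_def by blast
  have WE: "\<exists>a b z. x = a *\<^sub>C e1 + b *\<^sub>C e2 + z *\<^sub>C c 1" if "x \<in> W" for x using that unfolding W_def by blast
  have sub: "csubspace W" unfolding csubspace_def
  proof (intro conjI ballI allI)
    show "0 \<in> W" using WI[of 0 0 0] by simp
    fix x assume "x \<in> W"
    then obtain a b z where x: "x = a *\<^sub>C e1 + b *\<^sub>C e2 + z *\<^sub>C c 1" using WE by blast
    show "d *\<^sub>C x \<in> W" for d using WI[of "d * a" "d * b" "d * z"] by (simp add: x scaleC_add)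
    fix x' assume "x' \<in> W"
    then obtain a' b' z' where x': "x' = a' *\<^sub>C e1 + b' *\<^sub>C e2 + z' *\<^sub>C c 1" using WE by blast
    show "x + x' \<in> W" using WI[of "a + a'" "b + b'" "z + z'"] by (simp add: x x' scaleC_add algebra_simps)
  qed
  note sD = csubspaceD[OF sub]
  have e1W: "e1 \<in> W" and e2W: "e2 \<in> W" and cW: "c 1 \<in> W" using WI[of 1 0 0] WI[of 0 1 0] WI[of 0 0 1] by simp_all
  have yW: "y b \<in> W" for b
  proof -
    obtain z where "c b = z *\<^sub>C c 1" using prp by blast
    moreover have "y b = K b *\<^sub>C e1 + 1 *\<^sub>C e2 + c b" by (simp add: c_def)
    ultimately have "y b = K b *\<^sub>C e1 + 1 *\<^sub>C e2 + z *\<^sub>C c 1" by metis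
    then show ?thesis using WI by metis
  qed
  have yorb: "\<exists>h\<in>SU11. lin (y b) = \<rho> h (lin e1)" for b
  proof -
    have "lin (y b) = \<rho> (gmat 1 b ** ?w) (lin e1)"
      using mult[OF gmat_SU11 w e_nz(1)] Weyl_swap y(1) by simp
    then show ?thesis using SU11_mult[OF gmat_SU11 w, of 1 b] by auto
  qed
  have TW: "T x \<in> W" if g: "g \<in> SU11" and T: "unitary T" "lifted T (\<rho> g)" and x: "x \<in> W" for g T x
  proof -
    have orb: "T v \<in> W" if v: "v \<noteq> 0" "lin v = \<rho> h (lin e1)" "h \<in> SU11" for v h
    proof -
      have "lin (T v) = \<rho> (g ** h) (lin e1)" using liftedD[OF T(2) v(1)] v mult[OF g v(3) e_nz(1)] by simp
      then have "lin (T v) = lin e1 \<or> (\<exists>b. lin (T v) = lin (y b))" using orbit_of_e1[OF SU11_mult[OF g v(3)]] by auto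
      then show ?thesis unfolding lin_eq_iff using sD(3) e1W yW by metis
    qed
    have "T e1 \<in> W" using orb[OF e_nz(1) _ SU11_one(1)] one[OF e_nz(1)] by simp
    moreover have Ty: "T (y b) \<in> W" for b using orb[OF y(3)] yorb by blast
    moreover have "T e2 \<in> W" using Ty[of 0] by (simp add: y0)
    moreover have "T (c 1) \<in> W" unfolding c_def unitaryD[OF T(1)] using calculation by (intro sD)
    moreover obtain a b z where "x = a *\<^sub>C e1 + b *\<^sub>C e2 + z *\<^sub>C c 1" using WE[OF x] by blast
    ultimately show ?thesis by (auto simp: unitaryD[OF T(1)] intro!: sD)
  qed
  \<comment> \<open>Membership as a continuous equation, from which closedness follows by taking
    limits. If \<open>c 1 = 0\<close> the quotient is 0 by convention and the formula still
    describes the span of \<open>e1\<close> and \<open>e2\<close>.\<close>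
  have mem: "x \<in> W \<longleftrightarrow> x = BB x e2 *\<^sub>C e1 + BB x e1 *\<^sub>C e2 + (BB x (c 1) / BB (c 1) (c 1)) *\<^sub>C c 1" for x
  proof
    assume "x \<in> W"
    then obtain a b z where x: "x = a *\<^sub>C e1 + b *\<^sub>C e2 + z *\<^sub>C c 1" using WE by blast
    have oc: "BB e1 (c 1) = 0" "BB e2 (c 1) = 0"
      using BB_cnj[of "c 1"] c_orth by (metis complex_cnj_zero)+
    have "BB x e2 = a" "BB x e1 = b" "BB x (c 1) = z * BB (c 1) (c 1)"
      by (simp_all add: x BB_lin e e21 c_orth oc)
    moreover have "BB (c 1) (c 1) = 0 \<Longrightarrow> c 1 = 0" using hyperbolic_pair_neg(2)[OF e c_orth] by simp
    ultimately show "x = BB x e2 *\<^sub>C e1 + BB x e1 *\<^sub>C e2 + (BB x (c 1) / BB (c 1) (c 1)) *\<^sub>C c 1"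
      using x by (cases "BB (c 1) (c 1) = 0") auto
  qed (metis WI)
  have closed: "z \<in> W" if f: "\<And>n. f n \<in> W" "f \<longlonglongrightarrow> z" for f z
  proof -
    have "(\<lambda>n. BB (f n) e2 *\<^sub>C e1 + BB (f n) e1 *\<^sub>C e2 + (BB (f n) (c 1) * inverse (BB (c 1) (c 1))) *\<^sub>C c 1)
      \<longlonglongrightarrow> BB z e2 *\<^sub>C e1 + BB z e1 *\<^sub>C e2 + (BB z (c 1) * inverse (BB (c 1) (c 1))) *\<^sub>C c 1"
      by (intro tendsto_intros f)
    then have "f \<longlonglongrightarrow> BB z e2 *\<^sub>C e1 + BB z e1 *\<^sub>C e2 + (BB z (c 1) / BB (c 1) (c 1)) *\<^sub>C c 1"
      using f(1) mem by (simp add: divide_inverse[symmetric])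
    then show ?thesis using f(2) LIMSEQ_unique mem by blast
  qed
  let ?H = "coord ` W"
  have pos: "BB (e1 + e2) (e1 + e2) = 2" by (simp add: BB_lin e e21)
  have hyp: "hyp_subspace ?H"
    unfolding hyp_subspace_def
  proof (intro conjI ballI allI impI)
    show "?H \<subseteq> L2" by auto
    show "(\<lambda>k. 0) \<in> ?H" using sD(1) coord_eq_0_iff by (metis image_eqI)
    show "vadd x y \<in> ?H" if "x \<in> ?H" "y \<in> ?H" for x y using that sD(2) by (auto simp: vadd_coord)
    show "sc d x \<in> ?H" if "x \<in> ?H" for d x using that sD(3) by (auto simp: sc_coord)
    show "z \<in> ?H" if f: "\<forall>n. f n \<in> ?H" "z \<in> L2" "(\<lambda>n. l2norm (\<lambda>k. f n k - z k)) \<longlonglongrightarrow> 0" for f z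
    proof -
      have "\<forall>n. \<exists>x. x \<in> W \<and> f n = coord x" using f(1) by blast
      from choice[OF this] obtain f' where f': "\<And>n. f' n \<in> W" "\<And>n. f n = coord (f' n)" by blast
      obtain z' where z': "z = coord z'" using L2_coord f(2) by blast
      have "(\<lambda>k. f n k - z k) = coord (f' n - z')" for n by (auto simp: f' z')
      then have "(\<lambda>n. norm (f' n - z')) \<longlonglongrightarrow> 0" using f(3) by (simp add: norm_l2norm)
      then have "f' \<longlonglongrightarrow> z'" using LIM_zero_cancel tendsto_norm_zero_iff by blast
      then show ?thesis using closed f'(1) z' by blast
    qed
    \<comment> \<open>\<open>e1 + e2\<close> has form value 2, hence the normalisation by sqrt
      2.\<close>
    define v where "v = complex_of_real (1 / sqrt 2) *\<^sub>C (e1 + e2)"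
    have vv: "BB v v = 1"
      unfolding v_def BB_scale pos by (simp flip: of_real_mult)
    have "v \<in> W" unfolding v_def using e1W e2W by (intro sD)
    moreover have "Re (BB x x) < 0" if "BB x v = 0" "x \<noteq> 0" for x
      using BB_neg[of v x] vv that by force
    ultimately show "\<exists>v\<in>?H. Bf v v = 1 \<and> (\<forall>w\<in>?H. Bf w v = 0 \<and> w \<noteq> (\<lambda>k. 0) \<longrightarrow> Re (Bf w w) < 0)"
      by (intro bexI[of _ "coord v"]) (auto simp: BB_Bf[symmetric] vv coord_eq_0_iff)
  qed
  have proj: "projW ?H = {lin x | x. x \<in> W \<and> Re (BB x x) > 0}"
    unfolding projW_def lin_def BB_Bf by auto
  have ne: "projW ?H \<noteq> HPts"
  proof
    assume eq: "projW ?H = HPts"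
    have posW: "x \<in> W" if "Re (BB x x) > 0" for x
    proof -
      have "lin x \<in> projW ?H" unfolding eq HPts_alt using that by blast
      then obtain x' where "lin x = lin x'" "x' \<in> W" unfolding proj by blast
      then show ?thesis unfolding lin_eq_iff using sD(3) by auto
    qed
    \<comment> \<open>Positive vectors form an open set, so \<open>e1 + e2 + s x\<close> is positive
      for some s > 0; subtracting \<open>e1 + e2\<close> and dividing by s recovers
      \<open>x\<close>.\<close>
    have all: "x \<in> W" for x
    proof -
      have "((\<lambda>s. Re (BB (e1 + e2 + complex_of_real s *\<^sub>C x) (e1 + e2 + complex_of_real s *\<^sub>C x))) \<longlongrightarrow>
          Re (BB (e1 + e2 + complex_of_real 0 *\<^sub>C x) (e1 + e2 + complex_of_real 0 *\<^sub>C x))) (at_right 0)"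
        by (intro tendsto_intros)
      then have "\<forall>\<^sub>F s in at_right 0. Re (BB (e1 + e2 + complex_of_real s *\<^sub>C x) (e1 + e2 + complex_of_real s *\<^sub>C x)) > 0"
        by (rule order_tendstoD) (simp add: pos)
      moreover have "\<forall>\<^sub>F s :: real in at_right 0. s > 0" by (simp add: eventually_at_right_less)
      ultimately have "\<forall>\<^sub>F s in at_right 0. Re (BB (e1 + e2 + complex_of_real s *\<^sub>C x) (e1 + e2 + complex_of_real s *\<^sub>C x)) > 0 \<and> s > 0"
        by (rule eventually_conj)
      then obtain s where s: "Re (BB (e1 + e2 + complex_of_real s *\<^sub>C x) (e1 + e2 + complex_of_real s *\<^sub>C x)) > 0" "s > 0"
        using eventually_happens'[OF trivial_limit_at_right_real] by blast
      have "e1 + e2 + complex_of_real s *\<^sub>C x - (e1 + e2) \<in> W"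
        by (rule sD(4)[OF posW[OF s(1)] sD(2)[OF e1W e2W]])
      then have "(1 / complex_of_real s) *\<^sub>C (complex_of_real s *\<^sub>C x) \<in> W" unfolding add_diff_cancel_left' by (rule sD(3))
      then show ?thesis using s(2) by simp
    qed
    \<comment> \<open>All three coefficients in \<open>mem\<close> vanish at such a
      \<open>u\<close>, which would make \<open>u\<close> zero.\<close>
    obtain u where u: "u \<noteq> 0" "\<And>a. a \<in> {e1, e2, c 1} \<Longrightarrow> BB u a = 0"
      using orthogonal_vector_exists[of "{e1, e2, c 1}" 0] by auto
    then show False using mem[of u] all by simp
  qed
  have "\<rho> g x \<in> projW ?H" if g: "g \<in> SU11" and x: "x \<in> projW ?H" for g x
  proof -
    obtain v where v: "x = lin v" "v \<in> W" "Re (BB v v) > 0" using x unfolding proj by blast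
    have "v \<noteq> 0" using v(3) by (auto simp: BB_0)
    obtain T where T: "unitary T" "lifted T (\<rho> g)" using lift[OF g] .
    have "\<rho> g x = lin (T v)" using liftedD[OF T(2) \<open>v \<noteq> 0\<close>] v(1) by simp
    moreover have "Re (BB (T v) (T v)) > 0" using v(3) by (simp add: unitaryD[OF T(1)])
    ultimately show ?thesis unfolding proj using TW[OF g T v(2)] by blast
  qed
  moreover have "\<not> (\<exists>W. hyp_subspace W \<and> projW W \<noteq> HPts \<and> (\<forall>g\<in>SU11. \<forall>x\<in>projW W. \<rho> g x \<in> projW W))"
    using irred by (simp only: irreducible_rep_def) simp
  ultimately show False using hyp ne by blast
qed

text \<open>For b > 0, K(b) is a real multiple of K(1). If Re K(1) = 0, then all Re K(b) and hence
  all vectors \<open>c b\<close> vanish, and they are trivially proportional.\<close>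

lemma Re_K1_pos: "Re (K 1) > 0"
proof (rule ccontr)
  assume "\<not> ?thesis"
  then have k: "Re (K 1) = 0" using Re_K_nonneg[of 1] by simp
  have "c b = 0" for b
  proof -
    have p: "Re (K b) = 0" if b: "b > 0" for b
    proof -
      obtain r :: real where "K (b * 1) = of_real r * K 1" using K_scale[OF b] by metis
      then show ?thesis using k by simp
    qed
    consider "b > 0" | "b = 0" | "b < 0" by linarith
    then have "Re (K b) = 0"
    proof cases
      case 3
      then show ?thesis using p[of "- b"] by (simp add: K_minus)
    qed (use p K_zero in auto)
    then show ?thesis by (rule c_zero)
  qed
  then have "c b = 1 *\<^sub>C c 1" for b by simp
  then show False using c_not_proportional by blast
qed

text \<open>The scaling factor is multiplicative in s, so one occurrence of the exponent -t forces
  it everywhere. Then K(n) tends to 0, which contradicts subadditivity for 1 = (n + 2) - (n + 1) and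
  Re K(1) > 0.\<close>

lemma K_homogeneous: assumes "s > 0" shows "K s = of_real (s powr t) * K 1"
proof (rule ccontr)
  assume bad: "\<not> ?thesis"
  have ex: "\<exists>r. (r = s powr t \<or> r = s powr (- t)) \<and> (\<forall>b. K (s * b) = of_real r * K b)" if "s > 0" for s
    using K_scale[OF that] by metis
  obtain r where r: "\<And>s. s > 0 \<Longrightarrow> r s = s powr t \<or> r s = s powr (- t)"
    "\<And>s b. s > 0 \<Longrightarrow> K (s * b) = of_real (r s) * K b"
    using ex by metis
  have K1: "K 1 \<noteq> 0" using Re_K1_pos by auto
  have rK: "K x = of_real (r x) * K 1" if "x > 0" for x using r(2)[OF that, of 1] by simp
  have rm: "r (x * x') = r x * r x'" if "x > 0" "x' > 0" for x x'
  proof -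
    have "of_real (r (x * x')) * K 1 = of_real (r x * r x') * K 1"
      using r(2)[OF that(1), of x'] rK[of "x * x'"] rK[OF that(2)] that by simp
    then show ?thesis using K1 by (metis mult_right_cancel of_real_eq_iff)
  qed
  have rs: "r s \<noteq> s powr t" using bad rK[OF assms] by auto
  have s1: "s \<noteq> 1" using rs r(1)[OF assms] by auto
  have inj: "x = 1" if "x powr (2 * t) = 1" "x > 0" for x
    using that t_pos by (simp add: powr_def)
  have rx: "r x = x powr (- t)" if x: "x > 0" for x
  proof (rule ccontr)
    assume n: "r x \<noteq> x powr (- t)"
    then have rx: "r x = x powr t" using r(1)[OF x] by simp
    have x1: "x \<noteq> 1" using n rx by auto
    have prod: "r (s * x) = s powr (- t) * x powr t" using rm[OF assms x] rx rs r(1)[OF assms] by simp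
    \<comment> \<open>A product of one value of each type must again be of one of the types, which
      forces s = 1 or x = 1.\<close>
    consider "s powr (- t) * x powr t = s powr t * x powr t" | "s powr (- t) * x powr t = s powr (- t) * x powr (- t)"
      using r(1)[of "s * x"] prod assms x by (auto simp: powr_mult)
    then show False
    proof cases
      case 1
      then have "s powr (- t) = s powr t" using x by simp
      then have "s powr t * s powr t = s powr t * s powr (- t)" by simp
      then have "s powr (2 * t) = 1" using assms by (simp flip: powr_add)
      then show False using inj assms s1 by blast
    next
      case 2
      then have "x powr t = x powr (- t)" using assms by simp
      then have "x powr t * x powr t = x powr t * x powr (- t)" by simp
      then have "x powr (2 * t) = 1" using x by (simp flip: powr_add)
      then show False using inj x x1 by blast
    qed
  qed
  define k where "k = Re (K 1)"
  have ReK: "Re (K x) = x powr (- t) * k" if "x > 0" for x using rK[OF that] rx[OF that] by (simp add: k_def)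
  have "sqrt k \<le> sqrt (real (Suc (Suc n)) powr (- t) * k) + sqrt (real (Suc n) powr (- t) * k)" for n
    using Re_K_subadditive[of "real (Suc (Suc n))" "real (Suc n)"] ReK[of "real (Suc (Suc n))"] ReK[of "real (Suc n)"]
    by (simp add: k_def)
  moreover have "(\<lambda>n. sqrt (real (Suc (Suc n)) powr (- t) * k) + sqrt (real (Suc n) powr (- t) * k)) \<longlonglongrightarrow> sqrt (0 * k) + sqrt (0 * k)"
  proof -
    have l: "(\<lambda>n. real n powr (- t)) \<longlonglongrightarrow> 0"
      using t_pos by (intro tendsto_neg_powr filterlim_real_sequentially) auto
    have l1: "(\<lambda>n. real (Suc n) powr (- t)) \<longlonglongrightarrow> 0" using LIMSEQ_Suc[OF l] .
    have l2: "(\<lambda>n. real (Suc (Suc n)) powr (- t)) \<longlonglongrightarrow> 0" using LIMSEQ_Suc[OF l1] .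
    show ?thesis by (intro tendsto_add tendsto_real_sqrt tendsto_mult l1 l2 tendsto_const)
  qed
  ultimately have "sqrt k \<le> sqrt (0 * k) + sqrt (0 * k)"
    by (intro tendsto_lowerbound[of _ _ sequentially]) (auto intro: always_eventually)
  then show False using Re_K1_pos by (simp add: k_def)
qed

text \<open>Subadditivity for 2 = 1 - (-1) gives 2^t <= 4. In the boundary case t = 2 the vector
  \<open>c b - b c 1\<close> has form value 0, so all \<open>c b\<close> are multiples of
  \<open>c 1\<close>, which irreducibility excludes.\<close>

lemma t_less_2: "t < 2"
proof -
  define k where "k = Re (K 1)"
  have k: "k > 0" unfolding k_def by (rule Re_K1_pos)
  have ReK: "Re (K x) = \<bar>x\<bar> powr t * k" for x
  proof (cases "x = 0")
    case False
    then consider "x > 0" | "x < 0" by linarith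
    then show ?thesis
    proof cases
      case 1
      then have "K x = of_real (x powr t) * K 1" by (rule K_homogeneous)
      then have "Re (K x) = x powr t * Re (K 1)" by (metis scaleR_complex.simps(1) scaleR_conv_of_real)
      then show ?thesis using 1 by (simp add: k_def)
    next
      case 2
      then have "K (- x) = of_real ((- x) powr t) * K 1" by (intro K_homogeneous) simp
      then have "Re (K (- x)) = (- x) powr t * Re (K 1)" by (metis scaleR_complex.simps(1) scaleR_conv_of_real)
      then show ?thesis using 2 by (simp add: k_def K_minus)
    qed
  qed (simp add: K_zero)
  have "sqrt (2 powr t * k) \<le> 2 * sqrt k" using Re_K_subadditive[of 1 "- 1"] by (simp add: ReK)
  then have "2 powr t * k \<le> 4 * k" using k by (metis mult.commute real_sqrt_four real_sqrt_le_iff real_sqrt_mult)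
  then have "2 powr t \<le> 2 powr 2" using k by simp
  then have "t \<le> 2" by (simp only: powr_le_cancel_iff)
  moreover have "t \<noteq> 2"
  proof
    assume t2: "t = 2"
    have R: "Re (K x) = x\<^sup>2 * k" for x by (simp add: ReK t2 powr_numeral)
    have "c b = of_real b *\<^sub>C c 1" for b
    proof -
      let ?d = "c b - of_real b *\<^sub>C c 1"
      have "Re (BB ?d ?d) = Re (BB (c b) (c b)) - b * Re (BB (c b) (c 1)) - b * Re (BB (c 1) (c b)) + b * b * Re (BB (c 1) (c 1))"
        by (simp add: BB_lin algebra_simps)
      also have "\<dots> = 0" unfolding BB_c by (simp add: R K_zero power2_eq_square algebra_simps)
      finally have "?d = 0" using hyperbolic_pair_neg(2)[OF e, of ?d] by (simp add: BB_lin c_orth)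
      then show ?thesis by simp
    qed
    then show False using c_not_proportional by blast
  qed
  ultimately show ?thesis by simp
qed

text \<open>The tested double sum is \<open>- BB S S\<close> for S the sum of \<zeta>^n c(n), and
  \<open>S\<close> is orthogonal to \<open>e1\<close> and \<open>e2\<close>; this is the positive
  definiteness required by \<open>positive_definite_imp_sector\<close>.\<close>

lemma K1_admissible_axis: "admissible t (K 1)"
proof -
  have "0 \<le> Re (K 1 * cis (- ((t - 1) * \<psi>)))" if "\<bar>\<psi>\<bar> < pi / 2" for \<psi>
  proof (rule positive_definite_imp_sector[where K = "\<lambda>n. K (of_int n)", OF t_pos _ _ _ that])
    show "K (of_int (int n)) = of_real (real n powr t) * K 1" for n
      using K_homogeneous[of "real n"] K_zero by (cases "n = 0") auto
    show "K (of_int (- n)) = cnj (K (of_int n))" for n by (simp add: K_minus)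
    fix N :: nat and \<zeta> :: complex
    define S where "S = (\<Sum>n<N. \<zeta> ^ n *\<^sub>C c (real n))"
    have sumL: "BB (sum f A) x = (\<Sum>i\<in>A. BB (f i) x)" for f :: "nat \<Rightarrow> l2" and A x
      by (induction A rule: infinite_finite_induct) (auto simp: BB_lin)
    have sumR: "BB x (sum f A) = (\<Sum>i\<in>A. BB x (f i))" for f :: "nat \<Rightarrow> l2" and A x
      by (induction A rule: infinite_finite_induct) (auto simp: BB_lin)
    have "BB S e1 = 0" "BB S e2 = 0" unfolding S_def sumL by (simp_all add: BB_scale c_orth)
    then have "Re (BB S S) \<le> 0" by (rule hyperbolic_pair_neg(1)[OF e])
    moreover have "BB S S = (\<Sum>n<N. \<Sum>m<N. \<zeta> ^ n * cnj \<zeta> ^ m * - (K (real n) + cnj (K (real m)) - K (real n - real m)))"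
    proof -
      have "BB S S = (\<Sum>n<N. BB (\<zeta> ^ n *\<^sub>C c (real n)) S)" by (subst (1) S_def) (rule sumL)
      also have "\<dots> = (\<Sum>n<N. \<Sum>m<N. BB (\<zeta> ^ n *\<^sub>C c (real n)) (\<zeta> ^ m *\<^sub>C c (real m)))"
        by (subst S_def) (simp only: sumR)
      finally show ?thesis by (simp only: BB_scale BB_c complex_cnj_power mult.assoc mult.left_commute)
    qed
    then have "BB S S = - (\<Sum>n<N. \<Sum>m<N. \<zeta> ^ n * cnj \<zeta> ^ m * (K (of_int (int n)) + cnj (K (of_int (int m))) - K (of_int (int n - int m))))"
      by (simp only: mult_minus_right sum_negf of_int_of_nat_eq of_int_diff)
    ultimately show "0 \<le> Re (\<Sum>n<N. \<Sum>m<N. \<zeta> ^ n * cnj \<zeta> ^ m * (K (of_int (int n)) + cnj (K (of_int (int m))) - K (of_int (int n - int m))))"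
      by simp
  qed
  from sector_closure[OF this] show ?thesis
    unfolding admissible_def using t_pos t_less_2 Re_K1_pos by simp
qed

end

theorem K1_admissible:
  assumes irr: "irreducible_rep \<rho>" and ell: "has_ell \<rho> t" and d: "dist_reps \<rho> e1 e2" and K: "K1_of \<rho> e1 e2 k"
  shows "admissible t k"
proof -
  have "e1 \<in> L2" "e2 \<in> L2" using d by (auto simp: dist_reps_def)
  then obtain x1 x2 where x: "e1 = coord x1" "e2 = coord x2" using L2_coord by metis
  obtain T c where T: "unitaryB T" "lifts T (\<rho> (gmat 1 1))" "T e1 = e1" and c: "c \<in> Espace e1 e2"
    "T e2 = vadd (vadd (sc k e1) e2) c"
    using K unfolding K1_of_def by blast
  obtain c' where c': "c = coord c'" using c(1) L2_coord unfolding Espace_def by blast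
  define U where "U = (\<lambda>x. l2_of (T (coord x)))"
  note TU = unitaryB_imp_unitary[OF T(1), folded U_def]
  have bb: "BB x1 x1 = 0" "BB x2 x2 = 0" "BB x1 x2 = 1" using d unfolding dist_reps_def x BB_Bf[symmetric] by auto
  interpret axis_rep \<rho> t x1 x2 U
  proof
    show "is_rep \<rho>" "irreducible_rep \<rho>" using irr by (auto simp: irreducible_rep_def)
    show "has_ell \<rho> t" by fact
    show "BB x1 x1 = 0" "BB x2 x2 = 0" "BB x1 x2 = 1" by (fact bb)+
    show "\<rho> (gmat l b) (lin x1) = lin x1" if "l > 0" for l b using d that unfolding dist_reps_def x lin_def by blast
    show "\<rho> (gmat l 0) (lin x2) = lin x2" if "l > 0" for l using d that unfolding dist_reps_def x lin_def by blast
    show "unitary U" "lifted U (\<rho> (gmat 1 1))" using TU T by blast+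
    have "coord (U x1) = T (coord x1)" unfolding U_def by (rule unitaryB_imp_unitary(2)[OF T(1)])
    then have "coord (U x1) = coord x1" using T(3) x by simp
    then show "U x1 = x1" using coord_inject by blast
  qed
  have "coord (U x2) = T (coord x2)" unfolding U_def by (rule unitaryB_imp_unitary(2)[OF T(1)])
  then have "coord (U x2) = coord (k *\<^sub>C x1 + x2 + c')"
    using c(2) unfolding x c' sc_coord vadd_coord by (simp only:)
  then have "U x2 = k *\<^sub>C x1 + x2 + c'" using coord_inject by blast
  moreover have "U (y 0) = y 1" using y_parabolic[OF U1, of 0] by simp
  ultimately have y1: "y 1 = k *\<^sub>C x1 + x2 + c'" by (simp add: y0)
  have "BB c' x2 = 0" using c(1) by (simp add: Espace_def x c' BB_Bf)
  then have "K 1 = k" unfolding K_def y1 by (simp add: BB_lin bb)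
  then show ?thesis using K1_admissible_axis by simp
qed

section \<open>Isometries from equal Gram matrices\<close>

definition total_family :: "'i set \<Rightarrow> ('i \<Rightarrow> l2) \<Rightarrow> bool" where
  "total_family I \<phi> \<longleftrightarrow> (\<forall>S. csubspace S \<and> closed S \<and> (\<forall>i\<in>I. \<phi> i \<in> S) \<longrightarrow> S = UNIV)"

text \<open>The correspondence sending each combination of the \<phi> to the same combination of the
  \<psi>. It is kept as a relation because its single-valuedness appears only after the norm
  bounds.\<close>

inductive span_graph :: "'i set \<Rightarrow> ('i \<Rightarrow> l2) \<Rightarrow> ('i \<Rightarrow> l2) \<Rightarrow> l2 \<Rightarrow> l2 \<Rightarrow> bool" for I \<phi> \<psi> where
  zero: "span_graph I \<phi> \<psi> 0 0"
| step: "span_graph I \<phi> \<psi> x y \<Longrightarrow> i \<in> I \<Longrightarrow> span_graph I \<phi> \<psi> (x + c *\<^sub>C \<phi> i) (y + c *\<^sub>C \<psi> i)"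

lemma span_graph_add:
  assumes "span_graph I \<phi> \<psi> x' y'" "span_graph I \<phi> \<psi> x y"
  shows "span_graph I \<phi> \<psi> (x + x') (y + y')"
  using assms
proof (induction rule: span_graph.induct)
  case (step x' y' i c)
  then have "span_graph I \<phi> \<psi> (x + x' + c *\<^sub>C \<phi> i) (y + y' + c *\<^sub>C \<psi> i)" by (intro span_graph.step)
  then show ?case by (simp add: add.assoc)
qed simp

lemma span_graph_scale: "span_graph I \<phi> \<psi> x y \<Longrightarrow> span_graph I \<phi> \<psi> (d *\<^sub>C x) (d *\<^sub>C y)"
proof (induction rule: span_graph.induct)
  case (step x y i c)
  then have "span_graph I \<phi> \<psi> (d *\<^sub>C x + (d * c) *\<^sub>C \<phi> i) (d *\<^sub>C y + (d * c) *\<^sub>C \<psi> i)" by (intro span_graph.step)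
  then show ?case by (simp add: scaleC_add)
qed (simp add: span_graph.zero)

lemma span_graph_diff:
  assumes "span_graph I \<phi> \<psi> x y" "span_graph I \<phi> \<psi> x' y'"
  shows "span_graph I \<phi> \<psi> (x - x') (y - y')"
  using span_graph_add[OF span_graph_scale[OF assms(2), of "-1"] assms(1)] by (simp add: scaleC_add)

lemma span_graph_sym: "span_graph I \<phi> \<psi> x y \<Longrightarrow> span_graph I \<psi> \<phi> y x"
  by (induction rule: span_graph.induct) (auto intro: span_graph.intros)

lemma span_graph_base: "i \<in> I \<Longrightarrow> span_graph I \<phi> \<psi> (\<phi> i) (\<psi> i)"
  using span_graph.step[OF span_graph.zero, of i I \<phi> \<psi> 1] by simp

lemma span_graph_BB:
  assumes gram: "\<And>i j. i \<in> I \<Longrightarrow> j \<in> I \<Longrightarrow> BB (\<phi> i) (\<phi> j) = BB (\<psi> i) (\<psi> j)"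
    and "span_graph I \<phi> \<psi> x y" "span_graph I \<phi> \<psi> x' y'"
  shows "BB x x' = BB y y'"
  using assms(2)
proof (induction rule: span_graph.induct)
  case (step x y i c)
  have "BB (\<phi> i) x' = BB (\<psi> i) y'"
    using assms(3) by (induction rule: span_graph.induct) (use gram step.hyps in \<open>auto simp: BB_lin\<close>)
  then show ?case using step.IH by (simp add: BB_lin)
qed (simp add: BB_0)

lemma csubspace_closure:
  assumes "csubspace S" shows "csubspace (closure S)"
  unfolding csubspace_def
proof (intro conjI ballI allI)
  show "0 \<in> closure S" using csubspaceD(1)[OF assms] closure_subset by blast
  fix x assume "x \<in> closure S"
  then obtain f where f: "\<And>n. f n \<in> S" "f \<longlonglongrightarrow> x" unfolding closure_sequential by blast
  show "c *\<^sub>C x \<in> closure S" for c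
    unfolding closure_sequential using f csubspaceD(3)[OF assms]
    by (intro exI[of _ "\<lambda>n. c *\<^sub>C f n"]) (auto intro!: tendsto_intros)
  fix y assume "y \<in> closure S"
  then obtain g where g: "\<And>n. g n \<in> S" "g \<longlonglongrightarrow> y" unfolding closure_sequential by blast
  show "x + y \<in> closure S"
    unfolding closure_sequential using f g csubspaceD(2)[OF assms]
    by (intro exI[of _ "\<lambda>n. f n + g n"]) (auto intro!: tendsto_intros)
qed

lemma span_graph_dense:
  assumes "total_family I \<phi>" obtains f g where "\<And>n::nat. span_graph I \<phi> \<psi> (f n) (g n)" "f \<longlonglongrightarrow> x"
proof -
  let ?S = "{x. \<exists>y. span_graph I \<phi> \<psi> x y}"
  have "csubspace ?S" unfolding csubspace_def
    using span_graph.zero span_graph_add span_graph_scale by blast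
  moreover have "\<phi> i \<in> closure ?S" if "i \<in> I" for i
    by (rule subsetD[OF closure_subset]) (use span_graph_base[OF that, of \<phi> \<psi>] in blast)
  ultimately have "closure ?S = UNIV"
    using assms csubspace_closure closed_closure unfolding total_family_def by blast
  then have "x \<in> closure ?S" by simp
  then obtain f where f: "\<And>n. f n \<in> ?S" "f \<longlonglongrightarrow> x" unfolding closure_sequential by blast
  then have "\<forall>n. \<exists>y. span_graph I \<phi> \<psi> (f n) y" by blast
  from choice[OF this] show thesis using that f(2) by blast
qed

text \<open>The constant depends on the correspondence only through \<open>b\<close>; this is what makes the bounds below
  locally uniform in the group element.\<close>

lemma form_bound:
  assumes v: "Re (BB v v) > 0" and v': "BB v' v' = BB v v" and xv: "BB x' v' = BB x v" and xx: "BB x' x' = BB x x"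
    and b: "norm v' \<le> b"
  shows "norm x' \<le> sqrt (36 * (norm v / Re (BB v v))\<^sup>2 * b\<^sup>2 + 6 * (b\<^sup>2 / Re (BB v v))) * norm x"
proof -
  define \<beta> where "\<beta> = Re (BB v v)"
  have beta: "\<beta> > 0" using v by (simp add: \<beta>_def)
  have b2: "(norm v')\<^sup>2 \<le> b\<^sup>2" using b by (intro power_mono) auto
  define s where "s = cmod (BB x v)"
  have "s \<le> 3 * norm v * norm x" unfolding s_def using norm_BB_le[of x v] by (simp add: mult_ac)
  then have "s\<^sup>2 \<le> (3 * norm v * norm x)\<^sup>2" unfolding s_def by (intro power_mono) auto
  then have s2: "s\<^sup>2 \<le> 9 * (norm v)\<^sup>2 * (norm x)\<^sup>2" by (simp add: power_mult_distrib)
  have rx: "- Re (BB x x) \<le> 3 * (norm x)\<^sup>2"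
    using norm_BB_le[of x x] complex_Re_le_cmod[of "- BB x x"] by (simp add: power2_eq_square mult.assoc)
  have r0: "0 \<le> s\<^sup>2 / \<beta> - Re (BB x x)"
    using reverse_CS[OF v, of x] beta unfolding \<beta>_def[symmetric] s_def[symmetric]
    by (simp add: pos_le_divide_eq mult.commute)
  have "(norm x')\<^sup>2 \<le> 2 * (s / \<beta>)\<^sup>2 * (norm v')\<^sup>2 + 2 * ((norm v')\<^sup>2 / \<beta>) * (s\<^sup>2 / \<beta> - Re (BB x x))"
    using norm_le_form[of v' x'] v by (simp add: v' xv xx s_def \<beta>_def)
  also have "\<dots> \<le> 2 * (s / \<beta>)\<^sup>2 * b\<^sup>2 + 2 * (b\<^sup>2 / \<beta>) * (s\<^sup>2 / \<beta> - Re (BB x x))"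
    using b2 beta r0 by (intro add_mono mult_left_mono mult_right_mono divide_right_mono) auto
  also have "\<dots> \<le> 2 * (s / \<beta>)\<^sup>2 * b\<^sup>2 + 2 * (b\<^sup>2 / \<beta>) * (s\<^sup>2 / \<beta> + 3 * (norm x)\<^sup>2)"
    using rx beta by (intro add_left_mono mult_left_mono) auto
  also have "\<dots> = s\<^sup>2 * (4 * b\<^sup>2 / \<beta>\<^sup>2) + 6 * (b\<^sup>2 / \<beta>) * (norm x)\<^sup>2"
    using beta by (simp add: field_simps power2_eq_square)
  also have "\<dots> \<le> (9 * (norm v)\<^sup>2 * (norm x)\<^sup>2) * (4 * b\<^sup>2 / \<beta>\<^sup>2) + 6 * (b\<^sup>2 / \<beta>) * (norm x)\<^sup>2"
    using s2 by (intro add_right_mono mult_right_mono) auto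
  also have "\<dots> = (36 * (norm v / \<beta>)\<^sup>2 * b\<^sup>2 + 6 * (b\<^sup>2 / \<beta>)) * (norm x)\<^sup>2"
    by (simp add: algebra_simps power_divide)
  finally have "sqrt ((norm x')\<^sup>2) \<le> sqrt ((36 * (norm v / \<beta>)\<^sup>2 * b\<^sup>2 + 6 * (b\<^sup>2 / \<beta>)) * (norm x)\<^sup>2)"
    by (rule real_sqrt_le_mono)
  then show ?thesis by (simp add: real_sqrt_mult \<beta>_def)
qed

text \<open>Equal Gram matrices alone do not compare norms for an indefinite form. The positive
  vector \<open>\<phi> a + \<phi> b\<close> lies in the domain of the correspondence, so
  \<open>form_bound\<close> applies in both directions and the closure of the relation is the graph
  of a bounded bijection.\<close>

lemma unitary_extension:
  assumes tot: "total_family I \<phi>" "total_family I \<psi>"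
    and gram: "\<And>i j. i \<in> I \<Longrightarrow> j \<in> I \<Longrightarrow> BB (\<phi> i) (\<phi> j) = BB (\<psi> i) (\<psi> j)"
    and pos: "a \<in> I" "b \<in> I" "Re (BB (\<phi> a + \<phi> b) (\<phi> a + \<phi> b)) > 0"
  obtains T where "unitary T" "\<And>i. i \<in> I \<Longrightarrow> T (\<phi> i) = \<psi> i"
proof -
  let ?G = "span_graph I \<phi> \<psi>"
  let ?R = "{(x, y). ?G x y}"
  have G_BB: "BB x x' = BB y y'" if "?G x y" "?G x' y'" for x y x' y'
    by (rule span_graph_BB[of I \<phi> \<psi>]) (use gram that in auto)
  have Gv: "?G (\<phi> a + \<phi> b) (\<psi> a + \<psi> b)" 
    by (rule span_graph_add[OF span_graph_base[OF pos(2)] span_graph_base[OF pos(1)]])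
  let ?v = "\<phi> a + \<phi> b" let ?v' = "\<psi> a + \<psi> b"
  have p': "Re (BB ?v' ?v') > 0" using pos(3) G_BB[OF Gv Gv] by simp
  define C where "C = sqrt (36 * (norm ?v / Re (BB ?v ?v))\<^sup>2 * (norm ?v')\<^sup>2 + 6 * ((norm ?v')\<^sup>2 / Re (BB ?v ?v)))"
  define D where "D = sqrt (36 * (norm ?v' / Re (BB ?v' ?v'))\<^sup>2 * (norm ?v)\<^sup>2 + 6 * ((norm ?v)\<^sup>2 / Re (BB ?v' ?v')))"
  have C: "norm y \<le> C * norm x" if G: "?G x y" for x y
    unfolding C_def
    by (rule form_bound[OF pos(3) G_BB[OF Gv Gv, symmetric] G_BB[OF G Gv, symmetric] G_BB[OF G G, symmetric] order_refl])
  have D: "norm x \<le> D * norm y" if G: "?G x y" for x y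
    unfolding D_def
    by (rule form_bound[OF p' G_BB[OF Gv Gv] G_BB[OF G Gv] G_BB[OF G G] order_refl])
  have clE: "\<exists>f g. (\<forall>n. ?G (f n) (g n)) \<and> f \<longlonglongrightarrow> x \<and> g \<longlonglongrightarrow> y" if "(x, y) \<in> closure ?R" for x y
  proof -
    have "\<exists>h. (\<forall>n. h n \<in> ?R) \<and> h \<longlonglongrightarrow> (x, y)"
      by (rule closure_sequential[THEN iffD1, OF that])
    then obtain h where h: "\<forall>n. h n \<in> ?R" "h \<longlonglongrightarrow> (x, y)" by (elim exE conjE)
    have "\<forall>n. ?G (fst (h n)) (snd (h n))" using h(1) by (simp add: case_prod_beta)
    moreover have "(\<lambda>n. fst (h n)) \<longlonglongrightarrow> x" "(\<lambda>n. snd (h n)) \<longlonglongrightarrow> y"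
      using tendsto_fst[OF h(2)] tendsto_snd[OF h(2)] by simp_all
    ultimately show ?thesis by (intro exI conjI)
  qed
  have clI: "(x, y) \<in> closure ?R" if "\<And>n. ?G (f n) (g n)" "f \<longlonglongrightarrow> x" "g \<longlonglongrightarrow> y" for f g x y
    unfolding closure_sequential
    by (intro exI[of _ "\<lambda>n. (f n, g n)"]) (use that in \<open>auto intro!: tendsto_intros\<close>)
  have cl_add: "(x + x', y + y') \<in> closure ?R" if h: "(x, y) \<in> closure ?R" "(x', y') \<in> closure ?R" for x y x' y'
  proof -
    obtain f g where fg: "\<And>n. ?G (f n) (g n)" "f \<longlonglongrightarrow> x" "g \<longlonglongrightarrow> y" using clE[OF h(1)] by blast
    obtain f' g' where fg': "\<And>n. ?G (f' n) (g' n)" "f' \<longlonglongrightarrow> x'" "g' \<longlonglongrightarrow> y'" using clE[OF h(2)] by blast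
    show ?thesis
      by (rule clI[of "\<lambda>n. f n + f' n" "\<lambda>n. g n + g' n"])
         (rule span_graph_add[OF fg'(1) fg(1)] tendsto_add fg fg')+
  qed
  have cl_scale: "(c *\<^sub>C x, c *\<^sub>C y) \<in> closure ?R" if h: "(x, y) \<in> closure ?R" for x y c
  proof -
    obtain f g where fg: "\<And>n. ?G (f n) (g n)" "f \<longlonglongrightarrow> x" "g \<longlonglongrightarrow> y" using clE[OF h] by blast
    show ?thesis
      by (rule clI[of "\<lambda>n. c *\<^sub>C f n" "\<lambda>n. c *\<^sub>C g n"])
         (rule span_graph_scale[OF fg(1)] tendsto_scaleC tendsto_const fg)+
  qed
  have cl_bd: "norm y \<le> C * norm x" "norm x \<le> D * norm y" if h: "(x, y) \<in> closure ?R" for x y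
  proof -
    obtain f g where fg: "\<And>n. ?G (f n) (g n)" "f \<longlonglongrightarrow> x" "g \<longlonglongrightarrow> y" using clE[OF h] by blast
    show "norm y \<le> C * norm x"
      by (rule LIMSEQ_le[of "\<lambda>n. norm (g n)" _ "\<lambda>n. C * norm (f n)"])
         (use fg C in \<open>auto intro!: tendsto_intros\<close>)
    show "norm x \<le> D * norm y"
      by (rule LIMSEQ_le[of "\<lambda>n. norm (f n)" _ "\<lambda>n. D * norm (g n)"])
         (use fg D in \<open>auto intro!: tendsto_intros\<close>)
  qed
  have cl_BB: "BB x x' = BB y y'" if h: "(x, y) \<in> closure ?R" "(x', y') \<in> closure ?R" for x y x' y'
  proof -
    obtain f g where fg: "\<And>n. ?G (f n) (g n)" "f \<longlonglongrightarrow> x" "g \<longlonglongrightarrow> y" using clE[OF h(1)] by blast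
    obtain f' g' where fg': "\<And>n. ?G (f' n) (g' n)" "f' \<longlonglongrightarrow> x'" "g' \<longlonglongrightarrow> y'" using clE[OF h(2)] by blast
    have "(\<lambda>n. BB (f n) (f' n)) \<longlonglongrightarrow> BB x x'" by (intro tendsto_intros fg fg')
    moreover have "(\<lambda>n. BB (g n) (g' n)) \<longlonglongrightarrow> BB y y'" by (intro tendsto_intros fg fg')
    moreover have "BB (f n) (f' n) = BB (g n) (g' n)" for n using G_BB fg(1) fg'(1) by blast
    ultimately show ?thesis using LIMSEQ_unique by simp
  qed
  have conv: "\<exists>y. g \<longlonglongrightarrow> y" if f: "f \<longlonglongrightarrow> x" and B: "\<And>m n. norm (g m - g n) \<le> E * norm (f m - f n)"
    for f g :: "nat \<Rightarrow> l2" and x E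
  proof -
    have "Cauchy g"
    proof (rule CauchyI)
      fix e :: real assume e: "e > 0"
      have "e / (\<bar>E\<bar> + 1) > 0" using e by simp
      then obtain M where M: "\<And>m n. m \<ge> M \<Longrightarrow> n \<ge> M \<Longrightarrow> norm (f m - f n) < e / (\<bar>E\<bar> + 1)"
        using CauchyD[OF LIMSEQ_imp_Cauchy[OF f]] by blast
      have "norm (g m - g n) < e" if "m \<ge> M" "n \<ge> M" for m n
      proof -
        have "norm (g m - g n) \<le> (\<bar>E\<bar> + 1) * norm (f m - f n)"
          by (rule order_trans[OF B]) (intro mult_right_mono, auto)
        also have "\<dots> < e" using M[OF that] by (simp add: pos_less_divide_eq add_nonneg_pos mult.commute)
        finally show ?thesis .
      qed
      then show "\<exists>M. \<forall>m\<ge>M. \<forall>n\<ge>M. norm (g m - g n) < e" by blast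
    qed
    then show ?thesis by (simp add: Cauchy_convergent_iff convergent_def)
  qed
  have ex: "\<exists>y. (x, y) \<in> closure ?R" for x
  proof -
    obtain f g where fg: "\<And>n::nat. ?G (f n) (g n)" "f \<longlonglongrightarrow> x" using span_graph_dense[OF tot(1)] by metis
    have "norm (g m - g n) \<le> C * norm (f m - f n)" for m n by (rule C[OF span_graph_diff[OF fg(1) fg(1)]])
    then obtain y where "g \<longlonglongrightarrow> y" using conv[OF fg(2)] by blast
    then show ?thesis using clI fg by blast
  qed
  have ex': "\<exists>x. (x, y) \<in> closure ?R" for y
  proof -
    obtain f g where fg: "\<And>n::nat. span_graph I \<psi> \<phi> (f n) (g n)" "f \<longlonglongrightarrow> y" using span_graph_dense[OF tot(2)] by metis
    have G: "?G (g n) (f n)" for n using span_graph_sym[OF fg(1)] .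
    have "norm (g m - g n) \<le> D * norm (f m - f n)" for m n by (rule D[OF span_graph_diff[OF G G]])
    then obtain x where "g \<longlonglongrightarrow> x" using conv[OF fg(2)] by blast
    then show ?thesis using clI G fg by blast
  qed
  have diff: "(x - x', y - y') \<in> closure ?R" if "(x, y) \<in> closure ?R" "(x', y') \<in> closure ?R" for x y x' y'
    using cl_add[OF that(1) cl_scale[OF that(2), of "-1"]] by (simp add: scaleC_add)
  have uniq: "y = y'" if "(x, y) \<in> closure ?R" "(x, y') \<in> closure ?R" for x y y'
    using cl_bd(1)[OF diff[OF that]] by simp
  have uniq': "x = x'" if "(x, y) \<in> closure ?R" "(x', y) \<in> closure ?R" for x x' y
    using cl_bd(2)[OF diff[OF that]] by simp
  define T where "T x = (SOME y. (x, y) \<in> closure ?R)" for x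
  have T: "(x, T x) \<in> closure ?R" for x unfolding T_def by (rule someI_ex[OF ex])
  have T_eq: "T x = y" if "(x, y) \<in> closure ?R" for x y using uniq T that by blast
  have "bij T"
  proof (rule bijI)
    show "inj T" by (rule injI) (metis T uniq')
    show "surj T" unfolding surj_def using ex' T_eq by metis
  qed
  moreover have "T (x + y) = T x + T y" for x y by (rule T_eq[OF cl_add[OF T T]])
  moreover have "T (c *\<^sub>C x) = c *\<^sub>C T x" for c x by (rule T_eq[OF cl_scale[OF T]])
  moreover have "BB (T x) (T y) = BB x y" for x y using cl_BB[OF T T] by simp
  moreover have "norm (T x) \<le> C * norm x" for x using cl_bd(1)[OF T] .
  ultimately have "unitary T" unfolding unitary_def by blast
  moreover have "T (\<phi> i) = \<psi> i" if "i \<in> I" for i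
    by (rule T_eq, rule subsetD[OF closure_subset]) (simp add: span_graph_base[OF that])
  ultimately show thesis using that by blast
qed

section \<open>Fourier coefficients of the circle kernel\<close>

text \<open>The coefficient of z^k in (1 - z)^p.\<close>

definition bcoef :: "real \<Rightarrow> nat \<Rightarrow> real" where "bcoef p k = (- 1) ^ k * (p gchoose k)"

lemma bcoef_0 [simp]: "bcoef p 0 = 1"
  by (simp add: bcoef_def)

lemma bcoef_Suc: "(real k + 1) * bcoef p (Suc k) = (real k - p) * bcoef p k"
proof -
  have "(real k + 1) * (p gchoose Suc k) = (p - real k) * (p gchoose k)"
    using gbinomial_mult_1[of p k] by (simp add: algebra_simps)
  then have "(- 1) ^ Suc k * ((real k + 1) * (p gchoose Suc k)) = (- 1) ^ Suc k * ((p - real k) * (p gchoose k))" by simp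
  then show ?thesis by (simp add: bcoef_def algebra_simps)
qed

lemma bcoef_nonpos:
  assumes "0 \<le> p" "p \<le> 1" shows "bcoef p (Suc k) \<le> 0"
proof (induction k)
  case 0
  then show ?case using bcoef_Suc[of 0 p] assms by simp
next
  case (Suc k)
  have "(real (Suc k) - p) * bcoef p (Suc k) \<le> 0" using Suc.IH assms by (intro mult_nonneg_nonpos) auto
  then have "(real (Suc k) + 1) * bcoef p (Suc (Suc k)) \<le> 0" by (simp only: bcoef_Suc)
  then show ?case by (simp add: mult_le_0_iff)
qed

lemma bcoef_sum: "p * (\<Sum>k\<le>m. bcoef p k) = - (real m + 1) * bcoef p (Suc m)"
proof (induction m)
  case 0
  then show ?case using bcoef_Suc[of 0 p] by simp
next
  case (Suc m)
  then show ?case using bcoef_Suc[of "Suc m" p] by (simp add: algebra_simps)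
qed

text \<open>All coefficients after the first are nonpositive, while the partial sums are nonnegative
  by \<open>bcoef_sum\<close>; so the absolute values add up to at most 2. For p = 0 that identity
  is empty and the series is the constant 1. The second bound holds because k |bcoef p k| is p times
  a partial sum.\<close>

lemma bcoef_bounds:
  assumes p: "0 \<le> p" "p \<le> 1"
  shows "(\<Sum>k\<le>m. \<bar>bcoef p k\<bar>) \<le> 2" "real k * \<bar>bcoef p k\<bar> \<le> 1"
proof -
  have split: "(\<Sum>k\<le>m. bcoef p k) = 1 - (\<Sum>k\<in>{1..m}. \<bar>bcoef p k\<bar>)" for m
  proof -
    have "(\<Sum>k\<in>{1..m}. bcoef p k) = (\<Sum>k\<in>{1..m}. - \<bar>bcoef p k\<bar>)"
    proof (rule sum.cong)
      fix k assume "k \<in> {1..m}"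
      then show "bcoef p k = - \<bar>bcoef p k\<bar>" using bcoef_nonpos[OF p, of "k - 1"] by simp
    qed simp
    then show ?thesis by (simp add: atMost_atLeast0 sum.atLeast_Suc_atMost[of 0] sum_negf)
  qed
  have abs: "(\<Sum>k\<le>m. \<bar>bcoef p k\<bar>) = 1 + (\<Sum>k\<in>{1..m}. \<bar>bcoef p k\<bar>)" for m
    by (simp add: atMost_atLeast0 sum.atLeast_Suc_atMost[of 0])
  have nn: "(\<Sum>k\<le>m. bcoef p k) \<ge> 0" for m
  proof (cases "p = 0")
    case True
    have "real k * bcoef p k = 0" for k
    proof (induction k)
      case (Suc k)
      then show ?case using bcoef_Suc[of k p] True by (simp add: algebra_simps)
    qed simp
    then have z: "bcoef p (Suc k) = 0" for k by (metis mult_eq_0_iff of_nat_eq_0_iff nat.distinct(1))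
    then have "bcoef p k = 0" if "k \<in> {1..m}" for k using that by (cases k) auto
    then show ?thesis unfolding split by simp
  next
    case False
    then have "p > 0" using p by simp
    moreover have "p * (\<Sum>k\<le>m. bcoef p k) \<ge> 0"
      unfolding bcoef_sum using bcoef_nonpos[OF p, of m] by (intro mult_nonpos_nonpos) auto
    ultimately show ?thesis by (simp add: zero_le_mult_iff)
  qed
  have le1: "(\<Sum>k\<in>{1..m}. \<bar>bcoef p k\<bar>) \<le> 1" "(\<Sum>k\<le>m. bcoef p k) \<le> 1" for m
    using nn[of m] split[of m] sum_nonneg[of "{1..m}" "\<lambda>k. \<bar>bcoef p k\<bar>"] by auto
  show "(\<Sum>k\<le>m. \<bar>bcoef p k\<bar>) \<le> 2" using abs[of m] le1(1)[of m] by simp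
  show "real k * \<bar>bcoef p k\<bar> \<le> 1"
  proof (cases k)
    case (Suc m)
    have "real k * \<bar>bcoef p k\<bar> = p * (\<Sum>k\<le>m. bcoef p k)"
      unfolding bcoef_sum Suc using bcoef_nonpos[OF p, of m] by (simp add: algebra_simps)
    also have "\<dots> \<le> 1 * 1" using p nn[of m] le1(2)[of m] by (intro mult_mono) auto
    finally show ?thesis by simp
  qed simp
qed

lemma bcoef_abs_le: assumes p: "0 \<le> p" "p \<le> 1" shows "\<bar>bcoef p k\<bar> \<le> 2"
proof -
  have "\<bar>bcoef p k\<bar> \<le> (\<Sum>k\<le>k. \<bar>bcoef p k\<bar>)" by (rule member_le_sum) auto
  then show ?thesis using bcoef_bounds(1)[OF p, of k] by linarith
qed

lemma bcoef_summable: "0 \<le> p \<Longrightarrow> p \<le> 1 \<Longrightarrow> summable (\<lambda>k. \<bar>bcoef p k\<bar>)"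
proof (rule summableI_nonneg_bounded[where x = 2])
  fix n assume p: "0 \<le> p" "p \<le> 1"
  have "(\<Sum>i<n. \<bar>bcoef p i\<bar>) \<le> (\<Sum>i\<le>n. \<bar>bcoef p i\<bar>)" by (intro sum_mono2) auto
  then show "(\<Sum>i<n. \<bar>bcoef p i\<bar>) \<le> 2" using bcoef_bounds(1)[OF p, of n] by linarith
qed auto

lemma circle_Re:
  assumes "cmod z = 1" "z \<noteq> 1" shows "Re (1 - z) > 0"
proof -
  have "Re z \<noteq> 1"
  proof
    assume "Re z = 1"
    moreover have "(Re z)\<^sup>2 + (Im z)\<^sup>2 = 1" using assms(1) by (metis cmod_power2 one_power2)
    ultimately have "Im z = 0" by simp
    then show False using \<open>Re z = 1\<close> assms(2) by (simp add: complex_eq_iff)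
  qed
  moreover have "Re z \<le> 1" using complex_Re_le_cmod[of z] assms(1) by simp
  ultimately show ?thesis by simp
qed

lemma circle_cnj: assumes "cmod z = 1" "cmod w = 1" shows "z * cnj w = 1 \<longleftrightarrow> z = w"
proof
  have ww: "cnj w * w = 1" using assms(2) mult_cnj_cmod[of w] by (simp add: mult.commute)
  assume "z * cnj w = 1"
  then have "z * (cnj w * w) = w" by (metis mult.assoc mult_1)
  then show "z = w" unfolding ww by simp
next
  assume "z = w"
  then show "z * cnj w = 1" using assms(2) mult_cnj_cmod[of w] by simp
qed

text \<open>Abel's method: absolute summability makes the series continuous on the closed disc, and
  its boundary values are radial limits of the binomial formula inside.\<close>

lemma bcoef_power_series:
  assumes p: "0 \<le> p" "p \<le> 1" and z: "cmod z = 1" "z \<noteq> 1"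
  shows "(\<lambda>k. complex_of_real (bcoef p k) * z ^ k) sums (1 - z) powr complex_of_real p"
    "p > 0 \<Longrightarrow> (\<lambda>k. complex_of_real (bcoef p k)) sums 0"
proof -
  define f where "f w = (\<Sum>k. complex_of_real (bcoef p k) * w ^ k)" for w
  have sm: "summable (\<lambda>k. complex_of_real (bcoef p k) * w ^ k)" if "cmod w \<le> 1" for w
  proof (rule summable_norm_cancel, rule summable_comparison_test'[OF bcoef_summable[OF p]])
    show "norm (norm (complex_of_real (bcoef p k) * w ^ k)) \<le> \<bar>bcoef p k\<bar>" for k
      using that by (simp add: norm_mult norm_power mult_left_le power_le_one)
  qed
  have "uniform_limit (cball 0 1) (\<lambda>n w. \<Sum>k<n. complex_of_real (bcoef p k) * w ^ k) f sequentially"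
    unfolding f_def
    by (rule Weierstrass_m_test[OF _ bcoef_summable[OF p]])
       (simp add: norm_mult norm_power mult_left_le power_le_one)
  then have "continuous_on (cball 0 1) f"
    by (rule uniform_limit_theorem[rotated]) (auto intro!: always_eventually continuous_intros)
  then have c: "(\<lambda>n. f (r n * w)) \<longlonglongrightarrow> f w"
    if "cmod w = 1" "\<And>n. 0 \<le> r n \<and> r n \<le> 1" "r \<longlonglongrightarrow> (1::real)" for w r
  proof -
    have "(\<lambda>n. complex_of_real (r n) * w) \<longlonglongrightarrow> of_real 1 * w" by (intro tendsto_intros that)
    then have "(\<lambda>n. complex_of_real (r n) * w) \<longlonglongrightarrow> w" by simp
    then show ?thesis
      using \<open>continuous_on (cball 0 1) f\<close> that(1,2)
      by (intro continuous_on_tendsto_compose[of "cball 0 1" f]) (auto simp: norm_mult)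
  qed
  define r where "r n = 1 - inverse (real (Suc n))" for n
  have r: "0 \<le> r n" "r n < 1" for n unfolding r_def by (auto simp: field_simps)
  have rl: "r \<longlonglongrightarrow> 1"
    unfolding r_def using tendsto_diff[OF tendsto_const LIMSEQ_inverse_real_of_nat, of 1] by simp
  have inside: "f w = (1 - w) powr complex_of_real p" if "cmod w < 1" for w
  proof -
    have "(\<lambda>n. (complex_of_real p gchoose n) * (- w) ^ n) sums (1 + - w) powr complex_of_real p"
      using that by (intro gen_binomial_complex) simp
    moreover have "(complex_of_real p gchoose n) * (- w) ^ n = complex_of_real (bcoef p n) * w ^ n" for n
    proof -
      have "complex_of_real (p gchoose n) = complex_of_real p gchoose n" by (simp add: gbinomial_prod_rev)
      then show ?thesis by (simp add: bcoef_def power_minus[of w])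
    qed
    ultimately show ?thesis unfolding f_def by (simp add: sums_iff)
  qed
  have "(\<lambda>n. f (r n * z)) \<longlonglongrightarrow> f z" by (rule c) (use z r rl in \<open>auto intro: less_imp_le\<close>)
  moreover have "(\<lambda>n. (1 - r n * z) powr complex_of_real p) \<longlonglongrightarrow> (1 - of_real 1 * z) powr complex_of_real p"
  proof (intro tendsto_powr_complex tendsto_intros rl)
    show "1 - of_real 1 * z \<notin> \<real>\<^sub>\<le>\<^sub>0"
      using circle_Re[OF z] by (auto simp: complex_nonpos_Reals_iff)
  qed
  moreover have "f (r n * z) = (1 - r n * z) powr complex_of_real p" for n
    using r[of n] z(1) by (intro inside) (simp add: norm_mult)
  ultimately have "f z = (1 - z) powr complex_of_real p" using LIMSEQ_unique by force
  then show "(\<lambda>k. complex_of_real (bcoef p k) * z ^ k) sums (1 - z) powr complex_of_real p"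
    using summable_sums[OF sm[of z]] z(1) by (simp add: f_def)
  show "(\<lambda>k. complex_of_real (bcoef p k)) sums 0" if "p > 0"
  proof -
    have "(\<lambda>n. f (complex_of_real (r n) * 1)) \<longlonglongrightarrow> f 1" by (rule c) (use r rl in \<open>auto intro: less_imp_le\<close>)
    moreover have "f (complex_of_real (r n) * 1) = complex_of_real ((1 - r n) powr p)" for n
      using inside[of "of_real (r n)"] r[of n] powr_of_real[of "1 - r n" p] by simp
    moreover have "(\<lambda>n. complex_of_real ((1 - r n) powr p)) \<longlonglongrightarrow> complex_of_real 0"
    proof (rule tendsto_of_real)
      have "(\<lambda>n. 1 - r n) \<longlonglongrightarrow> 1 - 1" by (intro tendsto_intros rl)
      then have l: "(\<lambda>n. 1 - r n) \<longlonglongrightarrow> 0" by simp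
      have "(\<lambda>n. (1 - r n) powr p) \<longlonglongrightarrow> 0 powr p"
        by (rule tendsto_powr2[OF l tendsto_const]) (use r that in \<open>auto intro!: always_eventually simp: less_imp_le\<close>)
      then show "(\<lambda>n. (1 - r n) powr p) \<longlonglongrightarrow> 0" by simp
    qed
    ultimately have "f 1 = 0" using LIMSEQ_unique by simp
    then show ?thesis using summable_sums[OF sm[of 1]] by (simp add: f_def)
  qed
qed

text \<open>\<open>fcoef p q n\<close> is the Fourier coefficient of \<open>z\<^sup>n\<close>, \<open>n \<ge> 0\<close>, in
  \<open>(1 - z)\<^sup>p (1 - cnj z)\<^sup>q\<close> on the unit circle; that of \<open>z\<^sup>-\<^sup>n\<close> is \<open>fcoef q p n\<close>.\<close>

definition fcoef :: "real \<Rightarrow> real \<Rightarrow> nat \<Rightarrow> real" where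
  "fcoef p q n = (\<Sum>k. bcoef p (n + k) * bcoef q k)"

context
  fixes p q :: real assumes p: "0 \<le> p" "p \<le> 1" and q: "0 \<le> q" "q \<le> 1"
begin

lemma fcoef_summable: "summable (\<lambda>k. bcoef p (n + k) * bcoef q k)"
proof (rule summable_comparison_test')
  show "summable (\<lambda>k. 2 * \<bar>bcoef q k\<bar>)" by (intro summable_mult bcoef_summable q)
  show "norm (bcoef p (n + k) * bcoef q k) \<le> 2 * \<bar>bcoef q k\<bar>" for k
    using bcoef_abs_le[OF p, of "n + k"] by (simp add: abs_mult mult_right_mono)
qed

text \<open>The combination of neighbouring summands telescopes with the certificate
  \<open>d\<close>. The boundary term vanishes in the limit because k |bcoef q k| stays bounded and
  \<open>bcoef p\<close> tends to 0.\<close>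

lemma fcoef_Suc: "(real n + 1 + q) * fcoef p q (Suc n) = (real n - p) * fcoef p q n"
proof -
  define d where "d k = real k * (bcoef p (n + k) * bcoef q k)" for k
  have "d \<longlonglongrightarrow> 0"
  proof (rule Lim_null_comparison)
    have "(\<lambda>k. \<bar>bcoef p (k + n)\<bar>) \<longlonglongrightarrow> 0"
      using summable_LIMSEQ_zero[OF bcoef_summable[OF p]] by (rule LIMSEQ_ignore_initial_segment)
    then show "(\<lambda>k. \<bar>bcoef p (n + k)\<bar>) \<longlonglongrightarrow> 0" by (simp add: add.commute)
    have "norm (d k) \<le> \<bar>bcoef p (n + k)\<bar>" for k
    proof -
      have "norm (d k) = \<bar>bcoef p (n + k)\<bar> * (real k * \<bar>bcoef q k\<bar>)" by (simp add: d_def abs_mult)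
      also have "\<dots> \<le> \<bar>bcoef p (n + k)\<bar> * 1" using bcoef_bounds(2)[OF q] by (intro mult_left_mono) auto
      finally show ?thesis by simp
    qed
    then show "\<forall>\<^sub>F k in sequentially. norm (d k) \<le> \<bar>bcoef p (n + k)\<bar>" by simp
  qed
  then have tele: "(\<lambda>k. d k - d (Suc k)) sums (d 0 - 0)" by (rule telescope_sums')
  have "(\<lambda>k. (real n + 1 + q) * (bcoef p (Suc n + k) * bcoef q k) - (real n - p) * (bcoef p (n + k) * bcoef q k))
      sums ((real n + 1 + q) * fcoef p q (Suc n) - (real n - p) * fcoef p q n)"
    unfolding fcoef_def by (intro sums_diff sums_mult summable_sums fcoef_summable)
  moreover have "(real n + 1 + q) * (bcoef p (Suc n + k) * bcoef q k) - (real n - p) * (bcoef p (n + k) * bcoef q k) = d k - d (Suc k)" for k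
  proof -
    have 1: "(real n + real k + 1) * bcoef p (Suc (n + k)) = (real n + real k - p) * bcoef p (n + k)"
      using bcoef_Suc[of "n + k" p] by simp
    have 2: "(real k + 1) * bcoef q (Suc k) = (real k - q) * bcoef q k" by (rule bcoef_Suc)
    have "d (Suc k) = bcoef p (Suc (n + k)) * ((real k + 1) * bcoef q (Suc k))" by (simp add: d_def algebra_simps)
    also have "\<dots> = bcoef p (Suc (n + k)) * ((real k - q) * bcoef q k)" by (simp only: 2)
    finally have "d k - d (Suc k) = real k * (bcoef p (n + k) * bcoef q k) - bcoef p (Suc (n + k)) * ((real k - q) * bcoef q k)"
      by (simp add: d_def)
    moreover have "(real n + 1 + q) * (bcoef p (Suc n + k) * bcoef q k)
        = ((real n + real k + 1) * bcoef p (Suc (n + k))) * bcoef q k - bcoef p (Suc (n + k)) * ((real k - q) * bcoef q k)"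
      by (simp add: algebra_simps)
    ultimately show ?thesis unfolding 1 by (simp add: algebra_simps)
  qed
  ultimately have "(real n + 1 + q) * fcoef p q (Suc n) - (real n - p) * fcoef p q n = d 0 - 0"
    using sums_unique2[OF tele] by simp
  then show ?thesis by (simp add: d_def)
qed

lemma fcoef_0_pos: "fcoef p q 0 \<ge> 1"
proof -
  have "bcoef p k * bcoef q k \<ge> 0" for k
    by (cases k) (use bcoef_nonpos[OF p] bcoef_nonpos[OF q] in \<open>auto intro: mult_nonpos_nonpos\<close>)
  then have "(\<Sum>k\<in>{0}. bcoef p k * bcoef q k) \<le> (\<Sum>k. bcoef p k * bcoef q k)"
    using fcoef_summable[of 0] by (intro sum_le_suminf) auto
  then show ?thesis by (simp add: fcoef_def)
qed

text \<open>In the recurrence the factor n - p is nonpositive at n = 0 and nonnegative afterwards,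
  so the sign drops once and never returns.\<close>

lemma fcoef_nonpos: "fcoef p q (Suc n) \<le> 0"
proof (induction n)
  case 0
  have "(1 + q) * fcoef p q (Suc 0) = - p * fcoef p q 0" using fcoef_Suc[of 0] by simp
  also have "\<dots> \<le> 0" using p fcoef_0_pos by (simp add: mult_nonneg_nonneg)
  finally show ?case using q by (simp add: mult_le_0_iff)
next
  case (Suc n)
  have "(real (Suc n) - p) * fcoef p q (Suc n) \<le> 0" using Suc.IH p by (intro mult_nonneg_nonpos) auto
  then have "(real (Suc n) + 1 + q) * fcoef p q (Suc (Suc n)) \<le> 0" by (simp only: fcoef_Suc)
  then show ?case using q by (simp add: mult_le_0_iff)
qed

lemma fcoef_nonzero:
  assumes "0 < p" "p < 1" shows "fcoef p q n \<noteq> 0"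
proof (induction n)
  case 0
  then show ?case using fcoef_0_pos by simp
next
  case (Suc n)
  have "real n - p \<noteq> 0" using assms by (cases n) auto
  then show ?case using fcoef_Suc[of n] Suc.IH by auto
qed

end

definition acoef :: "real \<Rightarrow> real \<Rightarrow> int \<Rightarrow> real" where
  "acoef p q n = (if n \<ge> 0 then fcoef p q (nat n) else fcoef q p (nat (- n)))"

definition kap :: "real \<Rightarrow> real \<Rightarrow> complex \<Rightarrow> complex" where
  "kap p q z = (1 - z) powr complex_of_real p * (1 - cnj z) powr complex_of_real q"

text \<open>The two factors are absolutely convergent power series in z and cnj z. Their double sum
  is regrouped by the difference of the exponents, since z cnj z = 1.\<close>

lemma kap_has_sum:
  assumes p: "0 \<le> p" "p \<le> 1" and q: "0 \<le> q" "q \<le> 1" and pq: "p + q > 0" and z: "cmod z = 1"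
  shows "((\<lambda>n. complex_of_real (acoef p q n) * z powi n) has_sum kap p q z) UNIV"
proof -
  have zc: "cmod (cnj z) = 1" using z by simp
  have z0: "z \<noteq> 0" using z by auto
  have zz: "z * cnj z = 1" using z by (simp add: mult_cnj_cmod)
  have cz: "cnj z = inverse z" using zz z0 by (simp add: field_simps)
  define u v where "u k = complex_of_real (bcoef p k) * z ^ k" and "v k = complex_of_real (bcoef q k) * cnj z ^ k" for k
  have nu: "summable (\<lambda>k. norm (u k))" and nv: "summable (\<lambda>k. norm (v k))"
    using bcoef_summable[OF p] bcoef_summable[OF q] z by (simp_all add: u_def v_def norm_mult norm_power)
  have S: "suminf u * suminf v = kap p q z"
  \<comment> \<open>At z = 1 the principal powers in \<open>kap\<close> give 0; since p + q > 0, at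
    least one of the two series has sum 0 as well.\<close>
  proof (cases "z = 1")
    case True
    have "p > 0 \<or> q > 0" using pq by linarith
    have one: "cmod (- 1) = 1" "(- 1 :: complex) \<noteq> 1" by simp_all
    have "p > 0 \<Longrightarrow> suminf u = 0" "q > 0 \<Longrightarrow> suminf v = 0"
      using bcoef_power_series(2)[OF p one] bcoef_power_series(2)[OF q one]
      by (simp_all add: u_def[abs_def] v_def[abs_def] True sums_iff)
    then have "suminf u * suminf v = 0" using \<open>p > 0 \<or> q > 0\<close> by auto
    then show ?thesis by (simp add: kap_def True)
  next
    case False
    then have "cnj z \<noteq> 1" by (metis complex_cnj_cnj complex_cnj_one)
    have "suminf u = (1 - z) powr complex_of_real p"
      unfolding u_def using bcoef_power_series(1)[OF p z False] by (simp add: sums_iff)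
    moreover have "suminf v = (1 - cnj z) powr complex_of_real q"
      unfolding v_def using bcoef_power_series(1)[OF q zc \<open>cnj z \<noteq> 1\<close>] by (simp add: sums_iff)
    ultimately show ?thesis by (simp add: kap_def)
  qed
  let ?f = "\<lambda>(j, k). u j * v k"
  have "(\<lambda>(j, k). norm (u j) * norm (v k)) summable_on UNIV \<times> UNIV"
  proof (rule summable_on_SigmaI[where g = "\<lambda>j. norm (u j) * suminf (\<lambda>k. norm (v k))"])
    fix j :: nat
    have "((\<lambda>k. norm (v k)) has_sum suminf (\<lambda>k. norm (v k))) UNIV"
      by (rule norm_summable_imp_has_sum) (use nv in \<open>auto intro: summable_sums\<close>)
    then show "((\<lambda>k. case (j, k) of (j, k) \<Rightarrow> norm (u j) * norm (v k)) has_sum norm (u j) * suminf (\<lambda>k. norm (v k))) UNIV"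
      by (simp add: has_sum_cmult_right)
  next
    have "(\<lambda>j. norm (u j)) summable_on UNIV" by (rule norm_summable_imp_summable_on) (use nu in simp)
    then show "(\<lambda>j. norm (u j) * suminf (\<lambda>k. norm (v k))) summable_on UNIV" by (rule summable_on_cmult_left)
  qed auto
  then have "(\<lambda>x. norm (?f x)) summable_on UNIV \<times> UNIV" by (simp add: case_prod_unfold norm_mult)
  then have smf: "?f summable_on UNIV \<times> UNIV" by (rule abs_summable_summable)
  have hu: "(u has_sum suminf u) UNIV" and hv: "(v has_sum suminf v) UNIV"
    by (rule norm_summable_imp_has_sum; use nu nv in \<open>auto intro: summable_sums summable_norm_cancel\<close>)+
  have "infsum ?f (UNIV \<times> UNIV) = suminf u * suminf v"
  proof -
    have "((\<lambda>j. u j * suminf v) has_sum infsum ?f (UNIV \<times> UNIV)) UNIV"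
      by (rule has_sum_SigmaD[OF has_sum_infsum[OF smf]]) (simp add: has_sum_cmult_right hv)
    moreover have "((\<lambda>j. u j * suminf v) has_sum suminf u * suminf v) UNIV"
      by (rule has_sum_cmult_left[OF hu])
    ultimately show ?thesis using has_sum_unique by blast
  qed
  then have F: "(?f has_sum kap p q z) (UNIV \<times> UNIV)" using has_sum_infsum[OF smf] S by simp
  \<comment> \<open>n is the difference of the two exponents and m their minimum, which makes the
    change of indices bijective.\<close>
  define h :: "int \<times> nat \<Rightarrow> nat \<times> nat" where "h = (\<lambda>(n, m). (nat n + m, nat (- n) + m))"
  have "bij_betw h (UNIV \<times> UNIV) (UNIV \<times> UNIV)"
    by (rule bij_betwI[where g = "\<lambda>(j, k). (int j - int k, min j k)"]) (auto simp: h_def)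
  then have F': "((\<lambda>x. ?f (h x)) has_sum kap p q z) (UNIV \<times> UNIV)"
    using F has_sum_reindex_bij_betw[of h "UNIV \<times> UNIV" "UNIV \<times> UNIV" ?f] by simp
  show ?thesis
  proof (rule has_sum_SigmaD[OF F'])
    fix n :: int
    have trm: "?f (h (n, m)) = complex_of_real (bcoef p (nat n + m) * bcoef q (nat (- n) + m)) * z powi n" for m
    proof -
      have "z ^ (nat n + m) * cnj z ^ (nat (- n) + m) = (z * cnj z) ^ m * (z ^ nat n * cnj z ^ nat (- n))"
        by (simp add: power_add power_mult_distrib mult_ac)
      also have "\<dots> = z powi n"
        unfolding zz by (cases "n \<ge> 0") (auto simp: power_int_def cz)
      finally show ?thesis by (simp add: h_def u_def v_def mult_ac)
    qed
    have inner: "((\<lambda>m. bcoef p (nat n + m) * bcoef q (nat (- n) + m)) has_sum acoef p q n) UNIV"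
    proof (rule norm_summable_imp_has_sum)
      have abs: "summable (\<lambda>m. norm (bcoef r (l + m) * bcoef s m))"
        if r: "0 \<le> r" "r \<le> 1" and s: "0 \<le> s" "s \<le> 1" for r s l
      proof (rule summable_comparison_test')
        show "summable (\<lambda>k. 2 * \<bar>bcoef s k\<bar>)" by (intro summable_mult bcoef_summable s)
        show "norm (norm (bcoef r (l + k) * bcoef s k)) \<le> 2 * \<bar>bcoef s k\<bar>" for k
          using bcoef_abs_le[OF r, of "l + k"] by (simp add: abs_mult mult_right_mono)
      qed
      show "summable (\<lambda>m. norm (bcoef p (nat n + m) * bcoef q (nat (- n) + m)))"
        using abs[OF p q, of "nat n"] abs[OF q p, of "nat (- n)"]
        by (cases "n \<ge> 0") (simp_all add: mult.commute)
      show "(\<lambda>m. bcoef p (nat n + m) * bcoef q (nat (- n) + m)) sums acoef p q n"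
        using summable_sums[OF fcoef_summable[OF p q, of "nat n"]] summable_sums[OF fcoef_summable[OF q p, of "nat (- n)"]]
        by (cases "n \<ge> 0") (simp_all add: acoef_def fcoef_def mult.commute)
    qed
    show "((\<lambda>m. ?f (h (n, m))) has_sum complex_of_real (acoef p q n) * z powi n) UNIV"
      unfolding trm by (intro has_sum_cmult_left has_sum_of_real inner)
  qed
qed

section \<open>The model space\<close>

lemma Ln_cnj: "Re x > 0 \<Longrightarrow> Ln (cnj x) = cnj (Ln x)"
  by (intro cnj_Ln[symmetric]) (auto simp: complex_nonpos_Reals_iff)

text \<open>Taking logarithms is exact, not only modulo 2 pi i: each of the four arguments is below
  pi/2 in absolute value, so the two sides differ by less than 2 pi.\<close>

lemma Ln_product:
  assumes "Re x > 0" "Re y > 0" "Re u > 0" "Re v > 0" "c > 0" and eq: "x * y * cnj u * complex_of_real c = v"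
  shows "Ln x + Ln y + cnj (Ln u) + complex_of_real (ln c) = Ln v"
proof -
  let ?L = "Ln x + Ln y + cnj (Ln u) + complex_of_real (ln c)"
  have nz: "x \<noteq> 0" "y \<noteq> 0" "u \<noteq> 0" "v \<noteq> 0" using assms(1-4) by auto
  have "exp ?L = x * y * cnj u * complex_of_real c"
    unfolding exp_add exp_cnj[symmetric] using nz assms(5) by (simp add: exp_of_real)
  then have "exp ?L = exp (Ln v)" using eq nz by simp
  moreover have "\<bar>Im ?L - Im (Ln v)\<bar> < 2 * pi"
    using assms(1-4)[THEN Re_Ln_pos_lt_imp] by simp
  ultimately show ?thesis using exp_complex_eqI by blast
qed

text \<open>Dividing the denominator of the circle action by \<open>cnj a'\<close> moves it into the
  right half-plane, where the principal logarithm is continuous and commutes with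
  conjugation.\<close>

lemma Re_denom:
  assumes "cmod b < cmod a'" "cmod z = 1" shows "Re (1 + cnj b / cnj a' * z) > 0"
proof -
  have "cmod a' > 0" using assms(1) norm_ge_zero[of b] by linarith
  then have "cmod (cnj b / cnj a' * z) < 1" using assms by (simp add: norm_mult norm_divide)
  then have "- Re (cnj b / cnj a' * z) < 1" using abs_Re_le_cmod[of "cnj b / cnj a' * z"] by linarith
  then show ?thesis by simp
qed

lemma norm_powi_circle: "cmod z = 1 \<Longrightarrow> cmod (z powi n) = 1"
  by (simp add: norm_power_int)

text \<open>Averaging over \<open>N\<close>-th roots of unity isolates one Fourier mode as \<open>N \<rightarrow> \<infinity>\<close>.\<close>

lemma root_average:
  fixes m :: int
  assumes m: "m \<noteq> 0" "\<bar>m\<bar> < int N"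
  shows "(\<Sum>j<N. (cis (2 * pi / N) ^ j) powi m) = 0"
proof -
  have N: "N > 0" using m by auto
  define \<omega> where "\<omega> = cis (2 * pi * m / N)"
  have pw: "(cis (2 * pi / N) ^ j) powi m = \<omega> ^ j" for j
    by (simp add: \<omega>_def Complex.DeMoivre cis_power_int mult_ac)
  have "\<omega> \<noteq> 1"
  proof
    assume "\<omega> = 1"
    then have "cos (2 * pi * m / N) = 1" by (simp add: \<omega>_def complex_eq_iff)
    then have "\<exists>n::int. 2 * pi * m / N = n * 2 * pi" by (rule cos_one_2pi_int[THEN iffD1])
    then obtain n :: int where "2 * pi * m / N = real_of_int n * 2 * pi" by blast
    then have "real_of_int m = real_of_int (n * int N)" using N by (simp add: field_simps)
    then have mn: "m = n * int N" using of_int_eq_iff by blast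
    then have "n \<noteq> 0" using m by auto
    then have "int N \<le> \<bar>m\<bar>" unfolding mn abs_mult using mult_right_mono[of 1 "\<bar>n\<bar>" "int N"] by simp
    then show False using m by simp
  qed
  moreover have "\<omega> ^ N = 1"
  proof -
    have "\<omega> ^ N = cis (2 * pi * m)" using N by (simp add: \<omega>_def Complex.DeMoivre)
    then show ?thesis by (simp add: cis_multiple_2pi)
  qed
  ultimately show ?thesis unfolding pw by (simp add: sum_gp_strict)
qed

text \<open>On the square, \<open>nondeg\<close> says that (p, q) is not a corner; then at least one
  of the two one-sided coefficient sequences has no zero, which makes the model
  infinite-dimensional.\<close>

locale model =
  fixes p q :: real
  assumes p: "0 \<le> p" "p \<le> 1" and q: "0 \<le> q" "q \<le> 1"
    and nondeg: "0 < p \<and> p < 1 \<or> 0 < q \<and> q < 1"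
begin

lemma pq_pos: "p + q > 0" using p q nondeg by auto

abbreviation a :: "int \<Rightarrow> real" where "a \<equiv> acoef p q"

lemma a_0: "a 0 > 0"
  using fcoef_0_pos[OF p q] by (simp add: acoef_def)

lemma a_nonpos: assumes "n \<noteq> 0" shows "a n \<le> 0"
proof (cases "n \<ge> 0")
  case True
  then have "nat n = Suc (nat n - 1)" using assms by simp
  then show ?thesis using fcoef_nonpos[OF p q, of "nat n - 1"] True by (simp add: acoef_def)
next
  case False
  then have "nat (- n) = Suc (nat (- n) - 1)" by simp
  then show ?thesis using fcoef_nonpos[OF q p, of "nat (- n) - 1"] False by (simp add: acoef_def)
qed

definition supp :: "int set" where "supp = {n. a n \<noteq> 0}"

lemma supp_infinite: "infinite supp"
proof (cases "0 < p \<and> p < 1")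
  case True
  then have "range int \<subseteq> supp" using fcoef_nonzero[OF p q] by (auto simp: supp_def acoef_def)
  moreover have "infinite (range int)" by (rule range_inj_infinite) (auto simp: inj_on_def)
  ultimately show ?thesis using infinite_super by blast
next
  case False
  then have "0 < q" "q < 1" using nondeg by auto
  then have "range (\<lambda>n. - int (Suc n)) \<subseteq> supp" using fcoef_nonzero[OF q p] by (auto simp: supp_def acoef_def)
  moreover have "infinite (range (\<lambda>n. - int (Suc n)))" by (rule range_inj_infinite) (auto simp: inj_on_def)
  ultimately show ?thesis using infinite_super by blast
qed

text \<open>Mode 0, the only one with a positive coefficient, must occupy coordinate 0, where
  \<open>BB\<close> has its positive sign. Modes with coefficient zero are skipped, as they would
  leave coordinates unreached by the family.\<close>

definition en :: "nat \<Rightarrow> int" where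
  "en k = (case k of 0 \<Rightarrow> 0 | Suc j \<Rightarrow> from_nat_into (supp - {0}) j)"

lemma en_0 [simp]: "en 0 = 0" by (simp add: en_def)

lemma en_bij: "bij_betw en UNIV supp"
proof -
  have b: "bij_betw (from_nat_into (supp - {0})) UNIV (supp - {0})"
    using supp_infinite by (intro bij_betw_from_nat_into) auto
  have z: "0 \<in> supp" using a_0 by (simp add: supp_def)
  have ne: "from_nat_into (supp - {0}) j \<noteq> 0" for j using bij_betwE[OF b] by auto
  have inj: "from_nat_into (supp - {0}) j = from_nat_into (supp - {0}) k \<longleftrightarrow> j = k" for j k
    using b unfolding bij_betw_def inj_on_def by auto
  show ?thesis unfolding bij_betw_def
  proof
    show "inj en"
    proof (rule injI)
      fix j k assume "en j = en k"
      then show "j = k" by (cases j; cases k) (auto simp: en_def ne inj ne[symmetric])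
    qed
    have "range en = insert 0 (range (from_nat_into (supp - {0})))"
    proof (intro set_eqI iffI)
      fix n assume "n \<in> range en"
      then obtain k where "n = en k" by blast
      then show "n \<in> insert 0 (range (from_nat_into (supp - {0})))" by (cases k) (auto simp: en_def)
    next
      fix n assume "n \<in> insert 0 (range (from_nat_into (supp - {0})))"
      then consider "n = en 0" | j where "n = en (Suc j)" by (auto simp: en_def)
      then show "n \<in> range en" by cases (metis rangeI)+
    qed
    also have "\<dots> = supp" using b z by (auto simp: bij_betw_def)
    finally show "range en = supp" .
  qed
qed

lemma en_eq_iff: "en j = en k \<longleftrightarrow> j = k"
  using en_bij by (auto simp: bij_betw_def inj_on_def)

lemma kernel_sums:
  assumes "cmod z = 1"
  shows "(\<lambda>k. complex_of_real (a (en k)) * z powi en k) sums kap p q z"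
proof -
  have "((\<lambda>n. complex_of_real (a n) * z powi n) has_sum kap p q z) supp"
    using kap_has_sum[OF p q pq_pos assms]
    by (subst has_sum_cong_neutral[where T = UNIV and g = "\<lambda>n. complex_of_real (a n) * z powi n"]) (auto simp: supp_def)
  then have "((\<lambda>k. complex_of_real (a (en k)) * z powi en k) has_sum kap p q z) UNIV"
    using has_sum_reindex_bij_betw[OF en_bij, of "\<lambda>n. complex_of_real (a n) * z powi n"] by simp
  then show ?thesis by (rule has_sum_imp_sums)
qed

text \<open>The series converges at z = 1, and all its terms except the one at index 0 have the same
  sign.\<close>

lemma a_summable: "summable (\<lambda>k. \<bar>a (en k)\<bar>)"
proof -
  have "(\<lambda>k. complex_of_real (a (en k)) * 1 powi en k) sums kap p q 1" by (rule kernel_sums) simp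
  then have s: "summable (\<lambda>k. complex_of_real (a (en k)))" by (simp add: sums_iff)
  then have "summable (\<lambda>k. a (en k))" using summable_Re by fastforce
  then have "summable (\<lambda>k. a (en (Suc k)))" by (subst summable_Suc_iff)
  then have "summable (\<lambda>k. - a (en (Suc k)))" by (rule summable_minus)
  moreover have "- a (en (Suc k)) = \<bar>a (en (Suc k))\<bar>" for k
    using a_nonpos[of "en (Suc k)"] en_eq_iff[of "Suc k" 0] by simp
  ultimately have "summable (\<lambda>k. \<bar>a (en (Suc k))\<bar>)" by simp
  then show ?thesis by (subst (asm) summable_Suc_iff)
qed

text \<open>Only absolute values of the coefficients enter; their signs are supplied by
  \<open>BB\<close>.\<close>

definition \<Phi> :: "complex \<Rightarrow> l2" where
  "\<Phi> z = l2_of (\<lambda>k. complex_of_real (sqrt \<bar>a (en k)\<bar>) * z powi en k)"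

lemma coord_\<Phi>: assumes "cmod z = 1" shows "coord (\<Phi> z) k = complex_of_real (sqrt \<bar>a (en k)\<bar>) * z powi en k"
proof -
  have "(\<lambda>k. complex_of_real (sqrt \<bar>a (en k)\<bar>) * z powi en k) \<in> L2"
    using a_summable by (simp add: L2_def norm_mult norm_powi_circle[OF assms])
  then show ?thesis by (simp add: \<Phi>_def l2_of_inverse)
qed

lemma BB_\<Phi>:
  assumes "cmod z = 1" "cmod w = 1"
  shows "BB (\<Phi> z) (\<Phi> w) = kap p q (z * cnj w)"
proof -
  let ?c = "z * cnj w"
  have nc: "cmod ?c = 1" using assms by (simp add: norm_mult)
  have cp: "cnj (w powi n) = cnj w powi n" for n by (simp add: power_int_def)
  have trm: "coord (\<Phi> z) k * cnj (coord (\<Phi> w) k) = complex_of_real \<bar>a (en k)\<bar> * ?c powi en k" for k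
  proof -
    have "complex_of_real (sqrt \<bar>a (en k)\<bar>) * complex_of_real (sqrt \<bar>a (en k)\<bar>) = complex_of_real \<bar>a (en k)\<bar>"
      by (simp flip: of_real_mult)
    then have "complex_of_real \<bar>a (en k)\<bar> * ?c powi en k = (complex_of_real (sqrt \<bar>a (en k)\<bar>) * z powi en k) * (complex_of_real (sqrt \<bar>a (en k)\<bar>) * cnj w powi en k)"
      by (simp only: power_int_mult_distrib mult_ac)
    then show ?thesis by (simp add: coord_\<Phi> assms cp)
  qed
  have abs: "complex_of_real \<bar>a (en k)\<bar> * ?c powi en k
      = (if k = 0 then complex_of_real (2 * a 0) else 0) - complex_of_real (a (en k)) * ?c powi en k" for k
  proof (cases "k = 0")
    case False
    then show ?thesis using a_nonpos[of "en k"] en_eq_iff[of k 0] by simp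
  qed (use a_0 in simp)
  have "(\<lambda>k. (if k = 0 then complex_of_real (2 * a 0) else 0) - complex_of_real (a (en k)) * ?c powi en k)
      sums (complex_of_real (2 * a 0) - kap p q ?c)"
    by (intro sums_diff kernel_sums[OF nc] sums_single)
  then have "cin (\<Phi> z) (\<Phi> w) = complex_of_real (2 * a 0) - kap p q ?c"
    unfolding cin_def trm abs by (simp add: sums_iff)
  moreover have "coord (\<Phi> z) 0 * cnj (coord (\<Phi> w) 0) = complex_of_real (a 0)"
    unfolding trm using a_0 by simp
  ultimately show ?thesis by (simp add: BB_def mult.assoc)
qed

text \<open>Averaging z^(-n) \<Phi>(z) over the N-th roots of unity leaves, as N grows, only the
  coordinate of mode n. The coordinates of the error are dominated by a summable sequence, so
  coordinatewise convergence becomes norm convergence by Tannery's theorem, and every basis vector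
  lies in S.\<close>

lemma \<Phi>_total_closed:
  assumes S: "csubspace S" "closed S" and mem: "\<And>z. cmod z = 1 \<Longrightarrow> \<Phi> z \<in> S"
  shows "S = UNIV"
proof (rule closed_csubspace_UNIV[OF S])
  fix k
  define n where "n = en k"
  define r where "r N j = cis (2 * pi / real N) ^ j" for N j
  define x where "x N = complex_of_real (1 / real N) *\<^sub>C (\<Sum>j<N. r N j powi (- n) *\<^sub>C \<Phi> (r N j))" for N
  define v where "v = complex_of_real (sqrt \<bar>a n\<bar>) *\<^sub>C ek k"
  have c1: "cmod (r N j) = 1" for N j by (simp add: r_def norm_power)
  have cx: "coord (x N) l = complex_of_real (sqrt \<bar>a (en l)\<bar>) * (complex_of_real (1 / real N) * (\<Sum>j<N. r N j powi (en l - n)))" for N l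
  proof -
    have nz: "r N j \<noteq> 0" for j by (simp add: r_def)
    have e: "r N j powi (en l - n) = r N j powi (- n) * r N j powi en l" for j
      using power_int_add[of "r N j" "- n" "en l"] nz by simp
    show ?thesis
      unfolding x_def coord_simps coord_sum coord_\<Phi>[OF c1] e sum_distrib_left
      by (intro sum.cong) (simp_all only: mult_ac)
  qed
  have bd: "cmod (complex_of_real (1 / real N) * (\<Sum>j<N. r N j powi m)) \<le> 1" for N and m :: int
  proof (cases "N = 0")
    case False
    have "cmod (\<Sum>j<N. r N j powi m) \<le> (\<Sum>j<N. 1)"
      by (rule order_trans[OF norm_sum]) (simp add: norm_powi_circle[OF c1])
    then show ?thesis using False by (simp add: norm_mult norm_divide field_simps)
  qed simp
  define d where "d l N = (cmod (coord (x N - v) l))\<^sup>2" for l N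
  have dlim: "(\<lambda>N. d l N) \<longlonglongrightarrow> 0" for l
  proof (rule tendsto_eventually)
    show "\<forall>\<^sub>F N in sequentially. d l N = 0"
      using eventually_gt_at_top[of "nat \<bar>en l - n\<bar>"]
    proof eventually_elim
      fix N assume N: "nat \<bar>en l - n\<bar> < N"
      show "d l N = 0"
      proof (cases "l = k")
        case True
        then have "coord (x N) l = complex_of_real (sqrt \<bar>a n\<bar>)" using N by (simp add: cx n_def)
        then show ?thesis by (simp add: d_def v_def True)
      next
        case False
        then have "en l - n \<noteq> 0" unfolding n_def using en_eq_iff by simp
        moreover have "\<bar>en l - n\<bar> < int N" using N by linarith
        ultimately have "coord (x N) l = 0" unfolding cx r_def using root_average by simp
        then show ?thesis using False by (simp add: d_def v_def)
      qed
    qed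
  qed
  have dbd: "d l N \<le> 4 * \<bar>a (en l)\<bar>" for l N
  proof -
    have "cmod (coord (x N) l) \<le> sqrt \<bar>a (en l)\<bar> * 1"
      unfolding cx norm_mult[of "complex_of_real (sqrt _)"] by (intro mult_mono bd) auto
    moreover have "cmod (coord v l) \<le> sqrt \<bar>a (en l)\<bar>" by (simp add: v_def n_def)
    ultimately have "cmod (coord (x N - v) l) \<le> 2 * sqrt \<bar>a (en l)\<bar>"
      using norm_triangle_ineq4[of "coord (x N) l" "coord v l"] by simp
    then have "d l N \<le> (2 * sqrt \<bar>a (en l)\<bar>)\<^sup>2" unfolding d_def by (intro power_mono) auto
    then show ?thesis by (simp add: power_mult_distrib)
  qed
  have "(\<lambda>N. \<Sum>l. d l N) \<longlonglongrightarrow> (\<Sum>l::nat. 0::real)"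
  proof -
    have "eventually (\<lambda>(l, N). norm (d l N) \<le> 4 * \<bar>a (en l)\<bar>) (at_top \<times>\<^sub>F sequentially)"
      using dbd by (intro always_eventually) (auto simp: d_def)
    moreover have "summable (\<lambda>l. 4 * \<bar>a (en l)\<bar>)" by (intro summable_mult a_summable)
    ultimately show ?thesis
      using tannerys_theorem[where a = d and b = "\<lambda>_. 0" and F = sequentially and M = "\<lambda>l. 4 * \<bar>a (en l)\<bar>"] dlim
      by simp
  qed
  then have "(\<lambda>N. (norm (x N - v))\<^sup>2) \<longlonglongrightarrow> 0" unfolding norm_l2_sq d_def by simp
  then have "(\<lambda>N. sqrt ((norm (x N - v))\<^sup>2)) \<longlonglongrightarrow> sqrt 0" by (rule tendsto_real_sqrt)
  then have "(\<lambda>N. norm (x N - v)) \<longlonglongrightarrow> 0" by simp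
  then have "x \<longlonglongrightarrow> v" using LIM_zero_cancel tendsto_norm_zero_iff by blast
  moreover have "x N \<in> S" for N
    unfolding x_def by (intro csubspaceD(3)[OF S(1)] csubspace_sum[OF S(1)] mem c1)
  ultimately have "v \<in> S" using closed_sequentially[OF S(2)] by blast
  then have "complex_of_real (1 / sqrt \<bar>a n\<bar>) *\<^sub>C v \<in> S" by (rule csubspaceD(3)[OF S(1)])
  moreover have "a n \<noteq> 0" using en_bij unfolding n_def supp_def bij_betw_def by auto
  ultimately show "ek k \<in> S" by (simp add: v_def flip: of_real_mult)
qed

text \<open>The mixed power u^p (cnj u)^q in the logarithmic coordinate L = Ln u, where
  multiplication becomes addition without choosing branches.\<close>

definition E :: "complex \<Rightarrow> complex" where "E L = exp (of_real p * L + of_real q * cnj L)"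

lemma E_add: "E (L + L') = E L * E L'"
  by (simp add: E_def algebra_simps flip: exp_add)

lemma E_nz: "E L \<noteq> 0" by (simp add: E_def)

lemma E_cnj: "cnj (E L) = E (cnj L)"
  by (simp add: E_def exp_cnj algebra_simps)

lemma norm_E: "cmod (E L) = exp ((p + q) * Re L)"
  by (simp add: E_def algebra_simps)

lemma kap_E: assumes "Re (1 - z) > 0" shows "kap p q z = E (Ln (1 - z))"
proof -
  have nz: "1 - z \<noteq> 0" "1 - cnj z \<noteq> 0" using assms by (auto simp: complex_eq_iff)
  have "Ln (1 - cnj z) = cnj (Ln (1 - z))" using Ln_cnj[OF assms] by simp
  then show ?thesis unfolding kap_def E_def powr_def exp_add using nz by simp
qed

lemma kap_1: "kap p q 1 = 0" by (simp add: kap_def)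

lemma kap_nz: assumes "cmod z = 1" "cmod w = 1" "z \<noteq> w" shows "kap p q (z * cnj w) \<noteq> 0"
proof -
  have "Re (1 - z * cnj w) > 0" using assms circle_cnj by (intro circle_Re) (auto simp: norm_mult)
  then show ?thesis using kap_E E_nz by metis
qed

lemma norm_kap: assumes "cmod z = 1" shows "cmod (kap p q z) = cmod (1 - z) powr (p + q)"
proof (cases "z = 1")
  case False
  have R: "Re (1 - z) > 0" using circle_Re[OF assms False] .
  then have "1 - z \<noteq> 0" using False by simp
  then show ?thesis unfolding kap_E[OF R] norm_E by (simp add: powr_def)
qed (simp add: kap_1)

text \<open>All \<Phi>(z) share coordinate 0, so a difference of two of them lies in the negative
  part, where the squared norm is minus the form value, here 2 Re kap(z cnj w).\<close>

lemma dist_\<Phi>: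
  assumes "cmod z = 1" "cmod w = 1"
  shows "(norm (\<Phi> z - \<Phi> w))\<^sup>2 \<le> 2 * cmod (z - w) powr (p + q)"
proof -
  have c: "coord (\<Phi> z - \<Phi> w) 0 = 0" by (simp add: coord_\<Phi> assms)
  have zz: "z * cnj z = 1" "w * cnj w = 1" using circle_cnj assms by auto
  have "- complex_of_real ((norm (\<Phi> z - \<Phi> w))\<^sup>2) = BB (\<Phi> z - \<Phi> w) (\<Phi> z - \<Phi> w)" unfolding BB_self c by simp
  also have "\<dots> = - (kap p q (z * cnj w) + cnj (kap p q (z * cnj w)))"
    using BB_cnj[of "\<Phi> z" "\<Phi> w"] by (simp add: BB_diff BB_\<Phi> assms zz kap_1)
  finally have "complex_of_real ((norm (\<Phi> z - \<Phi> w))\<^sup>2) = kap p q (z * cnj w) + cnj (kap p q (z * cnj w))"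
    by (metis neg_equal_iff_equal)
  also have "\<dots> = complex_of_real (2 * Re (kap p q (z * cnj w)))" by (rule complex_add_cnj)
  finally have "(norm (\<Phi> z - \<Phi> w))\<^sup>2 = 2 * Re (kap p q (z * cnj w))" using of_real_eq_iff by blast
  then have "(norm (\<Phi> z - \<Phi> w))\<^sup>2 \<le> 2 * cmod (kap p q (z * cnj w))"
    using complex_Re_le_cmod[of "kap p q (z * cnj w)"] by linarith
  also have "cmod (kap p q (z * cnj w)) = cmod (1 - z * cnj w) powr (p + q)"
    by (rule norm_kap) (simp add: norm_mult assms)
  also have "cmod (1 - z * cnj w) = cmod (z - w)"
  proof -
    have "1 - z * cnj w = - ((z - w) * cnj w)" using zz by (simp add: algebra_simps)
    then have "cmod (1 - z * cnj w) = cmod ((z - w) * cnj w)" by (metis norm_minus_cancel)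
    then show ?thesis using assms by (simp add: norm_mult)
  qed
  finally show ?thesis .
qed

text \<open>With (c, d) the lower row of g this is (c z + d)^p cnj(c z + d)^q up to a phase
  depending on g alone: from c z + d = d (1 + (c/d) z) the constant d is kept only through |d|. The
  phase is invisible projectively, and without it the formula stays in the domain of the principal
  logarithm.\<close>

definition jac :: "complex^2^2 \<Rightarrow> complex \<Rightarrow> complex" where
  "jac g z = E (Ln (1 + g $ 2 $ 1 / g $ 2 $ 2 * z) + of_real (ln (cmod (g $ 2 $ 2))))"

lemma jac_nz: "jac g z \<noteq> 0" by (simp add: jac_def E_nz)

text \<open>The cocycle identity 1 - gz cnj(gw) = (1 - z cnj w) / ((c z + d) cnj(c w + d)) is turned
  by \<open>Ln_product\<close> into an identity of logarithms, to which \<open>E\<close> is applied.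
  On the diagonal both sides are 0.\<close>

lemma jac_gram:
  assumes g: "g \<in> SU11" and z: "cmod z = 1" and w: "cmod w = 1"
  shows "BB (jac g z *\<^sub>C \<Phi> (mob g z)) (jac g w *\<^sub>C \<Phi> (mob g w)) = BB (\<Phi> z) (\<Phi> w)"
proof (cases "z = w")
  case True
  have "mob g w * cnj (mob g w) = 1" "w * cnj w = 1" using norm_mob[OF g w] w circle_cnj by auto
  then show ?thesis using norm_mob[OF g w] w by (simp add: True BB_scale BB_\<Phi> kap_1)
next
  case False
  obtain \<alpha> \<beta> where ab: "g = su \<alpha> \<beta>" "\<alpha> * cnj \<alpha> - \<beta> * cnj \<beta> = 1" "cmod \<beta> < cmod \<alpha>" using SU11E[OF g] by metis
  have a0: "\<alpha> \<noteq> 0" using ab(3) by auto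
  let ?D = "\<lambda>z. 1 + cnj \<beta> / cnj \<alpha> * z"
  have D: "Re (?D z) > 0" "Re (?D w) > 0" using Re_denom[OF ab(3)] z w by auto
  define u where "u = mob g z * cnj (mob g w)"
  have nu: "cmod u = 1" unfolding u_def using norm_mob[OF g] z w by (simp add: norm_mult)
  have u1: "u \<noteq> 1" unfolding u_def using circle_cnj norm_mob[OF g] mob_inj[OF g z w] z w False by blast
  have zw: "cmod (z * cnj w) = 1" "z * cnj w \<noteq> 1" using circle_cnj z w False by (auto simp: norm_mult)
  have Dn: "cnj \<beta> * z + cnj \<alpha> = cnj \<alpha> * ?D z" for z using a0 by (simp add: field_simps)
  have key: "(1 - u) * ?D z * cnj (?D w) * complex_of_real ((cmod \<alpha>)\<^sup>2) = 1 - z * cnj w"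
  proof -
    have nzw: "cnj \<beta> * z + cnj \<alpha> \<noteq> 0" "cnj (cnj \<beta> * w + cnj \<alpha>) \<noteq> 0"
      using su_denom_nz[OF ab(3) z] su_denom_nz[OF ab(3) w] by (simp_all only: complex_cnj_zero_iff not_False_eq_True)
    have U: "u * ((cnj \<beta> * z + cnj \<alpha>) * cnj (cnj \<beta> * w + cnj \<alpha>)) = (\<alpha> * z + \<beta>) * cnj (\<alpha> * w + \<beta>)"
      unfolding u_def ab(1) mob_su complex_cnj_divide times_divide_times_eq using nzw by (simp only: nonzero_eq_divide_eq[symmetric] mult_eq_0_iff simp_thms)
    have "(1 - u) * ?D z * cnj (?D w) * complex_of_real ((cmod \<alpha>)\<^sup>2) = (1 - u) * ((cnj \<alpha> * ?D z) * cnj (cnj \<alpha> * ?D w))"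
      unfolding mult_cnj_cmod[symmetric] complex_cnj_mult complex_cnj_cnj by (simp only: mult_ac)
    also have "\<dots> = (cnj \<beta> * z + cnj \<alpha>) * cnj (cnj \<beta> * w + cnj \<alpha>) - (\<alpha> * z + \<beta>) * cnj (\<alpha> * w + \<beta>)"
      unfolding Dn[symmetric] left_diff_distrib U by simp
    also have "\<dots> = (\<alpha> * cnj \<alpha> - \<beta> * cnj \<beta>) * (1 - z * cnj w)" by (simp add: algebra_simps)
    finally show ?thesis unfolding ab(2) by simp
  qed
  have L: "Ln (1 - u) + Ln (?D z) + cnj (Ln (?D w)) + complex_of_real (ln ((cmod \<alpha>)\<^sup>2)) = Ln (1 - z * cnj w)"
    by (rule Ln_product[OF circle_Re[OF nu u1] D circle_Re[OF zw] _ key]) (use a0 in simp)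
  have jz: "jac g x = E (Ln (?D x) + of_real (ln (cmod \<alpha>)))" for x by (simp add: jac_def ab(1))
  have ll: "complex_of_real (ln ((cmod \<alpha>)\<^sup>2)) = of_real (ln (cmod \<alpha>)) + of_real (ln (cmod \<alpha>))"
    using a0 by (simp add: ln_realpow)
  have "BB (jac g z *\<^sub>C \<Phi> (mob g z)) (jac g w *\<^sub>C \<Phi> (mob g w)) = jac g z * cnj (jac g w) * E (Ln (1 - u))"
    using norm_mob[OF g] z w by (simp add: BB_scale BB_\<Phi> u_def[symmetric] kap_E[OF circle_Re[OF nu u1]])
  also have "\<dots> = E (Ln (1 - u) + Ln (?D z) + cnj (Ln (?D w)) + complex_of_real (ln ((cmod \<alpha>)\<^sup>2)))"
    unfolding jz ll E_cnj complex_cnj_add complex_cnj_complex_of_real by (simp only: E_add mult_ac)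
  also have "\<dots> = BB (\<Phi> z) (\<Phi> w)" unfolding L using z w by (simp add: BB_\<Phi> kap_E[OF circle_Re[OF zw]])
  finally show ?thesis .
qed

lemma norm_jac:
  assumes g: "g \<in> SU11" and z: "cmod z = 1"
  shows "cmod (jac g z) = cmod (g $ 2 $ 1 * z + g $ 2 $ 2) powr (p + q)"
proof -
  obtain \<alpha> \<beta> where ab: "g = su \<alpha> \<beta>" "cmod \<beta> < cmod \<alpha>" using SU11E[OF g] by metis
  have a0: "\<alpha> \<noteq> 0" using ab(2) by auto
  let ?D = "1 + cnj \<beta> / cnj \<alpha> * z"
  have "Re ?D > 0" using Re_denom[OF ab(2) z] .
  then have D: "?D \<noteq> 0" by (metis less_irrefl zero_complex.simps(1))
  have "ln (cmod ?D) + ln (cmod \<alpha>) = ln (cmod ?D * cmod \<alpha>)" using D a0 by (simp add: ln_mult)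
  also have "cmod ?D * cmod \<alpha> = cmod (cnj \<beta> * z + cnj \<alpha>)"
  proof -
    have "cnj \<beta> * z + cnj \<alpha> = ?D * cnj \<alpha>" using a0 by (simp add: field_simps)
    then show ?thesis by (simp only: norm_mult complex_mod_cnj)
  qed
  finally have "Re (Ln ?D + of_real (ln (cmod \<alpha>))) = ln (cmod (cnj \<beta> * z + cnj \<alpha>))" using D by simp
  then show ?thesis
    using su_denom_nz[OF ab(2) z] by (simp add: jac_def ab(1) norm_E powr_def)
qed

definition circ :: "complex set" where "circ = {z. cmod z = 1}"

lemma \<Phi>_total: "total_family circ \<Phi>"
  unfolding total_family_def circ_def using \<Phi>_total_closed by blast

text \<open>g permutes the circle and the multipliers are nonzero, so both families span the same
  lines.\<close>

lemma twisted_total: assumes g: "g \<in> SU11" shows "total_family circ (\<lambda>z. jac g z *\<^sub>C \<Phi> (mob g z))"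
  unfolding total_family_def
proof (intro allI impI, elim conjE)
  fix S assume S: "csubspace S" "closed S" and mem: "\<forall>z\<in>circ. jac g z *\<^sub>C \<Phi> (mob g z) \<in> S"
  show "S = UNIV"
  proof (rule \<Phi>_total_closed[OF S])
    fix w assume "cmod w = 1"
    then obtain z where z: "cmod z = 1" "mob g z = w" using mob_surj[OF g] by metis
    then have "jac g z *\<^sub>C \<Phi> w \<in> S" using mem by (auto simp: circ_def)
    then have "(1 / jac g z) *\<^sub>C (jac g z *\<^sub>C \<Phi> w) \<in> S" by (rule csubspaceD(3)[OF S(1)])
    then show "\<Phi> w \<in> S" using jac_nz by simp
  qed
qed

lemma kap_minus_one: "kap p q (- 1) = of_real (2 powr (p + q))"
proof -
  have "kap p q (- 1) = complex_of_real 2 powr of_real p * complex_of_real 2 powr of_real q" by (simp add: kap_def)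
  then show ?thesis using powr_of_real[of 2 p] powr_of_real[of 2 q] by (simp add: powr_add)
qed

lemma base_pos: "Re (BB (\<Phi> 1 + \<Phi> (- 1)) (\<Phi> 1 + \<Phi> (- 1))) > 0"
  by (simp add: BB_lin BB_\<Phi> kap_minus_one kap_1)

definition T :: "complex^2^2 \<Rightarrow> l2 \<Rightarrow> l2" where
  "T g = (SOME U. unitary U \<and> (\<forall>z. cmod z = 1 \<longrightarrow> U (\<Phi> z) = jac g z *\<^sub>C \<Phi> (mob g z)))"

lemma T: assumes g: "g \<in> SU11"
  shows "unitary (T g)" "cmod z = 1 \<Longrightarrow> T g (\<Phi> z) = jac g z *\<^sub>C \<Phi> (mob g z)"
proof -
  obtain U where "unitary U" "\<And>z. z \<in> circ \<Longrightarrow> U (\<Phi> z) = jac g z *\<^sub>C \<Phi> (mob g z)"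
  proof (rule unitary_extension[OF \<Phi>_total twisted_total[OF g], of 1 "- 1"])
    fix i j assume "i \<in> circ" "j \<in> circ"
    then show "BB (\<Phi> i) (\<Phi> j) = BB (jac g i *\<^sub>C \<Phi> (mob g i)) (jac g j *\<^sub>C \<Phi> (mob g j))"
      using jac_gram[OF g] by (simp add: circ_def)
  qed (use base_pos in \<open>auto simp: circ_def\<close>)
  then have "\<exists>U. unitary U \<and> (\<forall>z. cmod z = 1 \<longrightarrow> U (\<Phi> z) = jac g z *\<^sub>C \<Phi> (mob g z))" by (auto simp: circ_def)
  then have "unitary (T g) \<and> (\<forall>z. cmod z = 1 \<longrightarrow> T g (\<Phi> z) = jac g z *\<^sub>C \<Phi> (mob g z))"
    unfolding T_def by (rule someI_ex)
  then show "unitary (T g)" "cmod z = 1 \<Longrightarrow> T g (\<Phi> z) = jac g z *\<^sub>C \<Phi> (mob g z)" by auto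
qed

end

section \<open>The representation on the model space\<close>

context model
begin

definition \<rho> :: "complex^2^2 \<Rightarrow> vect set \<Rightarrow> vect set" where
  "\<rho> g L = (\<lambda>v. coord (T g (l2_of v))) ` L"

lemma lifted_T: assumes "g \<in> SU11" shows "lifted (T g) (\<rho> g)" and \<rho>_lin: "\<rho> g (lin x) = lin (T g x)"
proof -
  show r: "\<rho> g (lin x) = lin (T g x)" for x
  proof -
    have "\<rho> g (lin x) = {coord (T g (c *\<^sub>C x)) | c. c \<noteq> 0}"
      unfolding \<rho>_def lin_alt setcompr_eq_image image_image coord_inverse ..
    then show ?thesis unfolding lin_alt by (simp add: unitaryD(3)[OF T(1)[OF assms]])
  qed
  then show "lifted (T g) (\<rho> g)" by (simp add: lifted_def)
qed

lemma \<Phi>_nz: assumes "cmod z = 1" shows "\<Phi> z \<noteq> 0"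
proof -
  have "coord (\<Phi> z) 0 \<noteq> 0" using a_0 by (simp add: coord_\<Phi>[OF assms])
  then show ?thesis by auto
qed

lemma \<Phi>_isotropic: "cmod z = 1 \<Longrightarrow> BB (\<Phi> z) (\<Phi> z) = 0"
  using circle_cnj[of z z] by (simp add: BB_\<Phi> kap_1)

lemma BB_\<Phi>_nz: "cmod z = 1 \<Longrightarrow> cmod w = 1 \<Longrightarrow> z \<noteq> w \<Longrightarrow> BB (\<Phi> z) (\<Phi> w) \<noteq> 0"
  by (simp add: BB_\<Phi> kap_nz)

lemma lin_\<Phi>_inj: assumes "cmod z = 1" "cmod w = 1" "lin (\<Phi> z) = lin (\<Phi> w)" shows "z = w"
proof (rule ccontr)
  assume "z \<noteq> w"
  obtain c where "\<Phi> z = c *\<^sub>C \<Phi> w" using assms(3) unfolding lin_eq_iff by blast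
  then have "BB (\<Phi> z) (\<Phi> w) = 0" by (simp add: BB_scale \<Phi>_isotropic[OF assms(2)])
  then show False using BB_\<Phi>_nz assms(1,2) \<open>z \<noteq> w\<close> by blast
qed

lemma \<rho>_\<Phi>: "g \<in> SU11 \<Longrightarrow> cmod z = 1 \<Longrightarrow> \<rho> g (lin (\<Phi> z)) = lin (\<Phi> (mob g z))"
  by (simp add: \<rho>_lin T(2) lin_scale jac_nz)

text \<open>Three points of the circle suffice to see that the multipliers do not depend on the point.\<close>

lemma scalar_of_fixing_all:
  assumes S: "unitary S" and h: "\<And>z. cmod z = 1 \<Longrightarrow> \<exists>c. S (\<Phi> z) = c *\<^sub>C \<Phi> z"
  obtains c where "c \<noteq> 0" "\<And>x. S x = c *\<^sub>C x"
proof -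
  obtain c where c: "\<And>z. cmod z = 1 \<Longrightarrow> S (\<Phi> z) = c z *\<^sub>C \<Phi> z" using h by metis
  have cc: "c z * cnj (c w) = 1" if "cmod z = 1" "cmod w = 1" "z \<noteq> w" for z w
  proof -
    have "BB (S (\<Phi> z)) (S (\<Phi> w)) = BB (\<Phi> z) (\<Phi> w)" by (rule unitaryD(4)[OF S])
    then show ?thesis using BB_\<Phi>_nz[OF that] that by (simp add: c BB_scale mult.commute)
  qed
  have ec: "c z = c 1" if z: "cmod z = 1" for z
  proof -
    obtain w where w: "cmod w = 1" "w \<noteq> z" "w \<noteq> 1"
    proof (cases "z = - 1")
      case True
      then show thesis using that[of \<i>] by (simp add: complex_eq_iff)
    next
      case False
      then show thesis using that[of "- 1"] by simp
    qed
    have "c z * cnj (c w) = 1" "c 1 * cnj (c w) = 1"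
      using cc[of z w] cc[of 1 w] z w by auto
    then show ?thesis by (metis mult_cancel_right mult_zero_right zero_neq_one)
  qed
  have "{x. S x = c 1 *\<^sub>C x} = UNIV"
  proof (rule \<Phi>_total_closed)
    show "csubspace {x. S x = c 1 *\<^sub>C x}"
      unfolding csubspace_def by (auto simp: unitaryD[OF S] scaleC_add mult.commute)
    show "closed {x. S x = c 1 *\<^sub>C x}"
      using linear_continuous_on[OF unitaryD(9)[OF S]] linear_continuous_on[OF bounded_linear_scaleC]
      by (intro closed_Collect_eq) auto
    show "\<Phi> z \<in> {x. S x = c 1 *\<^sub>C x}" if "cmod z = 1" for z using c[OF that] ec[OF that] by simp
  qed
  then have "S x = c 1 *\<^sub>C x" for x by blast
  moreover have "c 1 \<noteq> 0" using cc[of 1 "- 1"] by auto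
  ultimately show thesis using that by blast
qed

text \<open>The operators \<open>T g\<close> multiply only up to scalars. The defect of T(g) T(h)
  against T(gh) preserves every line of the total family, hence is a scalar and disappears on
  lines.\<close>

lemma \<rho>_mult: assumes g: "g \<in> SU11" and h: "h \<in> SU11" shows "\<rho> (g ** h) (lin x) = \<rho> g (\<rho> h (lin x))"
proof -
  have gh: "g ** h \<in> SU11" using SU11_mult[OF g h] .
  note Tgh = T(1)[OF gh]
  note I = unitary_inv[OF Tgh]
  let ?S = "inv (T (g ** h)) \<circ> (T g \<circ> T h)"
  have S: "unitary ?S" using unitary_comp I(1) T(1)[OF g] T(1)[OF h] by blast
  have "\<exists>c. ?S (\<Phi> z) = c *\<^sub>C \<Phi> z" if z: "cmod z = 1" for z
  proof -
    have "T g (T h (\<Phi> z)) = (jac h z * jac g (mob h z)) *\<^sub>C \<Phi> (mob g (mob h z))"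
      using T(2)[OF h z] T(2)[OF g norm_mob[OF h z]] by (simp add: unitaryD[OF T(1)[OF g]])
    moreover have "\<Phi> (mob g (mob h z)) = (1 / jac (g ** h) z) *\<^sub>C T (g ** h) (\<Phi> z)"
      using T(2)[OF gh z] mob_mult[OF g h z] jac_nz by simp
    ultimately have "?S (\<Phi> z) = (jac h z * jac g (mob h z) * (1 / jac (g ** h) z)) *\<^sub>C \<Phi> z"
      by (simp add: unitaryD(3)[OF I(1)] I(3))
    then show ?thesis by blast
  qed
  then obtain c where c: "c \<noteq> 0" "\<And>x. ?S x = c *\<^sub>C x" using scalar_of_fixing_all[OF S] by blast
  have "T g (T h x) = T (g ** h) (?S x)" by (simp add: I(2))
  also have "\<dots> = c *\<^sub>C T (g ** h) x" unfolding c(2) by (simp add: unitaryD[OF Tgh])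
  finally have "lin (T g (T h x)) = lin (T (g ** h) x)" using c(1) by (simp add: lin_scale)
  then show ?thesis by (simp add: \<rho>_lin g h gh)
qed

lemma \<rho>_minus_one: "\<rho> (- mat 1) (lin x) = lin x"
proof -
  have "\<exists>c. T (- mat 1) (\<Phi> z) = c *\<^sub>C \<Phi> z" if "cmod z = 1" for z
    using T(2)[OF SU11_one(2) that] by (auto simp: mob_one)
  then obtain c where "c \<noteq> 0" "\<And>x. T (- mat 1) x = c *\<^sub>C x"
    using scalar_of_fixing_all[OF T(1)[OF SU11_one(2)]] by blast
  then show ?thesis by (simp add: \<rho>_lin SU11_one lin_scale)
qed

lemma tendsto_\<Phi>:
  assumes f: "(f \<longlongrightarrow> w) F" and ev: "\<forall>\<^sub>F h in F. cmod (f h) = 1" and w: "cmod w = 1"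
  shows "((\<lambda>h. \<Phi> (f h)) \<longlongrightarrow> \<Phi> w) F"
proof -
  have "((\<lambda>h. cmod (f h - w)) \<longlongrightarrow> 0) F" using f by (simp add: LIM_zero tendsto_norm_zero)
  then have "((\<lambda>h. cmod (f h - w) powr (p + q)) \<longlongrightarrow> 0 powr (p + q)) F"
    using pq_pos by (intro tendsto_powr2 tendsto_const) (auto intro: always_eventually)
  then have "((\<lambda>h. sqrt (2 * cmod (f h - w) powr (p + q))) \<longlongrightarrow> sqrt (2 * 0)) F"
    by (intro tendsto_intros) simp
  then have lim: "((\<lambda>h. sqrt (2 * cmod (f h - w) powr (p + q))) \<longlongrightarrow> 0) F" by simp
  have "\<forall>\<^sub>F h in F. norm (\<Phi> (f h) - \<Phi> w) \<le> sqrt (2 * cmod (f h - w) powr (p + q))"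
    using ev
  proof eventually_elim
    case (elim h)
    show ?case using real_le_rsqrt[OF dist_\<Phi>[OF elim w]] .
  qed
  then have "((\<lambda>h. \<Phi> (f h) - \<Phi> w) \<longlongrightarrow> 0) F" using lim by (rule Lim_null_comparison)
  then show ?thesis by (rule LIM_zero_cancel)
qed

lemma tendsto_T_\<Phi>:
  assumes g: "g \<in> SU11" and z: "cmod z = 1"
  shows "((\<lambda>h. T h (\<Phi> z)) \<longlongrightarrow> T g (\<Phi> z)) (at g within SU11)"
proof -
  let ?F = "at g within SU11"
  have ev: "\<forall>\<^sub>F h in ?F. h \<in> SU11" by (simp add: eventually_at_filter)
  have lim: "((\<lambda>h. h $ i $ j) \<longlongrightarrow> g $ i $ j) ?F" for i j by (intro tendsto_vec_nth tendsto_ident_at)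
  obtain \<alpha> \<beta> where ab: "g = su \<alpha> \<beta>" "cmod \<beta> < cmod \<alpha>" using SU11E[OF g] by metis
  have a0: "g $ 2 $ 2 \<noteq> 0" using ab by auto
  have den: "g $ 2 $ 1 * z + g $ 2 $ 2 \<noteq> 0" using su_denom_nz[OF ab(2) z] by (simp add: ab)
  have "Re (1 + g $ 2 $ 1 / g $ 2 $ 2 * z) > 0" using Re_denom[OF ab(2) z] by (simp add: ab)
  then have D: "1 + g $ 2 $ 1 / g $ 2 $ 2 * z \<notin> \<real>\<^sub>\<le>\<^sub>0" by (auto simp: complex_nonpos_Reals_iff)
  have "((\<lambda>h. jac h z) \<longlongrightarrow> jac g z) ?F"
    unfolding jac_def E_def using a0 D by (intro tendsto_intros lim) auto
  moreover have "((\<lambda>h. \<Phi> (mob h z)) \<longlongrightarrow> \<Phi> (mob g z)) ?F"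
  proof (rule tendsto_\<Phi>)
    show "((\<lambda>h. mob h z) \<longlongrightarrow> mob g z) ?F" unfolding mob_def using den by (intro tendsto_intros lim)
    show "\<forall>\<^sub>F h in ?F. cmod (mob h z) = 1" using ev by eventually_elim (rule norm_mob[OF _ z])
    show "cmod (mob g z) = 1" using norm_mob[OF g z] .
  qed
  ultimately have "((\<lambda>h. jac h z *\<^sub>C \<Phi> (mob h z)) \<longlongrightarrow> jac g z *\<^sub>C \<Phi> (mob g z)) ?F" by (rule tendsto_scaleC)
  moreover have "\<forall>\<^sub>F h in ?F. jac h z *\<^sub>C \<Phi> (mob h z) = T h (\<Phi> z)"
    using ev by eventually_elim (simp add: T(2) z)
  ultimately have "((\<lambda>h. T h (\<Phi> z)) \<longlongrightarrow> jac g z *\<^sub>C \<Phi> (mob g z)) ?F" by (rule Lim_transform_eventually)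
  then show ?thesis by (simp add: T(2)[OF g z])
qed

text \<open>Strong continuity is clear on the vectors \<Phi>(z). It extends to closed spans because
  the operators near g are uniformly bounded: \<open>form_bound\<close> controls them by the norm of
  the image of the single positive vector \<open>?v\<close>, which itself varies
  continuously.\<close>

lemma tendsto_T:
  assumes g: "g \<in> SU11"
  shows "((\<lambda>h. T h x) \<longlongrightarrow> T g x) (at g within SU11)"
proof -
  let ?F = "at g within SU11"
  have ev: "\<forall>\<^sub>F h in ?F. h \<in> SU11" by (simp add: eventually_at_filter)
  let ?S = "{x. ((\<lambda>h. T h x) \<longlongrightarrow> T g x) ?F}"
  have add: "x + y \<in> ?S" if "x \<in> ?S" "y \<in> ?S" for x y
  proof -
    have "((\<lambda>h. T h x + T h y) \<longlongrightarrow> T g x + T g y) ?F" using that by (auto intro: tendsto_add)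
    moreover have "\<forall>\<^sub>F h in ?F. T h x + T h y = T h (x + y)"
      using ev by eventually_elim (simp add: unitaryD[OF T(1)])
    ultimately have "((\<lambda>h. T h (x + y)) \<longlongrightarrow> T g x + T g y) ?F" by (rule Lim_transform_eventually)
    then show ?thesis by (simp add: unitaryD[OF T(1)[OF g]])
  qed
  have scale: "c *\<^sub>C x \<in> ?S" if "x \<in> ?S" for c x
  proof -
    have "((\<lambda>h. c *\<^sub>C T h x) \<longlongrightarrow> c *\<^sub>C T g x) ?F" using that by (auto intro: tendsto_scaleC)
    moreover have "\<forall>\<^sub>F h in ?F. c *\<^sub>C T h x = T h (c *\<^sub>C x)"
      using ev by eventually_elim (simp add: unitaryD[OF T(1)])
    ultimately have "((\<lambda>h. T h (c *\<^sub>C x)) \<longlongrightarrow> c *\<^sub>C T g x) ?F" by (rule Lim_transform_eventually)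
    then show ?thesis by (simp add: unitaryD[OF T(1)[OF g]])
  qed
  have zero: "0 \<in> ?S"
  proof -
    have "\<forall>\<^sub>F h in ?F. 0 = T h 0" using ev by eventually_elim (simp add: unitaryD[OF T(1)])
    then have "((\<lambda>h. T h 0) \<longlongrightarrow> 0) ?F" by (rule Lim_transform_eventually[OF tendsto_const])
    then show ?thesis by (simp add: unitaryD[OF T(1)[OF g]])
  qed
  have sub: "csubspace ?S" unfolding csubspace_def using zero add scale by blast
  have P: "\<Phi> z \<in> ?S" if "cmod z = 1" for z using tendsto_T_\<Phi>[OF g that] by simp
  let ?v = "\<Phi> 1 + \<Phi> (- 1)"
  define b where "b = norm (T g ?v) + 1"
  have "?v \<in> ?S" by (intro csubspaceD(2)[OF sub] P) simp_all
  then have "((\<lambda>h. norm (T h ?v)) \<longlongrightarrow> norm (T g ?v)) ?F" by (auto intro: tendsto_norm)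
  then have evb: "\<forall>\<^sub>F h in ?F. norm (T h ?v) < b" by (rule order_tendstoD) (simp add: b_def)
  define C where "C = sqrt (36 * (norm ?v / Re (BB ?v ?v))\<^sup>2 * b\<^sup>2 + 6 * (b\<^sup>2 / Re (BB ?v ?v)))"
  have bound: "norm (T h x) \<le> C * norm x" if h: "h \<in> SU11" and b: "norm (T h ?v) \<le> b" for h x
    unfolding C_def by (rule form_bound[OF base_pos _ _ _ b]) (rule unitaryD(4)[OF T(1)[OF h]])+
  have gb: "norm (T g ?v) \<le> b" by (simp add: b_def)
  have "closed ?S" unfolding closed_sequential_limits
  proof (intro allI impI, elim conjE)
    fix f x assume f: "\<forall>n. f n \<in> ?S" "f \<longlonglongrightarrow> x"
    show "x \<in> ?S" unfolding mem_Collect_eq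
    proof (rule tendstoI)
      fix e :: real assume e: "e > 0"
      have "(\<lambda>n. C * norm (x - f n)) \<longlonglongrightarrow> C * norm (x - x)" by (intro tendsto_intros f)
      then have "(\<lambda>n. C * norm (x - f n)) \<longlonglongrightarrow> 0" by simp
      then have "\<forall>\<^sub>F n in sequentially. C * norm (x - f n) < e / 3" by (rule order_tendstoD(2)) (use e in simp)
      then obtain n where n: "C * norm (x - f n) < e / 3" using eventually_happens' sequentially_bot by blast
      have "((\<lambda>h. T h (f n)) \<longlongrightarrow> T g (f n)) ?F" using f(1) by simp
      then have "\<forall>\<^sub>F h in ?F. dist (T h (f n)) (T g (f n)) < e / 3" using e by (intro tendstoD) simp_all
      then show "\<forall>\<^sub>F h in ?F. dist (T h x) (T g x) < e"
        using ev evb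
      proof eventually_elim
        case (elim h)
        have "norm (T h x - T g x) = norm (T h (x - f n) + (T h (f n) - T g (f n)) - T g (x - f n))"
          by (simp add: unitaryD[OF T(1)[OF elim(2)]] unitaryD[OF T(1)[OF g]])
        also have "\<dots> \<le> norm (T h (x - f n)) + norm (T h (f n) - T g (f n)) + norm (T g (x - f n))"
          using norm_triangle_ineq4[of "T h (x - f n) + (T h (f n) - T g (f n))" "T g (x - f n)"]
            norm_triangle_ineq[of "T h (x - f n)" "T h (f n) - T g (f n)"] by linarith
        also have "\<dots> < e / 3 + e / 3 + e / 3"
          using bound[OF elim(2) less_imp_le[OF elim(3)], of "x - f n"] bound[OF g gb, of "x - f n"] n elim(1)
          unfolding dist_norm by linarith
        finally show ?case by (simp add: dist_norm)
      qed
    qed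
  qed
  then have "?S = UNIV" using \<Phi>_total_closed[OF sub] P by blast
  then show ?thesis by blast
qed

text \<open>The quotient inside arcosh tends to 1, an endpoint of the domain of arcosh. Continuity
  can still be used because \<open>reverse_CS\<close> keeps the quotient at least 1.\<close>

lemma orbitally_continuous:
  assumes x: "x \<in> HPts" and g: "g \<in> SU11" and e: "\<epsilon> > 0"
  shows "\<exists>\<delta>>0. \<forall>h\<in>SU11. norm (h - g) < \<delta> \<longrightarrow> hdist (\<rho> h x) (\<rho> g x) < \<epsilon>"
proof -
  obtain v where v: "x = lin v" "Re (BB v v) > 0" using x unfolding HPts_alt by blast
  let ?f = "\<lambda>h. cmod (BB (T h v) (T g v)) / Re (BB v v)"
  have hd: "hdist (\<rho> h x) (\<rho> g x) = arcosh (?f h)" if h: "h \<in> SU11" for h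
    unfolding v(1) \<rho>_lin[OF h] \<rho>_lin[OF g] using v(2)
    by (subst hdist_lin) (simp_all add: unitaryD[OF T(1)[OF h]] unitaryD[OF T(1)[OF g]])
  have ge: "?f h \<ge> 1" if h: "h \<in> SU11" for h
  proof -
    have "(Re (BB v v))\<^sup>2 \<le> (cmod (BB (T h v) (T g v)))\<^sup>2"
      using reverse_CS[of "T g v" "T h v"] v(2)
      by (simp add: unitaryD[OF T(1)[OF h]] unitaryD[OF T(1)[OF g]] power2_eq_square)
    then have "Re (BB v v) \<le> cmod (BB (T h v) (T g v))" by (rule power2_le_imp_le) simp
    then show ?thesis using v(2) by simp
  qed
  have f1: "?f g = 1"
  proof -
    have "cmod (BB v v) = \<bar>Re (BB v v)\<bar>" by (subst BB_self_real) (rule norm_of_real)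
    then show ?thesis using v(2) by (simp add: unitaryD[OF T(1)[OF g]])
  qed
  have "(?f \<longlongrightarrow> cmod (BB (T g v) (T g v)) / Re (BB v v)) (at g within SU11)"
    using v(2) by (intro tendsto_intros tendsto_T[OF g]) simp
  then have "((\<lambda>h. arcosh (?f h)) \<longlongrightarrow> arcosh (?f g)) (at g within SU11)"
    by (rule tendsto_arcosh_strong) (use f1 ge in \<open>auto simp: eventually_at_filter\<close>)
  then have "((\<lambda>h. arcosh (?f h)) \<longlongrightarrow> 0) (at g within SU11)" unfolding f1 by simp
  then have "\<forall>\<^sub>F h in at g within SU11. arcosh (?f h) < \<epsilon>" using e by (rule order_tendstoD)
  then obtain d where d: "d > 0" "\<And>h. h \<in> SU11 \<Longrightarrow> h \<noteq> g \<Longrightarrow> dist h g < d \<Longrightarrow> arcosh (?f h) < \<epsilon>"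
    unfolding eventually_at by blast
  have "hdist (\<rho> h x) (\<rho> g x) < \<epsilon>" if h: "h \<in> SU11" "norm (h - g) < d" for h
  proof (cases "h = g")
    case True
    then show ?thesis using hd[OF g] f1 e by simp
  next
    case False
    then show ?thesis using d(2)[OF h(1)] h hd[OF h(1)] by (simp add: dist_norm)
  qed
  then show ?thesis using d(1) by blast
qed

lemma \<rho>_is_rep: "is_rep \<rho>"
  unfolding is_rep_def
proof (intro conjI ballI allI impI)
  show "\<exists>U. unitaryB U \<and> lifts U (\<rho> g)" if "g \<in> SU11" for g
    using unitary_imp_unitaryB(1,3)[OF T(1)[OF that]] lifted_T(1)[OF that] by blast
  show "\<rho> (g ** h) L = \<rho> g (\<rho> h L)" if "g \<in> SU11" "h \<in> SU11" "L \<in> Lines" for g h L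
    using \<rho>_mult[OF that(1,2)] that(3) unfolding Lines_alt by blast
  show "\<rho> (- mat 1) L = L" if "L \<in> Lines" for L
    using \<rho>_minus_one that unfolding Lines_alt by blast
qed (rule orbitally_continuous)

definition e2 :: l2 where "e2 = complex_of_real (2 powr - (p + q)) *\<^sub>C \<Phi> (- 1)"

lemma pair: "BB (\<Phi> 1) (\<Phi> 1) = 0" "BB e2 e2 = 0" "BB (\<Phi> 1) e2 = 1"
proof -
  show "BB (\<Phi> 1) (\<Phi> 1) = 0" "BB e2 e2 = 0" by (simp_all add: e2_def BB_scale \<Phi>_isotropic)
  have "complex_of_real (2 powr - (p + q)) * complex_of_real (2 powr (p + q)) = 1"
    by (simp flip: of_real_mult powr_add)
  then show "BB (\<Phi> 1) e2 = 1" by (simp add: e2_def BB_scale BB_\<Phi> kap_minus_one)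
qed

lemma lin_e2: "lin e2 = lin (\<Phi> (- 1))"
  unfolding e2_def by (rule lin_scale) simp

lemma T_axis:
  assumes l: "l > 0"
  shows "T (gmat l 0) (\<Phi> 1) = jac (gmat l 0) 1 *\<^sub>C \<Phi> 1" "T (gmat l 0) e2 = jac (gmat l 0) (- 1) *\<^sub>C e2"
    "cmod (jac (gmat l 0) 1) = l powr (p + q)"
proof -
  note g = gmat_SU11[OF l, of 0]
  show "T (gmat l 0) (\<Phi> 1) = jac (gmat l 0) 1 *\<^sub>C \<Phi> 1"
    using T(2)[OF g, of 1] by (simp add: mob_gmat_one[OF l])
  show "T (gmat l 0) e2 = jac (gmat l 0) (- 1) *\<^sub>C e2"
    using T(2)[OF g, of "- 1"] by (simp add: e2_def unitaryD[OF T(1)[OF g]] mob_gmat_minus_one[OF l] mult.commute)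
  have "gmat l 0 $ 2 $ 1 * 1 + gmat l 0 $ 2 $ 2 = complex_of_real l" by (simp add: gmat_su field_simps)
  then show "cmod (jac (gmat l 0) 1) = l powr (p + q)" using norm_jac[OF g, of 1] l by simp
qed

lemma \<rho>_has_ell: "has_ell \<rho> (p + q)"
  unfolding has_ell_def
proof (intro conjI allI impI)
  fix l :: real assume l: "l > 0"
  have "transl_length (\<rho> (gmat l 0)) = \<bar>ln (cmod (jac (gmat l 0) 1))\<bar>"
    by (rule transl_length_axis[OF T(1)[OF gmat_SU11[OF l]] T_axis(1,2)[OF l] pair lifted_T(1)[OF gmat_SU11[OF l]]])
  also have "\<dots> = (p + q) * \<bar>ln l\<bar>"
    using l pq_pos unfolding T_axis(3)[OF l] by (simp add: ln_powr abs_mult)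
  finally show "transl_length (\<rho> (gmat l 0)) = (p + q) * \<bar>ln l\<bar>" .
qed (rule pq_pos)

lemma hyperbolic_fixed:
  assumes l: "l > 0" "l \<noteq> 1" and x: "x \<noteq> 0" "Re (BB x x) \<ge> 0" "\<rho> (gmat l 0) (lin x) = lin x"
  shows "lin x = lin (\<Phi> 1) \<or> lin x = lin (\<Phi> (- 1))"
proof -
  note g = gmat_SU11[OF l(1), of 0]
  obtain k where k: "T (gmat l 0) x = k *\<^sub>C x" using x(3) unfolding \<rho>_lin[OF g] lin_eq_iff by blast
  have "cmod (jac (gmat l 0) 1) \<noteq> 1" unfolding T_axis(3)[OF l(1)] using l pq_pos by (simp add: powr_eq_one_iff_gen)
  from axis_fixed_lines[OF T(1)[OF g] T_axis(1,2)[OF l(1)] pair this x(1,2) k] show ?thesis by (simp add: lin_e2)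
qed

abbreviation rot :: "complex^2^2" where "rot \<equiv> su (cis (pi / 4)) 0"

lemma rot: "rot \<in> SU11" "mob rot z = \<i> * z"
proof -
  show "rot \<in> SU11" by (rule su_in) simp
  have "cis (pi / 4) / cnj (cis (pi / 4)) = \<i>" by (simp add: cis_cnj cis_divide)
  then show "mob rot z = \<i> * z" unfolding mob_su by (metis add.right_neutral complex_cnj_zero mult_zero_left add_0 times_divide_eq_left)
qed

text \<open>Any fixed point or member of an invariant pair must be an endpoint of the axis, yet the
  quarter turn \<open>rot\<close> carries the endpoints 1 and -1 to i and -i.\<close>

lemma \<rho>_non_elementary: "non_elementary \<rho>"
proof -
  note g2 = gmat_SU11[of 2 0, simplified] and g4 = gmat_SU11[of 4 0, simplified]
  have R: "\<rho> rot (lin (\<Phi> 1)) = lin (\<Phi> \<i>)" "\<rho> rot (lin (\<Phi> (- 1))) = lin (\<Phi> (- \<i>))"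
    using \<rho>_\<Phi>[OF rot(1)] by (simp_all add: rot(2))
  have ne: "lin (\<Phi> \<i>) \<noteq> lin (\<Phi> 1)" "lin (\<Phi> \<i>) \<noteq> lin (\<Phi> (- 1))"
    "lin (\<Phi> (- \<i>)) \<noteq> lin (\<Phi> 1)" "lin (\<Phi> (- \<i>)) \<noteq> lin (\<Phi> (- 1))"
    by (rule notI, drule lin_\<Phi>_inj[rotated 2]; simp add: complex_eq_iff)+
  have moved: "\<rho> rot y \<noteq> lin (\<Phi> 1)" "\<rho> rot y \<noteq> lin (\<Phi> (- 1))"
    if "y = lin (\<Phi> 1) \<or> y = lin (\<Phi> (- 1))" for y
    using that by (elim disjE; simp only: R ne not_False_eq_True)+
  have pts: "\<exists>v. x = lin v \<and> v \<noteq> 0 \<and> Re (BB v v) \<ge> 0" if "x \<in> HPts \<union> BdPts" for x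
  proof -
    have "v \<noteq> 0" if "Re (BB v v) > 0" for v using that by (auto simp: BB_0)
    then show ?thesis using that unfolding HPts_alt BdPts_alt by fastforce
  qed
  have axis: "x = lin (\<Phi> 1) \<or> x = lin (\<Phi> (- 1))" if x: "x \<in> HPts \<union> BdPts" and l: "l > 0" "l \<noteq> 1" "\<rho> (gmat l 0) x = x" for x l
    using pts[OF x] hyperbolic_fixed[OF l(1,2)] l(3) by blast
  have "\<not> (\<forall>g\<in>SU11. \<rho> g x = x)" if x: "x \<in> HPts \<union> BdPts" for x
  proof
    assume f: "\<forall>g\<in>SU11. \<rho> g x = x"
    then have "x = lin (\<Phi> 1) \<or> x = lin (\<Phi> (- 1))" using axis[OF x, of 2] g2 by simp
    then show False using moved[of x] f rot(1) by auto
  qed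
  moreover have "\<not> (\<forall>g\<in>SU11. \<rho> g ` {x, y} = {x, y})" if x: "x \<in> BdPts" and y: "y \<in> BdPts" and xy: "x \<noteq> y" for x y
  proof
    assume f: "\<forall>g\<in>SU11. \<rho> g ` {x, y} = {x, y}"
    have s: "\<rho> (gmat 2 0) ` {x, y} = {x, y}" using f g2 by blast
    \<comment> \<open>g(4,0) is the square of g(2,0); a permutation of two points has trivial
      square, so g(4,0) fixes each point of the pair.\<close>
    have sq: "\<rho> (gmat 4 0) u = \<rho> (gmat 2 0) (\<rho> (gmat 2 0) u)" if u: "u \<in> BdPts" for u
    proof -
      obtain v where "u = lin v" using u unfolding BdPts_alt by blast
      moreover have "gmat 4 0 = gmat 2 0 ** gmat 2 0" by (simp add: gmat_mult)
      ultimately show ?thesis using \<rho>_mult[OF g2 g2] by simp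
    qed
    have "{\<rho> (gmat 2 0) x, \<rho> (gmat 2 0) y} = {x, y}" using s by simp
    then have "\<rho> (gmat 2 0) x = x \<and> \<rho> (gmat 2 0) y = y \<or> \<rho> (gmat 2 0) x = y \<and> \<rho> (gmat 2 0) y = x"
      unfolding doubleton_eq_iff .
    then have "\<rho> (gmat 4 0) x = x \<and> \<rho> (gmat 4 0) y = y"
      unfolding sq[OF x] sq[OF y] by metis
    then have "x = lin (\<Phi> 1) \<or> x = lin (\<Phi> (- 1))" "y = lin (\<Phi> 1) \<or> y = lin (\<Phi> (- 1))"
      using axis[of x 4] axis[of y 4] x y by simp_all
    moreover have "\<rho> rot x = x \<or> \<rho> rot x = y" using f rot(1) by auto
    ultimately show False using moved[of x] by metis
  qed
  ultimately show ?thesis unfolding non_elementary_def by blast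
qed

lemma mob_transitive: assumes "cmod z = 1" obtains g where "g \<in> SU11" "mob g 1 = z"
proof
  let ?g = "su (cis (Arg z / 2)) 0"
  show "?g \<in> SU11" by (rule su_in) simp
  have "z \<noteq> 0" using assms by auto
  then have "cis (Arg z) = z" using assms by (simp add: cis_Arg sgn_eq)
  then show "mob ?g 1 = z" by (simp add: mob_su cis_cnj cis_divide)
qed

text \<open>Pushing a positive vector along the axis makes it converge projectively to \<open>\<Phi> 1\<close>.\<close>

lemma axis_limit:
  assumes W: "csubspace W" "closed W" and v: "v \<in> W" "Re (BB v v) > 0"
    and inv: "\<And>l. l > 0 \<Longrightarrow> T (gmat l 0) v \<in> W"
  shows "\<Phi> 1 \<in> W" "BB v (\<Phi> 1) \<noteq> 0"
proof -
  define c where "c = v - BB v e2 *\<^sub>C \<Phi> 1 - BB v (\<Phi> 1) *\<^sub>C e2"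
  note D = hyperbolic_pair_decomp[OF pair, of v, folded c_def]
  have "Re (BB v v) = 2 * Re (BB v e2 * cnj (BB v (\<Phi> 1))) + Re (BB c c)"
    using D(4)[of v] unfolding c_def[symmetric] by (simp add: mult.commute)
  moreover have "Re (BB c c) \<le> 0" using hyperbolic_pair_neg(1)[OF pair D(1,2)] .
  ultimately have nz: "BB v e2 \<noteq> 0" "BB v (\<Phi> 1) \<noteq> 0" using v(2) by auto
  then show "BB v (\<Phi> 1) \<noteq> 0" by simp
  define m where "m k = jac (gmat (real (Suc k)) 0) 1" for k
  define n where "n k = jac (gmat (real (Suc k)) 0) (- 1)" for k
  define U where "U k = T (gmat (real (Suc k)) 0)" for k
  have U: "unitary (U k)" "U k (\<Phi> 1) = m k *\<^sub>C \<Phi> 1" "U k e2 = n k *\<^sub>C e2" "cmod (m k) = real (Suc k) powr (p + q)" for k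
    unfolding U_def m_def n_def using T(1)[OF gmat_SU11] T_axis[of "real (Suc k)"] by simp_all
  note X = axis_multipliers[OF U(1-3) pair]
  have m0: "m k \<noteq> 0" for k by (rule X(2))
  have lim: "(\<lambda>k. real (Suc k) powr - (p + q)) \<longlonglongrightarrow> 0"
    using LIMSEQ_Suc[OF tendsto_neg_powr[of "- (p + q)" real sequentially]] pq_pos filterlim_real_sequentially by simp
  have im: "cmod (1 / m k) = real (Suc k) powr - (p + q)" for k
  proof -
    have "cmod (1 / m k) = 1 / cmod (m k)" by (simp add: norm_divide)
    then show ?thesis unfolding U(4) powr_minus_divide .
  qed
  have nm: "cmod (n k / m k) = real (Suc k) powr - (p + q) * real (Suc k) powr - (p + q)" for k
  proof -
    have "n k / m k = 1 / complex_of_real ((cmod (m k))\<^sup>2)" using X(3)[of k] m0[of k] by simp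
    then have "cmod (n k / m k) = 1 / (cmod (m k))\<^sup>2" by (simp add: norm_divide norm_power)
    also have "\<dots> = cmod (1 / m k) * cmod (1 / m k)" by (simp add: norm_divide power2_eq_square)
    finally show ?thesis unfolding im .
  qed
  have e21: "BB e2 (\<Phi> 1) = 1" using BB_cnj[of "\<Phi> 1" e2] pair by simp
  let ?s = "\<Phi> 1 + e2"
  have s: "BB ?s ?s = 2" by (simp add: BB_lin pair e21)
  \<comment> \<open>A bound uniform in k: every \<open>U k\<close> preserves the form value of
    \<open>c\<close> and keeps it orthogonal to the positive vector \<open>?s\<close>.\<close>
  define C where "C = sqrt ((norm ?s)\<^sup>2 / 2 * (- Re (BB c c)))"
  have Uc: "norm (U k c) \<le> C" for k
  proof -
    have "BB (U k c) (U k (\<Phi> 1)) = 0" "BB (U k c) (U k e2) = 0" by (simp_all add: unitaryD(4)[OF U(1)] D)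
    then have "BB (U k c) (\<Phi> 1) = 0" "BB (U k c) e2 = 0"
      using X(1)[of k] m0[of k] by (auto simp: U(2,3) BB_scale)
    then have "BB (U k c) ?s = 0" by (simp add: BB_add)
    then have "(norm (U k c))\<^sup>2 \<le> (norm ?s)\<^sup>2 / 2 * (- Re (BB c c))"
      using neg_complement[of ?s "U k c"] s by (simp add: unitaryD(4)[OF U(1)])
    then show ?thesis unfolding C_def by (rule real_le_rsqrt)
  qed
  \<comment> \<open>After division by \<open>m k\<close> the component along \<open>\<Phi> 1\<close>
    stays constant, that along \<open>e2\<close> decays like |m k|^(-2), and the bounded remainder
    like |m k|^(-1).\<close>
  define x where "x k = (1 / m k) *\<^sub>C U k v" for k
  have x: "x k = BB v e2 *\<^sub>C \<Phi> 1 + ((BB v (\<Phi> 1) * (n k / m k)) *\<^sub>C e2 + (1 / m k) *\<^sub>C U k c)" for k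
  proof -
    have "U k v = U k (BB v e2 *\<^sub>C \<Phi> 1 + BB v (\<Phi> 1) *\<^sub>C e2 + c)" using D(3) by simp
    also have "\<dots> = (BB v e2 * m k) *\<^sub>C \<Phi> 1 + (BB v (\<Phi> 1) * n k) *\<^sub>C e2 + U k c"
      by (simp add: unitaryD[OF U(1)] U(2,3))
    finally show ?thesis unfolding x_def using m0[of k] by (simp add: scaleC_add add.assoc mult.commute)
  qed
  have "(\<lambda>k. (BB v (\<Phi> 1) * (n k / m k)) *\<^sub>C e2 + (1 / m k) *\<^sub>C U k c) \<longlonglongrightarrow> 0"
  proof (rule Lim_null_comparison)
    let ?r = "\<lambda>k. real (Suc k) powr - (p + q)"
    show "\<forall>\<^sub>F k in sequentially. norm ((BB v (\<Phi> 1) * (n k / m k)) *\<^sub>C e2 + (1 / m k) *\<^sub>C U k c)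
        \<le> cmod (BB v (\<Phi> 1)) * (?r k * ?r k) * norm e2 + ?r k * C"
    proof (intro always_eventually allI)
      fix k
      have "norm ((BB v (\<Phi> 1) * (n k / m k)) *\<^sub>C e2 + (1 / m k) *\<^sub>C U k c)
          \<le> cmod (BB v (\<Phi> 1)) * cmod (n k / m k) * norm e2 + cmod (1 / m k) * norm (U k c)"
        by (rule order_trans[OF norm_triangle_ineq]) (simp only: norm_scaleC norm_mult order_refl)
      also have "\<dots> \<le> cmod (BB v (\<Phi> 1)) * (?r k * ?r k) * norm e2 + ?r k * C"
        unfolding nm im using Uc[of k] by (intro add_mono mult_left_mono order_refl) auto
      finally show "norm ((BB v (\<Phi> 1) * (n k / m k)) *\<^sub>C e2 + (1 / m k) *\<^sub>C U k c)
          \<le> cmod (BB v (\<Phi> 1)) * (?r k * ?r k) * norm e2 + ?r k * C" .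
    qed
    have "(\<lambda>k. cmod (BB v (\<Phi> 1)) * (?r k * ?r k) * norm e2 + ?r k * C)
        \<longlonglongrightarrow> cmod (BB v (\<Phi> 1)) * (0 * 0) * norm e2 + 0 * C"
      by (intro tendsto_intros lim)
    then show "(\<lambda>k. cmod (BB v (\<Phi> 1)) * (?r k * ?r k) * norm e2 + ?r k * C) \<longlonglongrightarrow> 0" by simp
  qed
  then have "x \<longlonglongrightarrow> BB v e2 *\<^sub>C \<Phi> 1 + 0" unfolding x by (intro tendsto_add tendsto_const)
  moreover have "x k \<in> W" for k unfolding x_def U_def by (intro csubspaceD(3)[OF W(1)] inv) simp
  ultimately have "BB v e2 *\<^sub>C \<Phi> 1 + 0 \<in> W" using closed_sequentially[OF W(2)] by blast
  then have "(1 / BB v e2) *\<^sub>C (BB v e2 *\<^sub>C \<Phi> 1) \<in> W" unfolding add_0_right by (rule csubspaceD(3)[OF W(1)])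
  then show "\<Phi> 1 \<in> W" using nz by simp
qed

text \<open>\<open>axis_limit\<close> puts \<open>\<Phi> 1\<close> into W. The group acts
  transitively on the circle, so W contains all \<Phi>(z), and this family is total.\<close>

lemma \<rho>_no_invariant_subspace:
  assumes hyp: "hyp_subspace W" and inv: "\<forall>g\<in>SU11. \<forall>x\<in>projW W. \<rho> g x \<in> projW W"
  shows "projW W = HPts"
proof -
  let ?W = "{x. coord x \<in> W}"
  have W0: "(\<lambda>k. 0) \<in> W" and Wadd: "\<And>x y. x \<in> W \<Longrightarrow> y \<in> W \<Longrightarrow> vadd x y \<in> W" and Wsc: "\<And>c x. x \<in> W \<Longrightarrow> sc c x \<in> W"
    and WL: "W \<subseteq> L2"
    and Wcl: "\<And>f z. (\<forall>n. f n \<in> W) \<Longrightarrow> z \<in> L2 \<Longrightarrow> (\<lambda>n. l2norm (\<lambda>k. f n k - z k)) \<longlonglongrightarrow> 0 \<Longrightarrow> z \<in> W"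
    and Wpos: "\<exists>v\<in>W. Bf v v = 1"
    using hyp unfolding hyp_subspace_def by blast+
  have sub: "csubspace ?W" unfolding csubspace_def
  proof (intro conjI ballI allI)
    have "coord 0 = (\<lambda>k. 0)" by (simp add: coord_eq_0_iff)
    then show "0 \<in> ?W" using W0 by simp
    show "x + y \<in> ?W" if "x \<in> ?W" "y \<in> ?W" for x y using that Wadd by (simp flip: vadd_coord)
    show "c *\<^sub>C x \<in> ?W" if "x \<in> ?W" for c x using that Wsc by (simp flip: sc_coord)
  qed
  have cl: "closed ?W" unfolding closed_sequential_limits
  proof (intro allI impI, elim conjE)
    fix f x assume f: "\<forall>n. f n \<in> ?W" "f \<longlonglongrightarrow> x"
    have "(\<lambda>n. norm (f n - x)) \<longlonglongrightarrow> 0" using f(2) by (simp add: LIM_zero tendsto_norm_zero)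
    moreover have "norm (f n - x) = l2norm (\<lambda>k. coord (f n) k - coord x k)" for n
    proof -
      have "coord (f n - x) = (\<lambda>k. coord (f n) k - coord x k)" by auto
      then show ?thesis unfolding norm_l2norm by simp
    qed
    ultimately have "(\<lambda>n. l2norm (\<lambda>k. coord (f n) k - coord x k)) \<longlonglongrightarrow> 0" by simp
    then have "coord x \<in> W" using Wcl[of "\<lambda>n. coord (f n)" "coord x"] f(1) by simp
    then show "x \<in> ?W" by simp
  qed
  have proj: "projW W = {lin x | x. x \<in> ?W \<and> Re (BB x x) > 0}"
  proof (intro set_eqI iffI)
    fix L assume "L \<in> projW W"
    then obtain w where w: "L = line w" "w \<in> W" "Re (Bf w w) > 0" unfolding projW_def by blast
    then obtain x where "w = coord x" using WL L2_coord by blast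
    then show "L \<in> {lin x | x. x \<in> ?W \<and> Re (BB x x) > 0}" using w by (auto simp: lin_def BB_Bf)
  next
    fix L assume "L \<in> {lin x | x. x \<in> ?W \<and> Re (BB x x) > 0}"
    then show "L \<in> projW W" unfolding projW_def by (auto simp: lin_def BB_Bf)
  qed
  have TW: "T g x \<in> ?W" if g: "g \<in> SU11" and x: "x \<in> ?W" "Re (BB x x) > 0" for g x
  proof -
    have "lin x \<in> projW W" unfolding proj using x by blast
    then have "\<rho> g (lin x) \<in> projW W" using inv g by blast
    then obtain y where "lin (T g x) = lin y" "y \<in> ?W" unfolding proj \<rho>_lin[OF g] by blast
    then obtain c where "T g x = c *\<^sub>C y" unfolding lin_eq_iff by blast
    then show ?thesis using csubspaceD(3)[OF sub \<open>y \<in> ?W\<close>, of c] by simp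
  qed
  obtain w where w: "w \<in> W" "Bf w w = 1" using Wpos by blast
  then obtain v where "w = coord v" using WL L2_coord by blast
  then have v: "v \<in> ?W" "BB v v = 1" using w by (simp_all add: BB_Bf)
  then have v0: "Re (BB v v) > 0" by simp
  have P: "\<Phi> 1 \<in> ?W" "BB v (\<Phi> 1) \<noteq> 0"
    using axis_limit[OF sub cl v(1) v0] TW[OF gmat_SU11 v(1) v0] by blast+
  define \<gamma> where "\<gamma> = BB v (\<Phi> 1)"
  \<comment> \<open>Invariance is assumed for positive lines only, so isotropic vectors are reached
    as differences T g u - T g v of images of positive vectors. With this \<gamma> the cross terms
    add 2 |\<gamma>|^2, so \<open>?u\<close> remains positive.\<close>
  let ?u = "v + \<gamma> *\<^sub>C \<Phi> 1"
  have u: "?u \<in> ?W" by (rule csubspaceD(2)[OF sub v(1) csubspaceD(3)[OF sub P(1)]])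
  have "BB (\<Phi> 1) v = cnj \<gamma>" using BB_cnj[of v "\<Phi> 1"] by (simp add: \<gamma>_def)
  then have "BB ?u ?u = 1 + 2 * (\<gamma> * cnj \<gamma>)" by (simp add: BB_add BB_scale v(2) pair(1) \<gamma>_def[symmetric] mult.commute)
  then have "Re (BB ?u ?u) = 1 + 2 * (cmod \<gamma>)\<^sup>2" unfolding mult_cnj_cmod by (simp del: of_real_power)
  then have uu: "Re (BB ?u ?u) > 0" using zero_le_power2[of "cmod \<gamma>"] by linarith
  have "\<Phi> z \<in> ?W" if z: "cmod z = 1" for z
  proof -
    obtain g where g: "g \<in> SU11" "mob g 1 = z" using mob_transitive[OF z] .
    have "T g ?u - T g v \<in> ?W" by (rule csubspaceD(4)[OF sub TW[OF g(1) u uu] TW[OF g(1) v(1) v0]])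
    moreover have "T g ?u - T g v = (\<gamma> * jac g 1) *\<^sub>C \<Phi> z"
      using T(2)[OF g(1), of 1] by (simp add: unitaryD[OF T(1)[OF g(1)]] g(2))
    ultimately have "(1 / (\<gamma> * jac g 1)) *\<^sub>C ((\<gamma> * jac g 1) *\<^sub>C \<Phi> z) \<in> ?W"
      using csubspaceD(3)[OF sub] by metis
    then show ?thesis using P(2) jac_nz by (simp add: \<gamma>_def)
  qed
  then have "?W = UNIV" using \<Phi>_total_closed[OF sub cl] by blast
  then show ?thesis unfolding proj HPts_alt by auto
qed

lemma \<rho>_irreducible: "irreducible_rep \<rho>"
  unfolding irreducible_rep_def using \<rho>_is_rep \<rho>_non_elementary \<rho>_no_invariant_subspace by blast

text \<open>The quotient is the mixed power of (1 - i)/(1 + i) = -i. Both logarithms have imaginary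
  part below pi/2 in absolute value, so their difference is the principal logarithm of -i.\<close>

lemma kap_ratio: "kap p q \<i> / kap p q (- \<i>) = cis ((q - p) * pi / 2)"
proof -
  have ln1: "Ln (1 - \<i>) - Ln (1 + \<i>) = Ln (- \<i>)"
  proof (rule exp_complex_eqI)
    have "\<bar>Im (Ln (1 - \<i>))\<bar> < pi / 2" "\<bar>Im (Ln (1 + \<i>))\<bar> < pi / 2" by (rule Re_Ln_pos_lt_imp; simp)+
    then show "\<bar>Im (Ln (1 - \<i>) - Ln (1 + \<i>)) - Im (Ln (- \<i>))\<bar> < 2 * pi" by simp
    have "1 - \<i> \<noteq> 0" "1 + \<i> \<noteq> 0" by (simp_all add: complex_eq_iff)
    then have "exp (Ln (1 - \<i>) - Ln (1 + \<i>)) = (1 - \<i>) / (1 + \<i>)" by (simp add: exp_diff)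
    also have "\<dots> = - \<i>" using \<open>1 + \<i> \<noteq> 0\<close> by (simp add: divide_eq_eq algebra_simps)
    also have "\<dots> = exp (Ln (- \<i>))" by (rule exp_Ln[symmetric]) simp
    finally show "exp (Ln (1 - \<i>) - Ln (1 + \<i>)) = exp (Ln (- \<i>))" .
  qed
  have "kap p q \<i> = E (Ln (1 - \<i>))" "kap p q (- \<i>) = E (Ln (1 + \<i>))"
    using kap_E[of \<i>] kap_E[of "- \<i>"] by simp_all
  moreover have "E (Ln (1 - \<i>)) = E (Ln (- \<i>)) * E (Ln (1 + \<i>))"
    unfolding E_add[symmetric] ln1[symmetric] by simp
  ultimately have "kap p q \<i> / kap p q (- \<i>) = E (Ln (- \<i>))" using E_nz by simp
  also have "\<dots> = cis ((q - p) * pi / 2)"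
    by (simp add: E_def cis_conv_exp algebra_simps diff_divide_distrib)
  finally show ?thesis .
qed

text \<open>Any admissible pair lies on the lines of \<open>\<Phi> 1\<close> and
  \<open>\<Phi> (- 1)\<close>: both are fixed by a hyperbolic element, and the parabolic, moving -1
  to -i, tells which is which. Rescaling the second vector by s2 multiplies K(1) by |s2|^2 and
  leaves its argument alone.\<close>

lemma \<rho>_Arg:
  assumes small: "\<bar>q - p\<bar> < 2" shows "Arg_rep \<rho> ((q - p) * pi / 2)"
  unfolding Arg_rep_def
proof (intro conjI allI impI)
  note g1 = gmat_SU11[of 1 1, simplified]
  let ?U = "T (gmat 1 1)" let ?j = "jac (gmat 1 1) 1"
  note U = T(1)[OF g1]
  have "gmat 1 1 $ 2 $ 1 + gmat 1 1 $ 2 $ 2 = 1" by (simp add: gmat_su field_simps)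
  then have j1: "cmod ?j = 1" using norm_jac[OF g1, of 1] by simp
  have U1: "?U (\<Phi> 1) = ?j *\<^sub>C \<Phi> 1" using T(2)[OF g1, of 1] mob_gmat_one[of 1 1] by simp
  \<comment> \<open>The unimodular multiplier at 1 is divided out to obtain the lift that fixes
    \<open>\<Phi> 1\<close>.\<close>
  let ?V = "\<lambda>x. cnj ?j *\<^sub>C ?U x"
  have jj: "?j * cnj ?j = 1" using j1 by (simp add: mult_cnj_cmod)
  have V: "unitary ?V"
    by (rule unitary_scale[OF U]) (simp add: j1)
  have Vl: "lifted ?V (\<rho> (gmat 1 1))"
    using jac_nz by (simp add: lifted_def \<rho>_lin[OF g1] lin_scale)
  have V1: "?V (\<Phi> 1) = \<Phi> 1" using jj by (simp add: U1 mult.commute)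
  have dist: "dist_reps \<rho> (coord (\<Phi> 1)) (coord e2)"
    unfolding dist_reps_def BB_Bf[symmetric] lin_def[symmetric]
    using pair \<rho>_\<Phi>[OF gmat_SU11] by (simp add: lin_e2 mob_gmat_one mob_gmat_minus_one)
  have "K1_of \<rho> (coord (\<Phi> 1)) (coord e2) (BB (?V e2) e2)"
  proof -
    note D = hyperbolic_pair_decomp[OF pair, of "?V e2"]
    let ?c = "?V e2 - BB (?V e2) e2 *\<^sub>C \<Phi> 1 - BB (?V e2) (\<Phi> 1) *\<^sub>C e2"
    have "BB (?V e2) (\<Phi> 1) = BB (?V e2) (?V (\<Phi> 1))" by (simp only: V1)
    also have "\<dots> = BB e2 (\<Phi> 1)" by (rule unitaryD(4)[OF V])
    also have "\<dots> = 1" using BB_cnj[of "\<Phi> 1" e2] pair by simp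
    finally have one: "BB (?V e2) (\<Phi> 1) = 1" .
    note R = unitary_imp_unitaryB[OF V]
    have "coord ?c \<in> Espace (coord (\<Phi> 1)) (coord e2)"
      unfolding Espace_def BB_Bf[symmetric] using D(1,2) by (simp add: BB_Bf)
    moreover have "coord (?V e2) = vadd (vadd (sc (BB (?V e2) e2) (coord (\<Phi> 1))) (coord e2)) (coord ?c)"
      unfolding sc_coord vadd_coord using D(3) one by simp
    ultimately show ?thesis
      unfolding K1_of_def using R(1) R(3)[OF Vl] R(2)[of "\<Phi> 1"] R(2)[of e2] V1
      by (intro exI[of _ "\<lambda>v. coord (?V (l2_of v))"] conjI bexI[of _ "coord ?c"]) simp_all
  qed
  with dist show "\<exists>f1 f2 K. dist_reps \<rho> f1 f2 \<and> K1_of \<rho> f1 f2 K" by blast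
  fix f1 f2 K assume "dist_reps \<rho> f1 f2 \<and> K1_of \<rho> f1 f2 K"
  then have d: "dist_reps \<rho> f1 f2" and K: "K1_of \<rho> f1 f2 K" by auto
  have "f1 \<in> L2" "f2 \<in> L2" using d by (auto simp: dist_reps_def)
  then obtain y1 y2 where y: "f1 = coord y1" "f2 = coord y2" using L2_coord by metis
  have B: "BB y1 y1 = 0" "BB y2 y2 = 0" "BB y1 y2 = 1"
    and fx: "\<And>l b. l > 0 \<Longrightarrow> \<rho> (gmat l b) (lin y1) = lin y1" "\<And>l. l > 0 \<Longrightarrow> \<rho> (gmat l 0) (lin y2) = lin y2"
    using d unfolding dist_reps_def y BB_Bf[symmetric] lin_def[symmetric] by auto
  have ynz: "y1 \<noteq> 0" "y2 \<noteq> 0" using B(3) by (auto simp: BB_0)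
  have mm: "mob (gmat 1 1) (- 1) = - \<i>"
  proof -
    have "1 - \<i> \<noteq> 0" by (simp add: complex_eq_iff)
    then show ?thesis using mob_parabolic[of 1] by (simp add: divide_eq_eq algebra_simps)
  qed
  have "lin y1 \<noteq> lin (\<Phi> (- 1))"
  proof
    assume h: "lin y1 = lin (\<Phi> (- 1))"
    then have "lin (\<Phi> (- \<i>)) = lin (\<Phi> (- 1))" using fx(1)[of 1 1] \<rho>_\<Phi>[OF g1, of "- 1"] by (simp add: mm)
    then have "- \<i> = - 1" by (intro lin_\<Phi>_inj) simp_all
    then show False by (simp add: complex_eq_iff)
  qed
  moreover have "lin y1 = lin (\<Phi> 1) \<or> lin y1 = lin (\<Phi> (- 1))"
    using hyperbolic_fixed[of 2 y1] ynz B fx by simp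
  ultimately obtain s1 where s1: "y1 = s1 *\<^sub>C \<Phi> 1" "s1 \<noteq> 0" using lin_eq_iff[of y1] by blast
  have "lin y2 \<noteq> lin (\<Phi> 1)"
  proof
    assume "lin y2 = lin (\<Phi> 1)"
    then obtain s where "y2 = s *\<^sub>C \<Phi> 1" unfolding lin_eq_iff by blast
    then show False using B(3) by (simp add: s1 BB_scale pair)
  qed
  moreover have "lin y2 = lin (\<Phi> 1) \<or> lin y2 = lin (\<Phi> (- 1))"
    using hyperbolic_fixed[of 2 y2] ynz B fx by simp
  ultimately obtain s2 where s2: "y2 = s2 *\<^sub>C \<Phi> (- 1)" "s2 \<noteq> 0" using lin_eq_iff[of y2] by blast
  obtain S c where S: "unitaryB S" "lifts S (\<rho> (gmat 1 1))" "S f1 = f1" and c: "c \<in> Espace f1 f2"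
    "S f2 = vadd (vadd (sc K f1) f2) c"
    using K unfolding K1_of_def by blast
  obtain c' where c': "c = coord c'" using c(1) L2_coord unfolding Espace_def by blast
  define W where "W = (\<lambda>x. l2_of (S (coord x)))"
  have W: "unitary W" "lifted W (\<rho> (gmat 1 1))" and cW: "coord (W x) = S (coord x)" for x
    unfolding W_def using unitaryB_imp_unitary[OF S(1)] S(2) by blast+
  have "coord (W y1) = coord y1" using cW S(3) y by simp
  then have "W y1 = y1" using coord_inject by blast
  then have "s1 *\<^sub>C W (\<Phi> 1) = s1 *\<^sub>C \<Phi> 1" by (simp add: s1 unitaryD(3)[OF W(1)])
  then have "(1 / s1) *\<^sub>C (s1 *\<^sub>C W (\<Phi> 1)) = (1 / s1) *\<^sub>C (s1 *\<^sub>C \<Phi> 1)" by simp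
  then have W1: "W (\<Phi> 1) = \<Phi> 1" using s1(2) by simp
  have "lin (W (\<Phi> (- 1))) = lin (\<Phi> (- \<i>))"
    using liftedD[OF W(2) \<Phi>_nz[of "- 1"]] \<rho>_\<Phi>[OF g1, of "- 1"] by (simp add: mm)
  then obtain r where r: "W (\<Phi> (- 1)) = r *\<^sub>C \<Phi> (- \<i>)" unfolding lin_eq_iff by blast
  have kn: "kap p q (- \<i>) \<noteq> 0" using kap_nz[of "- \<i>" 1] by (simp add: complex_eq_iff)
  have "BB (W (\<Phi> (- 1))) (W (\<Phi> 1)) = BB (\<Phi> (- 1)) (\<Phi> 1)" by (rule unitaryD(4)[OF W(1)])
  then have "r * kap p q (- \<i>) = of_real (2 powr (p + q))"
    by (simp add: r W1 BB_scale BB_\<Phi> kap_minus_one)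
  \<comment> \<open>The scalar \<open>r\<close> is determined by pairing with the fixed vector
    \<open>\<Phi> 1\<close>: before the motion the kernel value is kap(-1), afterwards
    kap(-i).\<close>
  then have rr: "r = of_real (2 powr (p + q)) / kap p q (- \<i>)" using kn by (simp add: field_simps)
  have "coord (W y2) = coord (K *\<^sub>C y1 + y2 + c')"
    using c(2) unfolding cW y c' sc_coord vadd_coord by (simp only:)
  then have Wy2: "W y2 = K *\<^sub>C y1 + y2 + c'" using coord_inject by blast
  have "BB c' y2 = 0" using c(1) by (simp add: Espace_def y c' BB_Bf)
  then have "K = BB (W y2) y2" unfolding Wy2 by (simp add: BB_lin B)
  also have "\<dots> = s2 * cnj s2 * (r * kap p q \<i>)"
    by (simp add: s2 unitaryD(3)[OF W(1)] r BB_scale BB_\<Phi> mult_ac)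
  also have "\<dots> = of_real ((cmod s2)\<^sup>2 * 2 powr (p + q)) * cis ((q - p) * pi / 2)"
    unfolding mult_cnj_cmod rr kap_ratio[symmetric] by simp
  finally have KK: "K = of_real ((cmod s2)\<^sup>2 * 2 powr (p + q)) * cis ((q - p) * pi / 2)" .
  have "Arg K = Arg (cis ((q - p) * pi / 2))"
    unfolding KK using s2(2) by (intro Arg_times_of_real) simp
  also have "\<dots> = (q - p) * pi / 2"
  proof (rule Arg_cis)
    \<comment> \<open>\<open>small\<close> keeps the angle in the principal range of
      \<open>Arg\<close>.\<close>
    have "\<bar>q - p\<bar> * (pi / 2) < 2 * (pi / 2)" using small by (intro mult_strict_right_mono) auto
    then have "\<bar>(q - p) * pi / 2\<bar> < pi" by (simp add: abs_mult)
    then show "(q - p) * pi / 2 \<in> {- pi<..pi}" by (auto simp: abs_less_iff)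
  qed
  finally show "Arg K = (q - p) * pi / 2" .
qed

end

section \<open>From admissible parameters to exponents\<close>

text \<open>With \<theta> = arg K and d = (t - 1) pi/2, the two half-plane conditions say cos
  (\<theta> + d) >= 0 and cos (\<theta> - d) >= 0. Both angles are below pi in absolute value, so
  both are at most pi/2, and together they bound |\<theta>| + |d|.\<close>

lemma admissible_Arg:
  assumes "admissible t K"
  shows "\<bar>Arg K\<bar> < pi / 2" "\<bar>Arg K\<bar> + \<bar>t - 1\<bar> * pi / 2 \<le> pi / 2"
proof -
  define \<theta> where "\<theta> = Arg K"
  have t: "0 < t" "t < 2" and K: "Re K > 0"
    and s: "0 \<le> Re (K * cis ((t - 1) * pi / 2))" "0 \<le> Re (K * cis (- ((t - 1) * pi / 2)))"
    using assms by (auto simp: admissible_def)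
  have K0: "K \<noteq> 0" using K by auto
  have polar: "K = of_real (cmod K) * cis \<theta>" unfolding \<theta>_def using K0 by (simp add: cis_Arg sgn_eq)
  have th: "\<bar>\<theta>\<bar> < pi / 2" unfolding \<theta>_def using Re_Ln_pos_lt_imp[OF K] K0 by (simp add: Arg_eq_Im_Ln)
  then show "\<bar>Arg K\<bar> < pi / 2" by (simp add: \<theta>_def)
  define d where "d = (t - 1) * pi / 2"
  have d: "\<bar>d\<bar> < pi / 2" using t by (simp add: d_def abs_mult)
  have eq: "Re (K * cis x) = cmod K * cos (\<theta> + x)" for x
    by (subst polar) (simp only: mult.assoc cis_mult, simp)
  have "0 \<le> cmod K * cos (\<theta> + d)" "0 \<le> cmod K * cos (\<theta> + - d)" using s unfolding d_def[symmetric] eq .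
  then have c: "0 \<le> cos (\<theta> + d)" "0 \<le> cos (\<theta> - d)" using K0 by (auto simp: zero_le_mult_iff)
  have le: "\<bar>x\<bar> \<le> pi / 2" if "0 \<le> cos x" "\<bar>x\<bar> < pi" for x
  proof (rule ccontr)
    assume "\<not> ?thesis"
    then have "cos (pi / 2) > cos \<bar>x\<bar>" using that(2) by (intro cos_monotone_0_pi) auto
    then show False using that(1) by simp
  qed
  have "\<bar>\<theta> + d\<bar> \<le> pi / 2" "\<bar>\<theta> - d\<bar> \<le> pi / 2" using th d by (intro le c; linarith)+
  then have "\<bar>\<theta>\<bar> + \<bar>d\<bar> \<le> pi / 2" by linarith
  then show "\<bar>Arg K\<bar> + \<bar>t - 1\<bar> * pi / 2 \<le> pi / 2" by (simp add: \<theta>_def d_def abs_mult)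
qed

lemma admissible_realised:
  assumes "admissible t K"
  shows "\<exists>\<rho>. irreducible_rep \<rho> \<and> has_ell \<rho> t \<and> Arg_rep \<rho> (Arg K)"
proof -
  define \<sigma> where "\<sigma> = Arg K / pi"
  have t: "0 < t" "t < 2" using assms by (auto simp: admissible_def)
  have s1: "\<bar>\<sigma>\<bar> < 1 / 2" using admissible_Arg(1)[OF assms] by (simp add: \<sigma>_def abs_divide divide_less_eq)
  have s2: "\<bar>\<sigma>\<bar> + \<bar>t - 1\<bar> / 2 \<le> 1 / 2"
  proof -
    have "(\<bar>\<sigma>\<bar> + \<bar>t - 1\<bar> / 2) * pi \<le> 1 / 2 * pi"
      using admissible_Arg(2)[OF assms] by (simp add: \<sigma>_def abs_divide algebra_simps)
    then show ?thesis by (simp only: mult_le_cancel_right_pos[OF pi_gt_zero])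
  qed
  define p where "p = t / 2 - \<sigma>"
  define q where "q = t / 2 + \<sigma>"
  \<comment> \<open>|\<sigma>| + |t - 1|/2 <= 1/2 unfolds to |\<sigma>| <= t/2 and |\<sigma>| <= 1 -
    t/2, that is to p and q in [0,1]. The strict bounds on t and \<sigma> exclude the
    corners.\<close>
  interpret model p q
    by unfold_locales (use s1 s2 t in \<open>auto simp: p_def q_def abs_le_iff abs_less_iff abs_if split: if_splits\<close>)
  have pq: "p + q = t" "(q - p) * pi / 2 = Arg K" by (simp_all add: p_def q_def \<sigma>_def)
  have "\<bar>q - p\<bar> < 2" using s1 by (simp add: p_def q_def)
  then show ?thesis using \<rho>_irreducible \<rho>_has_ell \<rho>_Arg unfolding pq by blast
qed

theorem mainTheorem2:
  fixes \<rho>1 \<rho>2 :: "complex^2^2 \<Rightarrow> vect set \<Rightarrow> vect set"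
    and t :: real and e1 e2 :: vect and K1 K2 :: complex
  assumes "irreducible_rep \<rho>1" and "irreducible_rep \<rho>2"
    and "has_ell \<rho>1 t" and "has_ell \<rho>2 t"
    and "dist_reps \<rho>1 e1 e2" and "dist_reps \<rho>2 e1 e2"
    and "K1_of \<rho>1 e1 e2 K1" and "K1_of \<rho>2 e1 e2 K2"
  shows "\<exists>\<rho>. irreducible_rep \<rho> \<and> has_ell \<rho> t \<and> Arg_rep \<rho> (Arg (K1 + K2))"
  using assms by (intro admissible_realised admissible_add K1_admissible)

end
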